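(* Assume (A1), (A2), (A3), (A4) and (A5). Let $\theta,\beta\in(0,1)$. For $\varepsilon,\lambda>0$ let $u^\varepsilon$ be the viscosity solution of $$\partial_t^\alpha u^\varepsilon + H\left(\tfrac{x}{\varepsilon}, Du^\varepsilon\right)=0 \ \text{ in } \mathbb{R}^N\times(0,T),\qquad u^\varepsilon(\cdot,0)=u_0 \ \text{ on } \mathbb{R}^N,$$ let $\overline u$ be the viscosity solution of $$\partial_t^\alpha \overline{u} + \overline{H}(D\overline{u})=0 \ \text{ in } \mathbb{R}^N\times(0,T),\qquad \overline{u}(\cdot,0)=u_0 \ \text{ on } \mathbb{R}^N,$$ and, for each $p\in\mathbb{R}^N$, let $v^\lambda(\cdot,p)$ be the viscosity solution of $$\lambda v^\lambda(y,p)+H(y,p+Dv^\lambda(y,p))=0\quad\text{in }\mathbb{R}^N .$$ For $\varepsilon,\delta\in(0,1)$ and $R>0$, with $\lambda=\varepsilon^\theta$, define $\Phi:\mathbb{R}^{2N}\times[0,T]\to\mathbb{R}$ by $$\Phi(x,y,t)=u^\varepsilon(x,t)-\overline u(y,t)-\varepsilon v^\lambda\left(\frac{x}{\varepsilon},\frac{x-y}{\varepsilon^\beta}\right)-\frac{|x-y|^2}{2\varepsilon^\beta}-\frac{\delta|y|^2}{2}-\frac{Rt^\alpha}{\Gamma(1+\alpha)} .$$ Then there exists $\varepsilon_0\in(0,1)$ such that for each $\nu\in(0,1)$ there exists $C>0$, independent of $\varepsilon$ (and of the choice of $\delta$, $R$ and the maximum point), such that for all $\varepsilon\in(0,\varepsilon_0)$: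 if $\delta^{1/2}<\lambda=\varepsilon^\theta$ and $\Phi$ attains its maximum over $\mathbb{R}^{2N}\times[0,T]$ at a point $(\hat x,\hat y,\hat t)\in\mathbb{R}^{2N}\times(0,T]$, then $$J[u^\varepsilon](\hat x,\hat t)-J[\overline u](\hat y,\hat t)+K_{(0,\hat t)}[u^\varepsilon](\hat x,\hat t)-K_{(0,\hat t)}[\overline u](\hat y,\hat t)\le C\left(\varepsilon^{\theta-\frac{\beta(1-\nu)}{2-\nu}}+\varepsilon^{1-\theta-\beta}\right).$$
   Context: $T>0$ and $\alpha\in(0,1)$ are fixed constants. $H:\mathbb{R}^N\times\mathbb{R}^N\to\mathbb{R}$, $(y,p)\mapsto H(y,p)$, and $u_0:\mathbb{R}^N\to\mathbb{R}$ are continuous. The assumptions are: (A1) $\lim_{r\to\infty}\inf\{H(y,p): y\in\mathbb{R}^N, |p|\ge r\}=\infty$. (A2) $H(y+k,p)=H(y,p)$ for all $y,p\in\mathbb{R}^N$, $k\in\mathbb{Z}^N$. (A3) $u_0\in \mathrm{Lip}(\mathbb{R}^N)\cap \mathrm{BUC}(\mathbb{R}^N)$ ($u_0$ is Lipschitz, bounded and uniformly continuous). (A4) There exists $C>0$ such that $|H(x,p)-H(y,q)|\le C(|x-y|+|p-q|)$ for all $x,y,p,q\in\mathbb{R}^N$. (A5) There exists $C>0$ such that $H(x,p)\ge C^{-1}|p|-C$ for all $x,p\in\mathbb{R}^N$. Caputo derivative: $\partial_t^\alpha u(x,t)=\frac{1}{\Gamma(1-\alpha)}\int_0^t (t-s)^{-\alpha}\partial_s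 u(x,s)\,ds$. For a function $f$ of $(x,t)$, $t\in(0,T]$ and $0\le a<b\le t$ put $$J[f](x,t)=\frac{f(x,t)-f(x,0)}{t^\alpha\,\Gamma(1-\alpha)},\qquad K_{(a,b)}[f](x,t)=\frac{\alpha}{\Gamma(1-\alpha)}\int_a^b\frac{f(x,t)-f(x,t-\tau)}{\tau^{\alpha+1}}\,d\tau .$$ The difference $K_{(0,\hat t)}[u^\varepsilon](\hat x,\hat t)-K_{(0,\hat t)}[\overline u](\hat y,\hat t)$ is understood as $\lim_{r\to0^+}\big(K_{(r,\hat t)}[u^\varepsilon](\hat x,\hat t)-K_{(r,\hat t)}[\overline u](\hat y,\hat t)\big)$, i.e. as the integral over $(0,\hat t)$ of the difference of the two integrands. Viscosity solutions: for a continuous $F:\mathbb{R}^N\times\mathbb{R}^N\to\mathbb{R}$, an upper semicontinuous $u:\mathbb{R}^N\times[0,T]\to\mathbb{R}$ is a viscosity subsolution of $\partial_t^\alpha u+F(x,Du)=0$, $u(\cdot,0)=u_0$, if $u(\cdot,0)\le u_0$ and, for every $\varphi\in C^1(\mathbb{R}^N\times(0,T])\cap C(\mathbb{R}^N\times[0,T])$, whenever $u-\varphi$ attains a maximum over $\mathbb{R}^N\times[0,T]$ at $(\hat x,\hat t)\in\mathbb{R}^N\times(0,T]$, $$J[\varphi](\hat x,\hat t)+K_{(0,\hat t)}[\varphi](\hat x,\hat t)+F(\hat x,D\varphi(\hat x,\hat t))\le 0 .$$ A lower semicontinuous $u$ is a viscosity supersolution if $u(\cdot,0)\ge u_0$ and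 the reverse inequality ($\ge 0$) holds whenever $u-\varphi$ attains a minimum over $\mathbb{R}^N\times[0,T]$ at $(\hat x,\hat t)\in\mathbb{R}^N\times(0,T]$. A continuous function is a viscosity solution if it is both. Here $D$ is the gradient in $x$. The problem for $u^\varepsilon$ corresponds to $F(x,p)=H(x/\varepsilon,p)$, and the problem for $\overline u$ to $F(x,p)=\overline H(p)$. "The viscosity solution" of these evolution problems means the unique viscosity solution in $\mathrm{BUC}(\mathbb{R}^N\times[0,T])$; $v^\lambda(\cdot,p)$ is the unique bounded (hence $\mathbb{Z}^N$-periodic) continuous viscosity solution, in the usual sense, of the stationary equation, with $D$ the gradient in $y$. Effective Hamiltonian: for each $p\in\mathbb{R}^N$, $\overline H(p)\in\mathbb{R}$ is the unique constant for which the cell problem $H(y,p+Dv(y))=\overline H(p)$ in $\mathbb{T}^N=\mathbb{R}^N/\mathbb{Z}^N$ has a continuous viscosity solution $v$. *)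

theory Defs
  imports "HOL-Analysis.Analysis"
begin

(* Functions of (x,t) are functions on pairs; only their values on UNIV \<times> {0..T} matter. *)

definition J :: "real \<Rightarrow> ('a \<times> real \<Rightarrow> real) \<Rightarrow> 'a \<Rightarrow> real \<Rightarrow> real" where
  "J \<alpha> f x t = (f (x, t) - f (x, 0)) / (t powr \<alpha> * Gamma (1 - \<alpha>))"

definition K :: "real \<Rightarrow> real \<Rightarrow> real \<Rightarrow> ('a \<times> real \<Rightarrow> real) \<Rightarrow> 'a \<Rightarrow> real \<Rightarrow> real" where
  "K \<alpha> a b f x t = \<alpha> / Gamma (1 - \<alpha>) *
     (LINT \<tau>:{a<..<b}|lborel. (f (x, t) - f (x, t - \<tau>)) / \<tau> powr (\<alpha> + 1))"

(* G is the full gradient of \<phi> on S.  Derivatives are taken within S, so that they are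
   one-sided in time at t = T when S = UNIV \<times> {0<..T}. *)
definition C1_on :: "'a::euclidean_space set \<Rightarrow> ('a \<Rightarrow> real) \<Rightarrow> ('a \<Rightarrow> 'a) \<Rightarrow> bool" where
  "C1_on S \<phi> G \<longleftrightarrow> continuous_on S G \<and>
     (\<forall>z\<in>S. (\<phi> has_derivative (\<lambda>h. G z \<bullet> h)) (at z within S))"

definition usc_on :: "'a::topological_space set \<Rightarrow> ('a \<Rightarrow> real) \<Rightarrow> bool" where
  "usc_on S f \<longleftrightarrow> (\<forall>z\<in>S. \<forall>c>f z. eventually (\<lambda>w. f w < c) (at z within S))"

definition lsc_on :: "'a::topological_space set \<Rightarrow> ('a \<Rightarrow> real) \<Rightarrow> bool" where
  "lsc_on S f \<longleftrightarrow> (\<forall>z\<in>S. \<forall>c<f z. eventually (\<lambda>w. c < f w) (at z within S))"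

text \<open>Viscosity solutions of \<open>\<partial>\<^sub>t\<^sup>\<alpha> u + F(x, Du) = 0\<close>, \<open>u(\<cdot>,0) = u0\<close>. For a
  test function with space-time gradient \<open>G\<close>, its spatial gradient is \<open>fst \<circ> G\<close>.\<close>

definition evol_test_function ::
  "real \<Rightarrow> ('a::euclidean_space \<times> real \<Rightarrow> real) \<Rightarrow> ('a \<times> real \<Rightarrow> 'a \<times> real) \<Rightarrow> bool" where
  "evol_test_function T \<phi> G \<longleftrightarrow>
     C1_on (UNIV \<times> {0<..T}) \<phi> G \<and> continuous_on (UNIV \<times> {0..T}) \<phi>"

definition evol_visc_subsolution ::
  "real \<Rightarrow> real \<Rightarrow> ('a::euclidean_space \<Rightarrow> 'a \<Rightarrow> real) \<Rightarrow> ('a \<Rightarrow> real) \<Rightarrow> ('a \<times> real \<Rightarrow> real) \<Rightarrow> bool" where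
  "evol_visc_subsolution \<alpha> T F u0 u \<longleftrightarrow>
     usc_on (UNIV \<times> {0..T}) u \<and> (\<forall>x. u (x, 0) \<le> u0 x) \<and>
     (\<forall>\<phi> G x t. evol_test_function T \<phi> G \<and> t \<in> {0<..T} \<and>
        (\<forall>z\<in>UNIV \<times> {0..T}. u z - \<phi> z \<le> u (x, t) - \<phi> (x, t)) \<longrightarrow>
        J \<alpha> \<phi> x t + K \<alpha> 0 t \<phi> x t + F x (fst (G (x, t))) \<le> 0)"

definition evol_visc_supersolution ::
  "real \<Rightarrow> real \<Rightarrow> ('a::euclidean_space \<Rightarrow> 'a \<Rightarrow> real) \<Rightarrow> ('a \<Rightarrow> real) \<Rightarrow> ('a \<times> real \<Rightarrow> real) \<Rightarrow> bool" where
  "evol_visc_supersolution \<alpha> T F u0 u \<longleftrightarrow>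
     lsc_on (UNIV \<times> {0..T}) u \<and> (\<forall>x. u (x, 0) \<ge> u0 x) \<and>
     (\<forall>\<phi> G x t. evol_test_function T \<phi> G \<and> t \<in> {0<..T} \<and>
        (\<forall>z\<in>UNIV \<times> {0..T}. u z - \<phi> z \<ge> u (x, t) - \<phi> (x, t)) \<longrightarrow>
        J \<alpha> \<phi> x t + K \<alpha> 0 t \<phi> x t + F x (fst (G (x, t))) \<ge> 0)"

definition evol_visc_solution ::
  "real \<Rightarrow> real \<Rightarrow> ('a::euclidean_space \<Rightarrow> 'a \<Rightarrow> real) \<Rightarrow> ('a \<Rightarrow> real) \<Rightarrow> ('a \<times> real \<Rightarrow> real) \<Rightarrow> bool" where
  "evol_visc_solution \<alpha> T F u0 u \<longleftrightarrow>
     continuous_on (UNIV \<times> {0..T}) u \<and>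
     evol_visc_subsolution \<alpha> T F u0 u \<and> evol_visc_supersolution \<alpha> T F u0 u"

definition BUC_on :: "'a::metric_space set \<Rightarrow> ('a \<Rightarrow> real) \<Rightarrow> bool" where
  "BUC_on S f \<longleftrightarrow> bounded (f ` S) \<and> uniformly_continuous_on S f"

text \<open>Continuous viscosity solutions of the stationary equation \<open>F(y, v(y), Dv(y)) = 0\<close>
  on the whole space, tested at local extrema.\<close>

definition stat_visc_solution ::
  "('a::euclidean_space \<Rightarrow> real \<Rightarrow> 'a \<Rightarrow> real) \<Rightarrow> ('a \<Rightarrow> real) \<Rightarrow> bool" where
  "stat_visc_solution F v \<longleftrightarrow>
     continuous_on UNIV v \<and>
     (\<forall>\<phi> G y. C1_on UNIV \<phi> G \<and> eventually (\<lambda>z. v z - \<phi> z \<le> v y - \<phi> y) (nhds y) \<longrightarrow>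
        F y (v y) (G y) \<le> 0) \<and>
     (\<forall>\<phi> G y. C1_on UNIV \<phi> G \<and> eventually (\<lambda>z. v z - \<phi> z \<ge> v y - \<phi> y) (nhds y) \<longrightarrow>
        F y (v y) (G y) \<ge> 0)"

definition integer_vec :: "real ^ 'n \<Rightarrow> bool" where
  "integer_vec k \<longleftrightarrow> (\<forall>i. k $ i \<in> \<int>)"

(* Functions on the torus are integer-periodic functions on the whole space. *)
definition cell_solution ::
  "(real ^ 'n \<Rightarrow> real ^ 'n \<Rightarrow> real) \<Rightarrow> real ^ 'n \<Rightarrow> real \<Rightarrow> (real ^ 'n \<Rightarrow> real) \<Rightarrow> bool" where
  "cell_solution H p c v \<longleftrightarrow>
     (\<forall>y k. integer_vec k \<longrightarrow> v (y + k) = v y) \<and>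
     stat_visc_solution (\<lambda>y r q. H y (p + q) - c) v"

(* Hbar p is the unique constant for which the cell problem at p is solvable. *)
definition effective_hamiltonian ::
  "(real ^ 'n \<Rightarrow> real ^ 'n \<Rightarrow> real) \<Rightarrow> (real ^ 'n \<Rightarrow> real) \<Rightarrow> bool" where
  "effective_hamiltonian H Hbar \<longleftrightarrow> (\<forall>p c. (\<exists>v. cell_solution H p c v) \<longleftrightarrow> c = Hbar p)"

(* w is the function v^\<lambda>(y, p) with \<lambda> = \<epsilon>^\<theta>, u is u^\<epsilon> and ub is the homogenized solution. *)
definition Phi ::
  "real \<Rightarrow> real \<Rightarrow> real \<Rightarrow> real \<Rightarrow> real \<Rightarrow> ('a::euclidean_space \<times> real \<Rightarrow> real) \<Rightarrow>
   ('a \<times> real \<Rightarrow> real) \<Rightarrow> ('a \<Rightarrow> 'a \<Rightarrow> real) \<Rightarrow> 'a \<Rightarrow> 'a \<Rightarrow> real \<Rightarrow> real" where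
  "Phi \<alpha> \<beta> \<epsilon> \<delta> R u ub w x y t =
     u (x, t) - ub (y, t)
     - \<epsilon> * w (x /\<^sub>R \<epsilon>) ((x - y) /\<^sub>R (\<epsilon> powr \<beta>))
     - (norm (x - y))\<^sup>2 / (2 * \<epsilon> powr \<beta>)
     - \<delta> * (norm y)\<^sup>2 / 2
     - R * t powr \<alpha> / Gamma (1 + \<alpha>)"

end

theory Submission
  imports Defs
begin

text \<open>
  Write \<open>p = (xh - yh) / \<epsilon>\<^sup>\<beta>\<close>, where \<open>(xh, yh, th)\<close> is the maximum point, and \<open>\<lambda> = \<epsilon>\<^sup>\<theta>\<close>. Formally, at
  the maximum point the gradient of the oscillating solution is \<open>p + Dv\<close> and that of the homogenised
  one is \<open>p - \<delta> yh\<close>, so that subtracting the two equations leaves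
  \<open>Hbar(p - \<delta> yh) - H(xh / \<epsilon>, p + Dv) = Hbar(p - \<delta> yh) + \<lambda> v\<close> up to the dependence of the corrector \<open>v\<close>
  on its second argument. The Lipschitz constant of \<open>v\<close> in that argument is \<open>C / \<lambda>\<close>, which
  contributes an error of order \<open>E = C \<epsilon>\<^sup>1\<^sup>-\<^sup>\<theta>\<^sup>-\<^sup>\<beta>\<close>, and \<open>\<lambda> v + Hbar(p) = O(\<lambda> (1 + |p|))\<close>. It
  remains to bound \<open>p\<close> and to show \<open>\<delta> |yh| = O(\<lambda>)\<close>. The first follows from the Lipschitz continuity of
  \<open>ubar\<close> in space, which gives \<open>|p - \<delta> yh| \<le> L + E\<close>; the second from comparing the maximum with the
  value at the origin, once the oscillating solutions are
  bounded above uniformly in \<open>\<epsilon>\<close>. If \<open>1 - \<theta> - \<beta> < 0\<close> these last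
  bounds are unavailable, but then a bound of order \<open>1 + E\<close> is enough, and it follows from
  \<open>H\<close> being bounded below.

  Two difficulties separate this formal argument from a proof. The nonlocal terms of the two solutions need
  not exist separately, and \<open>v\<close> is not differentiable. Both are settled by
  \<open>nonlocal_comparison_at_maximum\<close>, which doubles the time variable and the argument of \<open>v\<close>. There the
  viscosity inequalities are used in a form in which the test function is needed only near the contact
  time (\<open>nonlocal_subsolution\<close>). The increments of the difference of the solutions are
  nonnegative at the maximum, which yields the existence of the limit in the claim together with
  the bound. The same lemma gives the Lipschitz continuity of \<open>ubar\<close> (\<open>evol_solution_lipschitz\<close>).
  The facts on \<open>v\<close> and \<open>Hbar\<close> come from a comparison principle for the discounted stationary equation
  (\<open>stationary_comparison\<close>) and a bound of the oscillation of cell solutions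
  (\<open>cell_solution_oscillation\<close>); the estimate itself is assembled in \<open>corrected_maximum_estimate\<close>.
\<close>

section \<open>Continuously differentiable test functions\<close>

lemma C1_onI:
  assumes "continuous_on S G" "\<And>z. z \<in> S \<Longrightarrow> (\<phi> has_derivative (\<lambda>h. G z \<bullet> h)) (at z within S)"
  shows "C1_on S \<phi> G"
  using assms by (auto simp: C1_on_def)

lemma C1_on_imp_continuous_on: "C1_on S f F \<Longrightarrow> continuous_on S f"
  unfolding C1_on_def by (meson continuous_on_eq_continuous_within has_derivative_continuous)

lemma C1_on_subset: "C1_on S f F \<Longrightarrow> S' \<subseteq> S \<Longrightarrow> C1_on S' f F"
  unfolding C1_on_def by (meson continuous_on_subset has_derivative_subset subsetD)

lemma C1_on_const: "C1_on S (\<lambda>_. c) (\<lambda>_. 0)"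
  by (auto simp: C1_on_def)

lemma C1_on_add:
  assumes "C1_on S f F" "C1_on S g G"
  shows "C1_on S (\<lambda>z. f z + g z) (\<lambda>z. F z + G z)"
proof (rule C1_onI)
  show "continuous_on S (\<lambda>z. F z + G z)"
    using assms unfolding C1_on_def by (auto intro!: continuous_intros)
  fix z assume z: "z \<in> S"
  have "((\<lambda>z. f z + g z) has_derivative (\<lambda>h. F z \<bullet> h + G z \<bullet> h)) (at z within S)"
    using assms z unfolding C1_on_def by (intro has_derivative_add) auto
  then show "((\<lambda>z. f z + g z) has_derivative (\<lambda>h. (F z + G z) \<bullet> h)) (at z within S)"
    by (simp add: inner_add_left)
qed

lemma C1_on_mult:
  assumes "C1_on S f F" "C1_on S g G"
  shows "C1_on S (\<lambda>z. f z * g z) (\<lambda>z. f z *\<^sub>R G z + g z *\<^sub>R F z)"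
proof (rule C1_onI)
  show "continuous_on S (\<lambda>z. f z *\<^sub>R G z + g z *\<^sub>R F z)"
    using assms assms[THEN C1_on_imp_continuous_on] unfolding C1_on_def
    by (auto intro!: continuous_intros)
  fix z assume z: "z \<in> S"
  have "((\<lambda>z. f z * g z) has_derivative (\<lambda>h. f z * (G z \<bullet> h) + (F z \<bullet> h) * g z)) (at z within S)"
    using assms z unfolding C1_on_def by (intro has_derivative_mult) auto
  then show "((\<lambda>z. f z * g z) has_derivative (\<lambda>h. (f z *\<^sub>R G z + g z *\<^sub>R F z) \<bullet> h)) (at z within S)"
    by (simp add: inner_add_left mult.commute)
qed

lemma C1_on_cmult: "C1_on S f F \<Longrightarrow> C1_on S (\<lambda>z. c * f z) (\<lambda>z. c *\<^sub>R F z)"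
  using C1_on_mult[OF C1_on_const[of S c], of f F] by simp

lemma C1_on_uminus: "C1_on S f F \<Longrightarrow> C1_on S (\<lambda>z. - f z) (\<lambda>z. - F z)"
  using C1_on_cmult[of S f F "-1"] by simp

lemma C1_on_fst:
  assumes "C1_on X f F"
  shows "C1_on (X \<times> Y) (\<lambda>z. f (fst z)) (\<lambda>z. (F (fst z), 0))"
proof (rule C1_onI)
  show "continuous_on (X \<times> Y) (\<lambda>z. (F (fst z), 0))"
    using assms unfolding C1_on_def
    by (intro continuous_on_Pair continuous_intros continuous_on_compose2[of X F _ fst]) auto
  fix z assume z: "z \<in> X \<times> Y"
  have "(f has_derivative (\<lambda>h. F (fst z) \<bullet> h)) (at (fst z) within X)"
    using assms z unfolding C1_on_def by auto
  then have "((\<lambda>z. f (fst z)) has_derivative (\<lambda>h. F (fst z) \<bullet> fst h)) (at z within X \<times> Y)"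
    using z
    by (intro has_derivative_in_compose2[of X f "\<lambda>x h. F x \<bullet> h" fst "X \<times> Y" z fst])
       (use assms in \<open>auto simp: C1_on_def intro: derivative_eq_intros\<close>)
  then show "((\<lambda>z. f (fst z)) has_derivative (\<lambda>h. (F (fst z), 0) \<bullet> h)) (at z within X \<times> Y)"
    by (simp add: inner_prod_def)
qed

lemma C1_on_snd:
  assumes "C1_on Y f F"
  shows "C1_on (X \<times> Y) (\<lambda>z. f (snd z)) (\<lambda>z. (0, F (snd z)))"
proof (rule C1_onI)
  show "continuous_on (X \<times> Y) (\<lambda>z. (0, F (snd z)))"
    using assms unfolding C1_on_def
    by (intro continuous_on_Pair continuous_intros continuous_on_compose2[of Y F _ snd]) auto
  fix z assume z: "z \<in> X \<times> Y"
  have "((\<lambda>z. f (snd z)) has_derivative (\<lambda>h. F (snd z) \<bullet> snd h)) (at z within X \<times> Y)"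
    using z
    by (intro has_derivative_in_compose2[of Y f "\<lambda>x h. F x \<bullet> h" snd "X \<times> Y" z snd])
       (use assms in \<open>auto simp: C1_on_def intro: derivative_eq_intros\<close>)
  then show "((\<lambda>z. f (snd z)) has_derivative (\<lambda>h. (0, F (snd z)) \<bullet> h)) (at z within X \<times> Y)"
    by (simp add: inner_prod_def)
qed

lemma C1_on_UNIV_fst:
  assumes "C1_on UNIV f F"
  shows "C1_on UNIV (\<lambda>z::'a::euclidean_space \<times> 'b::euclidean_space. f (fst z)) (\<lambda>z. (F (fst z), 0))"
  using C1_on_fst[OF assms, of UNIV] by simp

lemma C1_on_UNIV_snd:
  assumes "C1_on UNIV f F"
  shows "C1_on UNIV (\<lambda>z::'a::euclidean_space \<times> 'b::euclidean_space. f (snd z)) (\<lambda>z. (0, F (snd z)))"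
  using C1_on_snd[OF assms, of UNIV] by simp

lemma C1_on_real:
  assumes "continuous_on I f'" "\<And>t. t \<in> I \<Longrightarrow> (f has_real_derivative f' t) (at t within I)"
  shows "C1_on I f f'"
  using assms by (auto simp: C1_on_def has_field_derivative_def)

lemma C1_on_slice_fst:
  fixes A :: "'a::euclidean_space \<times> 'b::euclidean_space \<Rightarrow> real"
  assumes "C1_on UNIV A G"
  shows "C1_on UNIV (\<lambda>x. A (x, y)) (\<lambda>x. fst (G (x, y)))"
proof (rule C1_onI)
  show "continuous_on UNIV (\<lambda>x. fst (G (x, y)))"
    using assms unfolding C1_on_def
    by (intro continuous_intros continuous_on_compose2[of UNIV G UNIV "\<lambda>x. (x, y)"]) auto
  fix x :: 'a
  have 1: "((\<lambda>x. (x, y)) has_derivative (\<lambda>h. (h, 0))) (at x)"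
    by (auto intro!: derivative_eq_intros)
  have "(A has_derivative (\<lambda>h. G (x, y) \<bullet> h)) (at (x, y))"
    using assms unfolding C1_on_def by auto
  from has_derivative_compose[OF 1 this]
  show "((\<lambda>x. A (x, y)) has_derivative (\<lambda>h. fst (G (x, y)) \<bullet> h)) (at x within UNIV)"
    by (simp add: inner_prod_def)
qed

lemma C1_on_slice_snd:
  fixes A :: "'a::euclidean_space \<times> 'b::euclidean_space \<Rightarrow> real"
  assumes "C1_on UNIV A G"
  shows "C1_on UNIV (\<lambda>y. A (x, y)) (\<lambda>y. snd (G (x, y)))"
proof (rule C1_onI)
  show "continuous_on UNIV (\<lambda>y. snd (G (x, y)))"
    using assms unfolding C1_on_def
    by (intro continuous_intros continuous_on_compose2[of UNIV G UNIV "\<lambda>y. (x, y)"]) auto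
  fix y :: 'b
  have 1: "((\<lambda>y. (x, y)) has_derivative (\<lambda>h. (0, h))) (at y)"
    by (auto intro!: derivative_eq_intros)
  have "(A has_derivative (\<lambda>h. G (x, y) \<bullet> h)) (at (x, y))"
    using assms unfolding C1_on_def by auto
  from has_derivative_compose[OF 1 this]
  show "((\<lambda>y. A (x, y)) has_derivative (\<lambda>h. snd (G (x, y)) \<bullet> h)) (at y within UNIV)"
    by (simp add: inner_prod_def)
qed

lemma C1_on_time_slice:
  assumes "C1_on (UNIV \<times> {0<..T}) \<phi> G" "t \<in> {0<..T}"
  shows "((\<lambda>s. \<phi> (x, s)) has_real_derivative snd (G (x, t))) (at t within {0<..t})"
proof -
  have d: "(\<phi> has_derivative (\<lambda>h. G (x, t) \<bullet> h)) (at (x, t) within UNIV \<times> {0<..T})"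
    using assms unfolding C1_on_def by auto
  have 1: "((\<lambda>s. (x, s)) has_derivative (\<lambda>h. (0, h))) (at t within {0<..t})"
    by (intro has_derivative_Pair has_derivative_const has_derivative_ident)
  have d': "(\<phi> has_derivative (\<lambda>h. G (x, t) \<bullet> h)) (at (x, t) within (\<lambda>s. (x, s)) ` {0<..t})"
    by (rule has_derivative_subset[OF d]) (use assms in auto)
  from has_derivative_in_compose[OF 1 d']
  show ?thesis
    by (simp add: has_field_derivative_def inner_prod_def mult_commute_abs)
qed

lemma C1_on_diff_variables:
  fixes f :: "'a::euclidean_space \<Rightarrow> real"
  assumes "C1_on UNIV f F"
  shows "C1_on UNIV (\<lambda>z. f (fst z - snd z)) (\<lambda>z. (F (fst z - snd z), - F (fst z - snd z)))"
proof (rule C1_onI)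
  have "continuous_on UNIV (\<lambda>z. F (fst z - snd z))"
    using assms unfolding C1_on_def
    by (intro continuous_on_compose2[of UNIV F UNIV "\<lambda>z. fst z - snd z"] continuous_intros) auto
  then show "continuous_on UNIV (\<lambda>z. (F (fst z - snd z), - F (fst z - snd z)))"
    by (intro continuous_intros)
  fix z :: "'a \<times> 'a"
  have 1: "((\<lambda>z. fst z - snd z) has_derivative (\<lambda>h. fst h - snd h)) (at z)"
    by (auto intro!: derivative_eq_intros)
  have "(f has_derivative (\<lambda>h. F (fst z - snd z) \<bullet> h)) (at (fst z - snd z))"
    using assms unfolding C1_on_def by auto
  from has_derivative_compose[OF 1 this]
  show "((\<lambda>z. f (fst z - snd z)) has_derivative
      (\<lambda>h. (F (fst z - snd z), - F (fst z - snd z)) \<bullet> h)) (at z within UNIV)"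
    by (simp add: inner_prod_def inner_diff_right)
qed

lemma C1_on_rescale:
  fixes f :: "'a::euclidean_space \<Rightarrow> real"
  assumes "C1_on UNIV f F" "r \<noteq> 0"
  shows "C1_on UNIV (\<lambda>y. f (r *\<^sub>R y) / r) (\<lambda>y. F (r *\<^sub>R y))"
proof (rule C1_onI)
  show "continuous_on UNIV (\<lambda>y. F (r *\<^sub>R y))"
    by (rule continuous_on_compose2[of UNIV F]) (use assms in \<open>auto simp: C1_on_def intro: continuous_intros\<close>)
  fix y :: 'a
  have 1: "((\<lambda>y. r *\<^sub>R y) has_derivative (\<lambda>h. r *\<^sub>R h)) (at y)"
    by (intro has_derivative_scaleR_right has_derivative_ident)
  have "(f has_derivative (\<lambda>h. F (r *\<^sub>R y) \<bullet> h)) (at (r *\<^sub>R y))"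
    using assms unfolding C1_on_def by auto
  from has_derivative_mult_right[OF has_derivative_compose[OF 1 this], of "1 / r"]
  show "((\<lambda>y. f (r *\<^sub>R y) / r) has_derivative (\<lambda>h. F (r *\<^sub>R y) \<bullet> h)) (at y within UNIV)"
    using assms(2) by simp
qed

lemma C1_on_sqnorm:
  fixes a :: "'a::euclidean_space"
  shows "C1_on S (\<lambda>x. (norm (x - a))\<^sup>2) (\<lambda>x. 2 *\<^sub>R (x - a))"
proof (rule C1_onI)
  fix z assume "z \<in> S"
  have "((\<lambda>x. (x - a) \<bullet> (x - a)) has_derivative (\<lambda>h. (2 *\<^sub>R (z - a)) \<bullet> h)) (at z within S)"
    by (auto intro!: derivative_eq_intros simp: inner_commute)
  then show "((\<lambda>x. (norm (x - a))\<^sup>2) has_derivative (\<lambda>h. (2 *\<^sub>R (z - a)) \<bullet> h)) (at z within S)"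
    by (simp add: power2_norm_eq_inner)
qed (intro continuous_intros)

lemma C1_on_smooth_norm:
  fixes a :: "'a::euclidean_space"
  assumes k: "k > 0"
  shows "C1_on S (\<lambda>x. sqrt ((norm (x - a))\<^sup>2 + k\<^sup>2))
                 (\<lambda>x. (x - a) /\<^sub>R sqrt ((norm (x - a))\<^sup>2 + k\<^sup>2))"
proof (rule C1_onI)
  have pos: "(norm (x - a))\<^sup>2 + k\<^sup>2 > 0" for x
    using k by (intro add_nonneg_pos) auto
  have ne: "sqrt ((norm (x - a))\<^sup>2 + k\<^sup>2) \<noteq> 0" for x
    using real_sqrt_gt_zero[OF pos[of x]] by linarith
  show "continuous_on S (\<lambda>x. (x - a) /\<^sub>R sqrt ((norm (x - a))\<^sup>2 + k\<^sup>2))"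
    by (intro continuous_intros ballI ne)
  fix z assume z: "z \<in> S"
  have 1: "((\<lambda>x. (norm (x - a))\<^sup>2 + k\<^sup>2) has_derivative (\<lambda>h. (2 *\<^sub>R (z - a)) \<bullet> h)) (at z within S)"
    using has_derivative_add[OF _ has_derivative_const, of "\<lambda>x. (norm (x - a))\<^sup>2" _ "at z within S" "k\<^sup>2"]
      C1_on_sqnorm[of S a] z unfolding C1_on_def by (auto simp del: inner_scaleR_left)
  have d: "((\<lambda>x. sqrt ((norm (x - a))\<^sup>2 + k\<^sup>2)) has_derivative
     (\<lambda>h. ((2 *\<^sub>R (z - a)) \<bullet> h) * (inverse (sqrt ((norm (z - a))\<^sup>2 + k\<^sup>2)) / 2))) (at z within S)"
    by (rule DERIV_compose_FDERIV[OF DERIV_real_sqrt[OF pos] 1])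
  have e: "((2 *\<^sub>R (z - a)) \<bullet> h) * (inverse (sqrt ((norm (z - a))\<^sup>2 + k\<^sup>2)) / 2)
      = ((z - a) /\<^sub>R sqrt ((norm (z - a))\<^sup>2 + k\<^sup>2)) \<bullet> h" for h
    by (simp only: inner_scaleR_left) simp
  show "((\<lambda>x. sqrt ((norm (x - a))\<^sup>2 + k\<^sup>2)) has_derivative
     (\<lambda>h. ((z - a) /\<^sub>R sqrt ((norm (z - a))\<^sup>2 + k\<^sup>2)) \<bullet> h)) (at z within S)"
    by (rule has_derivative_eq_rhs[OF d]) (rule ext, rule e)
qed

lemma smooth_norm_bounds:
  assumes "k \<ge> 0"
  shows "norm x \<le> sqrt ((norm x)\<^sup>2 + k\<^sup>2)" "sqrt ((norm x)\<^sup>2 + k\<^sup>2) \<le> norm x + k"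
    "norm (x /\<^sub>R sqrt ((norm x)\<^sup>2 + k\<^sup>2)) \<le> 1"
proof -
  show 1: "norm x \<le> sqrt ((norm x)\<^sup>2 + k\<^sup>2)"
    by (rule real_le_rsqrt) simp
  show "sqrt ((norm x)\<^sup>2 + k\<^sup>2) \<le> norm x + k"
    by (rule real_le_lsqrt) (use assms in \<open>auto simp: power2_sum\<close>)
  show "norm (x /\<^sub>R sqrt ((norm x)\<^sup>2 + k\<^sup>2)) \<le> 1"
  proof (cases "x = 0")
    case False
    define s where "s = sqrt ((norm x)\<^sup>2 + k\<^sup>2)"
    have s: "norm x \<le> s" "0 < s" using 1 False unfolding s_def[symmetric] by (auto intro: less_le_trans[of 0 "norm x"])
    have "norm (x /\<^sub>R s) = norm x / s" using s by (simp add: divide_inverse_commute)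
    also have "\<dots> \<le> 1" using s by simp
    finally show ?thesis unfolding s_def .
  qed simp
qed

lemma C1_on_powr: "C1_on {0<..T} (\<lambda>t::real. t powr a) (\<lambda>t. a * t powr (a - 1))"
  by (rule C1_on_real) (auto intro!: continuous_intros derivative_eq_intros)

text \<open>Used to exchange a test function for another one at a positive distance from the contact time.\<close>

lemma C1_cutoff:
  fixes a b :: real
  assumes "a < b"
  obtains \<eta> \<eta>' where "C1_on UNIV \<eta> \<eta>'" "\<And>s. 0 \<le> \<eta> s" "\<And>s. \<eta> s \<le> 1"
    "\<And>s. s \<le> a \<Longrightarrow> \<eta> s = 1" "\<And>s. s \<ge> b \<Longrightarrow> \<eta> s = 0"
proof -
  \<comment> \<open>The square of the positive part is \<open>C\<^sup>1\<close>; composing it with itself flattens both ends.\<close>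
  define m where "m = (\<lambda>x::real. (max 0 x)\<^sup>2)"
  have m: "(m has_real_derivative 2 * max 0 x) (at x)" for x
  proof -
    consider "x < 0" | "x > 0" | "x = 0" by linarith
    then show ?thesis
    proof cases
      case 1
      have "((\<lambda>_. 0) has_real_derivative 2 * max 0 x) (at x)" using 1 by auto
      then show ?thesis
        by (rule has_field_derivative_transform_within[where d = "-x"])
           (use 1 in \<open>auto simp: m_def dist_real_def\<close>)
    next
      case 2
      have "((\<lambda>x. x\<^sup>2) has_real_derivative 2 * max 0 x) (at x)"
        using 2 by (auto intro!: derivative_eq_intros)
      then show ?thesis
        by (rule has_field_derivative_transform_within[where d = "x"])
           (use 2 in \<open>auto simp: m_def dist_real_def\<close>)
    next
      case 3
      have "\<bar>(m (0 + h) - m 0) / h\<bar> \<le> \<bar>h\<bar>" for h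
        by (cases "h > 0") (auto simp: m_def max_def power2_eq_square)
      then have "((\<lambda>h. (m (0 + h) - m 0) / h) \<longlongrightarrow> 0) (at 0)"
        by (intro Lim_null_comparison[OF always_eventually tendsto_rabs_zero[OF tendsto_ident_at]]) auto
      then show ?thesis using 3 by (simp add: DERIV_def)
    qed
  qed
  define \<eta> where "\<eta> = (\<lambda>s. 1 - m (1 - m ((b - s) / (b - a))))"
  define \<eta>' where "\<eta>' = (\<lambda>s. - (2 * max 0 (1 - m ((b - s) / (b - a))) *
     (- (2 * max 0 ((b - s) / (b - a)) * (- 1 / (b - a))))))"
  show thesis
  proof (rule that[of \<eta> \<eta>'])
    show "C1_on UNIV \<eta> \<eta>'"
    proof (rule C1_on_real)
      have "continuous_on UNIV m" unfolding m_def by (intro continuous_intros)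
      then show "continuous_on UNIV \<eta>'"
        unfolding \<eta>'_def using assms
        by (auto intro!: continuous_intros continuous_on_compose2[of UNIV m])
      show "(\<eta> has_real_derivative \<eta>' t) (at t)" for t
      proof -
        have "((\<lambda>s. (b - s) / (b - a)) has_real_derivative - 1 / (b - a)) (at t)"
          using assms by (auto intro!: derivative_eq_intros simp: divide_simps)
        from DERIV_diff[OF DERIV_const DERIV_chain2[OF m DERIV_diff[OF DERIV_const DERIV_chain2[OF m this]]]]
        show ?thesis unfolding \<eta>_def \<eta>'_def by (simp only: diff_0)
      qed
    qed
    have m01: "0 \<le> m x" "x \<le> 1 \<Longrightarrow> m x \<le> 1" "x \<le> 0 \<Longrightarrow> m x = 0" "x \<ge> 1 \<Longrightarrow> m x \<ge> 1" for x
      by (auto simp: m_def max_def power_le_one)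
    show "0 \<le> \<eta> s" "\<eta> s \<le> 1" for s unfolding \<eta>_def using m01 by auto
    show "s \<le> a \<Longrightarrow> \<eta> s = 1" for s
      unfolding \<eta>_def using assms m01(4)[of "(b - s) / (b - a)"] m01(3) by auto
    show "s \<ge> b \<Longrightarrow> \<eta> s = 0" for s
      unfolding \<eta>_def using assms m01(3)[of "(b - s) / (b - a)"]
      by (simp add: divide_nonpos_pos) (simp add: m_def)
  qed
qed

lemma gradient_eq_0_at_maximum:
  assumes "C1_on UNIV \<eta> G" "\<And>z'. \<eta> z' \<le> \<eta> z"
  shows "G z = 0"
proof -
  have "(\<eta> has_derivative (\<lambda>h. G z \<bullet> h)) (at z)" using assms(1) by (simp add: C1_on_def)
  then have "(\<lambda>h. G z \<bullet> h) = (\<lambda>h. 0)"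
    by (rule differential_zero_maxmin[OF UNIV_I open_UNIV]) (use assms(2) in auto)
  then have "G z \<bullet> G z = 0" by meson
  then show ?thesis by simp
qed

section \<open>Elementary estimates and maxima\<close>

lemmas continuous_on_arith =
  continuous_on_diff continuous_on_add continuous_on_mult continuous_on_power
  continuous_on_norm continuous_on_const continuous_on_fst continuous_on_snd continuous_on_id

lemma continuous_attains_sup_coercive:
  fixes f :: "'a::heine_borel \<Rightarrow> real"
  assumes "closed S" "continuous_on S f" "x0 \<in> S" "bounded {x \<in> S. f x \<ge> f x0}"
  obtains x where "x \<in> S" "\<And>y. y \<in> S \<Longrightarrow> f y \<le> f x"
proof -
  let ?C = "{x \<in> S. f x \<ge> f x0}"
  have "closed ?C"
    using continuous_closed_preimage[OF assms(2,1), of "{f x0..}"]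
    by (simp add: vimage_def Int_def)
  then have "compact ?C" using assms(4) compact_eq_bounded_closed by blast
  moreover have "continuous_on ?C f" using assms(2) continuous_on_subset by fastforce
  ultimately obtain x where x: "x \<in> ?C" "\<And>y. y \<in> ?C \<Longrightarrow> f y \<le> f x"
    using continuous_attains_sup[of ?C f] assms(3) by auto
  then have "f y \<le> f x" if "y \<in> S" for y
    using that by (cases "f y \<ge> f x0") auto
  then show thesis using that x by auto
qed

lemma le_add_eps:
  fixes a :: real
  assumes "\<And>e. e > 0 \<Longrightarrow> a \<le> b + c * e"
  shows "a \<le> b"
proof (rule ccontr)
  assume ab: "\<not> a \<le> b"
  define e where "e = (a - b) / (2 * (\<bar>c\<bar> + 1))"
  have e: "e > 0" using ab unfolding e_def by (intro divide_pos_pos) auto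
  have "a \<le> b + c * e" by (rule assms[OF e])
  moreover have "c * e \<le> (\<bar>c\<bar> + 1) * e" using e by (intro mult_right_mono) auto
  moreover have "(\<bar>c\<bar> + 1) * e = (a - b) / 2" unfolding e_def by (simp add: field_simps)
  ultimately have "a \<le> b + c * e" "c * e \<le> (a - b) / 2" by auto
  then have "a \<le> b + (a - b) / 2" by (meson add_left_mono order_trans)
  then show False using ab by (simp add: field_simps)
qed

lemma le_one_plus_of_square_le: "a\<^sup>2 \<le> M \<Longrightarrow> a \<le> 1 + (M::real)"
proof -
  assume M: "a\<^sup>2 \<le> M"
  have "0 \<le> (a - 1)\<^sup>2" by simp
  then have "2 * a \<le> a\<^sup>2 + 1" by (simp add: power2_diff)
  moreover have "0 \<le> M" using M order_trans zero_le_power2 by blast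
  ultimately show ?thesis using M by linarith
qed

text \<open>The usual bound for the gradient of the localising term \<open>\<delta> |x|\<^sup>2\<close>, which tends to \<open>0\<close> with \<open>\<delta>\<close>.\<close>

lemma scaled_norm_le_of_square:
  fixes x :: "'a::real_normed_vector"
  assumes "\<delta> * (norm x)\<^sup>2 \<le> M" "\<delta> * M \<le> \<rho>\<^sup>2" "0 \<le> \<delta>" "0 \<le> \<rho>"
  shows "\<delta> * norm x \<le> \<rho>"
proof (rule power2_le_imp_le)
  have "(\<delta> * norm x)\<^sup>2 = \<delta> * (\<delta> * (norm x)\<^sup>2)" by (simp add: power2_eq_square)
  also have "\<dots> \<le> \<delta> * M" using assms by (intro mult_left_mono) auto
  finally show "(\<delta> * norm x)\<^sup>2 \<le> \<rho>\<^sup>2" using assms(2) by linarith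
qed (rule assms)

lemma antimono_tendsto_at_right_0:
  fixes D :: "real \<Rightarrow> real"
  assumes "0 < t" "\<And>r r'. 0 < r \<Longrightarrow> r < r' \<Longrightarrow> r' < t \<Longrightarrow> D r' \<le> D r"
    and "\<And>r. 0 < r \<Longrightarrow> r < t \<Longrightarrow> D r \<le> M"
  shows "\<exists>L. (D \<longlongrightarrow> L) (at_right 0)"
proof
  have bdd: "bdd_above (D ` {0<..<t})" using assms(3) by (intro bdd_aboveI2[of _ _ M]) auto
  let ?L = "SUP r\<in>{0<..<t}. D r"
  show "(D \<longlongrightarrow> ?L) (at_right 0)"
  proof (rule order_tendstoI)
    fix a assume "a < ?L"
    then obtain r0 where r0: "r0 \<in> {0<..<t}" "a < D r0"
      using less_cSUP_iff[OF _ bdd] assms(1) by auto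
    have "\<forall>\<^sub>F r in at_right 0. r \<in> {0<..<r0}"
      using r0 by (intro eventually_at_right_real) auto
    then show "\<forall>\<^sub>F r in at_right 0. a < D r"
    proof eventually_elim
      case (elim r)
      then show ?case using r0 assms(2)[of r r0] by auto
    qed
  next
    fix a assume a: "?L < a"
    have "\<forall>\<^sub>F r in at_right 0. r \<in> {0<..<t}"
      using assms(1) by (intro eventually_at_right_real) auto
    then show "\<forall>\<^sub>F r in at_right 0. D r < a"
    proof eventually_elim
      case (elim r)
      then show ?case using cSUP_upper[OF elim bdd] a by auto
    qed
  qed
qed

lemma BUC_on_boundE:
  assumes "BUC_on S f"
  obtains B where "0 \<le> B" "\<And>z. z \<in> S \<Longrightarrow> \<bar>f z\<bar> \<le> B"
proof -
  obtain B where "\<forall>y\<in>f ` S. \<bar>y\<bar> \<le> B"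
    using assms unfolding BUC_on_def bounded_iff real_norm_def by blast
  then have "\<And>z. z \<in> S \<Longrightarrow> \<bar>f z\<bar> \<le> max 0 B" by (meson imageI max.coboundedI2)
  then show thesis using that[of "max 0 B"] by simp
qed

lemma BUC_on_imp_continuous_on: "BUC_on S f \<Longrightarrow> continuous_on S f"
  by (simp add: BUC_on_def uniformly_continuous_imp_continuous)

lemma continuous_on_time_slice:
  assumes "continuous_on (UNIV \<times> {0..T}) f" "t \<le> T"
  shows "continuous_on {0..t::real} (\<lambda>s. f (x, s))"
proof -
  have "continuous_on {0..t} (\<lambda>s. (x, s))" by (intro continuous_intros)
  then show ?thesis
    by (rule continuous_on_compose2[OF assms(1)]) (use assms(2) in auto)
qed

text \<open>Uniform continuity controls \<open>y\<close> near \<open>x\<close> and boundedness controls the rest, so that the opening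
  \<open>D\<close> can be chosen for all vertices and times at once.\<close>

lemma BUC_on_below_paraboloid:
  fixes u :: "'a::euclidean_space \<times> real \<Rightarrow> real"
  assumes "BUC_on (UNIV \<times> I) u" "e > 0"
  obtains D where "D \<ge> 0" "\<And>x y s. s \<in> I \<Longrightarrow> u (y, s) \<le> u (x, s) + e + D * (norm (y - x))\<^sup>2"
proof -
  obtain B where B: "0 \<le> B" "\<And>z. z \<in> UNIV \<times> I \<Longrightarrow> \<bar>u z\<bar> \<le> B"
    using BUC_on_boundE[OF assms(1)] by blast
  obtain d where d: "d > 0"
    "\<And>z w. z \<in> UNIV \<times> I \<Longrightarrow> w \<in> UNIV \<times> I \<Longrightarrow> dist w z < d \<Longrightarrow> dist (u w) (u z) < e"
    using assms unfolding BUC_on_def uniformly_continuous_on_def by metis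
  show thesis
  proof (rule that[of "2 * B / d\<^sup>2"])
    show "2 * B / d\<^sup>2 \<ge> 0" using B by simp
    fix x y :: 'a and s assume s: "s \<in> I"
    show "u (y, s) \<le> u (x, s) + e + 2 * B / d\<^sup>2 * (norm (y - x))\<^sup>2"
    proof (cases "norm (y - x) < d")
      case True
      then have "dist (u (y, s)) (u (x, s)) < e"
        using s by (intro d(2)) (auto simp: dist_Pair_Pair dist_norm)
      moreover have "0 \<le> 2 * B / d\<^sup>2 * (norm (y - x))\<^sup>2" using B by simp
      ultimately show ?thesis unfolding dist_real_def by linarith
    next
      case False
      have "u (y, s) - u (x, s) \<le> 2 * B" using B(2)[of "(y, s)"] B(2)[of "(x, s)"] s by auto
      also have "\<dots> = 2 * B / d\<^sup>2 * d\<^sup>2" using d by simp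
      also have "\<dots> \<le> 2 * B / d\<^sup>2 * (norm (y - x))\<^sup>2"
        using False d B by (intro mult_left_mono power_mono) auto
      finally show ?thesis using assms(2) by linarith
    qed
  qed
qed

section \<open>The nonlocal operators\<close>

abbreviation K_integrand :: "real \<Rightarrow> ('a \<times> real \<Rightarrow> real) \<Rightarrow> 'a \<Rightarrow> real \<Rightarrow> real \<Rightarrow> real" where
  "K_integrand \<alpha> f x t \<tau> \<equiv> (f (x, t) - f (x, t - \<tau>)) / \<tau> powr (\<alpha> + 1)"

lemma powr_kernel_integral:
  fixes \<alpha> r :: real
  assumes "\<alpha> < 1" "0 < r"
  shows "set_integrable lborel {0<..<r} (\<lambda>\<tau>. \<tau> powr (- \<alpha>))"
    and "(LINT \<tau>:{0<..<r}|lborel. \<tau> powr (- \<alpha>)) = r powr (1 - \<alpha>) / (1 - \<alpha>)"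
proof -
  let ?F = "\<lambda>\<tau>. \<tau> powr (1 - \<alpha>) / (1 - \<alpha>)"
  have F: "(?F has_real_derivative x powr (- \<alpha>)) (at x)" if "0 < ereal x" for x
    using that assms by (auto intro!: derivative_eq_intros)
  have cont: "continuous_on {0..} ?F"
    using assms by (intro continuous_intros continuous_on_powr') auto
  have A: "((?F \<circ> real_of_ereal) \<longlongrightarrow> 0) (at_right 0)"
  proof -
    have "(?F \<longlongrightarrow> ?F 0) (at 0 within {0..})"
      using cont unfolding continuous_on_def by (rule bspec) simp
    then have "(?F \<longlongrightarrow> ?F 0) (at_right 0)"
      by (rule tendsto_within_subset) auto
    then show ?thesis by (simp add: ereal_tendsto_simps1 zero_ereal_def)
  qed
  have B: "((?F \<circ> real_of_ereal) \<longlongrightarrow> ?F r) (at_left (ereal r))"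
  proof -
    have "(?F \<longlongrightarrow> ?F r) (at_left r)"
      using DERIV_isCont[OF F[of r]] assms
      by (auto simp: isCont_def intro: tendsto_within_subset)
    then show ?thesis by (simp add: ereal_tendsto_simps1)
  qed
  have cts: "isCont (\<lambda>\<tau>. \<tau> powr (- \<alpha>)) x" if "0 < ereal x" for x
    using that by (auto intro!: continuous_intros)
  have lt: "(0::ereal) < ereal r" using assms by simp
  note ftc = interval_integral_FTC_nonneg[OF lt F cts _ A B]
  have e: "einterval 0 (ereal r) = {0<..<r}"
    by (auto simp: einterval_def zero_ereal_def)
  show "set_integrable lborel {0<..<r} (\<lambda>\<tau>. \<tau> powr (- \<alpha>))"
    using ftc(1) unfolding e by simp
  show "(LINT \<tau>:{0<..<r}|lborel. \<tau> powr (- \<alpha>)) = r powr (1 - \<alpha>) / (1 - \<alpha>)"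
    using ftc(2) lt unfolding interval_lebesgue_integral_def e by simp
qed

lemma K_integrand_integrable:
  assumes \<alpha>: "\<alpha> \<in> {0<..<1}" and ab: "0 \<le> a" "b \<le> t"
    and cont: "continuous_on {0..t} (\<lambda>s. f (x, s))"
    and C: "\<And>\<tau>. \<tau> \<in> {a<..<b} \<Longrightarrow> \<bar>f (x, t) - f (x, t - \<tau>)\<bar> \<le> C * \<tau>"
  shows "set_integrable lborel {a<..<b} (K_integrand \<alpha> f x t)"
proof (cases "a < b")
  case False
  then show ?thesis by (simp add: set_integrable_def)
next
  case True
  have 1: "set_integrable lborel {0<..<b} (\<lambda>\<tau>. \<tau> powr (- \<alpha>))"
    using powr_kernel_integral \<alpha> True ab by auto
  have "set_integrable lborel {a<..<b} (\<lambda>\<tau>. C * \<tau> powr (- \<alpha>))"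
    by (intro set_integrable_mult_right set_integrable_subset[OF 1]) (use ab in auto)
  then show ?thesis
  proof (rule set_integrable_bound)
    have "continuous_on {a<..<b} (K_integrand \<alpha> f x t)"
      using ab
      by (intro continuous_intros continuous_on_compose2[OF cont]) auto
    then show "set_borel_measurable lborel {a<..<b} (K_integrand \<alpha> f x t)"
      using borel_measurable_continuous_on_indicator[of "{a<..<b}" "K_integrand \<alpha> f x t"]
      by (simp add: set_borel_measurable_def)
    have "\<bar>K_integrand \<alpha> f x t \<tau>\<bar> \<le> \<bar>C * \<tau> powr (- \<alpha>)\<bar>" if "\<tau> \<in> {a<..<b}" for \<tau>
    proof -
      have "\<tau> > 0" using that ab by auto
      then have "\<bar>K_integrand \<alpha> f x t \<tau>\<bar> = \<bar>f (x, t) - f (x, t - \<tau>)\<bar> / \<tau> powr (\<alpha> + 1)" by simp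
      also have "\<dots> \<le> C * \<tau> / \<tau> powr (\<alpha> + 1)"
        by (intro divide_right_mono C that) simp
      also have "\<dots> = C * \<tau> powr (- \<alpha>)"
        using \<open>\<tau> > 0\<close> by (simp add: powr_add powr_minus divide_simps)
      finally show ?thesis by simp
    qed
    then show "AE \<tau> in lborel. \<tau> \<in> {a<..<b} \<longrightarrow> norm (K_integrand \<alpha> f x t \<tau>) \<le> norm (C * \<tau> powr (- \<alpha>))"
      by auto
  qed
qed

lemma J_uminus: "J \<alpha> (\<lambda>z. - f z) x t = - J \<alpha> f x t"
  by (simp add: J_def minus_divide_left)

lemma K_uminus: "K \<alpha> a b (\<lambda>z. - f z) x t = - K \<alpha> a b f x t"
proof -
  have "(- f (x, t) - - f (x, t - \<tau>)) / \<tau> powr (\<alpha> + 1) = - K_integrand \<alpha> f x t \<tau>" for \<tau>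
    by (simp add: minus_divide_left)
  then show ?thesis by (simp add: K_def set_lebesgue_integral_def)
qed

lemma K_const: "K \<alpha> a b (\<lambda>_. c) x t = 0"
  by (simp add: K_def set_lebesgue_integral_def)

text \<open>One-sided control of the increments is all that a maximum of a difference provides, so the
  two kernels are compared rather than estimated separately.\<close>

lemma K_diff_lower_bound:
  assumes \<alpha>: "\<alpha> \<in> {0<..<1}" and ab: "0 \<le> a" "0 < b"
    and fg: "set_integrable lborel {a<..<b} (K_integrand \<alpha> f x t)"
            "set_integrable lborel {a<..<b} (K_integrand \<alpha> g y s)"
    and C: "0 \<le> C"
      "\<And>\<tau>. \<tau> \<in> {a<..<b} \<Longrightarrow> (f (x, t) - f (x, t - \<tau>)) - (g (y, s) - g (y, s - \<tau>)) \<ge> - (C * \<tau>)"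
  shows "K \<alpha> a b f x t - K \<alpha> a b g y s \<ge> - (C * (\<alpha> / Gamma (1 - \<alpha>) * (b powr (1 - \<alpha>) / (1 - \<alpha>))))"
proof -
  note pk = powr_kernel_integral[of \<alpha> b]
  have G: "\<alpha> / Gamma (1 - \<alpha>) \<ge> 0" using \<alpha> by (simp add: Gamma_real_pos less_imp_le)
  have i1: "set_integrable lborel {0<..<b} (\<lambda>\<tau>. C * \<tau> powr (- \<alpha>))"
    using pk \<alpha> ab by auto
  have i: "set_integrable lborel {a<..<b} (\<lambda>\<tau>. C * \<tau> powr (- \<alpha>))"
    by (rule set_integrable_subset[OF i1]) (use ab in auto)
  have "- (LINT \<tau>:{0<..<b}|lborel. C * \<tau> powr (- \<alpha>)) \<le> - (LINT \<tau>:{a<..<b}|lborel. C * \<tau> powr (- \<alpha>))"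
    using i i1 ab C(1) unfolding set_lebesgue_integral_def set_integrable_def
    by (intro le_imp_neg_le integral_mono) (auto simp: indicator_def)
  also have "\<dots> = (LINT \<tau>:{a<..<b}|lborel. - (C * \<tau> powr (- \<alpha>)))"
    by (rule set_integral_uminus[OF i, symmetric])
  also have "\<dots> \<le> (LINT \<tau>:{a<..<b}|lborel. K_integrand \<alpha> f x t \<tau> - K_integrand \<alpha> g y s \<tau>)"
  proof (rule set_integral_mono)
    show "set_integrable lborel {a<..<b} (\<lambda>\<tau>. - (C * \<tau> powr (- \<alpha>)))"
      using i by (simp add: set_integrable_def)
    show "set_integrable lborel {a<..<b} (\<lambda>\<tau>. K_integrand \<alpha> f x t \<tau> - K_integrand \<alpha> g y s \<tau>)"
      by (intro set_integral_diff fg)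
    fix \<tau> assume t: "\<tau> \<in> {a<..<b}"
    then have pos: "\<tau> > 0" using ab by auto
    have "- (C * \<tau> powr (- \<alpha>)) = - (C * \<tau>) / \<tau> powr (\<alpha> + 1)"
      using pos by (simp add: powr_add powr_minus divide_simps)
    also have "\<dots> \<le> ((f (x, t) - f (x, t - \<tau>)) - (g (y, s) - g (y, s - \<tau>))) / \<tau> powr (\<alpha> + 1)"
      by (intro divide_right_mono C(2) t) simp
    finally show "- (C * \<tau> powr (- \<alpha>)) \<le> K_integrand \<alpha> f x t \<tau> - K_integrand \<alpha> g y s \<tau>"
      by (simp add: diff_divide_distrib)
  qed
  also have "\<dots> = (LINT \<tau>:{a<..<b}|lborel. K_integrand \<alpha> f x t \<tau>) - (LINT \<tau>:{a<..<b}|lborel. K_integrand \<alpha> g y s \<tau>)"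
    by (rule set_integral_diff(2)[OF fg])
  finally have "- (C * (b powr (1 - \<alpha>) / (1 - \<alpha>))) \<le> \<dots>"
    using pk(2) \<alpha> ab by simp
  from mult_left_mono[OF this G] show ?thesis
    by (simp add: K_def right_diff_distrib mult_ac)
qed

lemma K_abs_bound:
  assumes \<alpha>: "\<alpha> \<in> {0<..<1}" and ab: "0 \<le> a" "0 < b"
    and f: "set_integrable lborel {a<..<b} (K_integrand \<alpha> f x t)"
    and C: "0 \<le> C" "\<And>\<tau>. \<tau> \<in> {a<..<b} \<Longrightarrow> \<bar>f (x, t) - f (x, t - \<tau>)\<bar> \<le> C * \<tau>"
  shows "\<bar>K \<alpha> a b f x t\<bar> \<le> C * (\<alpha> / Gamma (1 - \<alpha>) * (b powr (1 - \<alpha>) / (1 - \<alpha>)))"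
proof -
  note l = K_diff_lower_bound[OF \<alpha> ab _ _ C(1), where x = x and y = x and t = t and s = t]
  have "- (C * \<tau>) \<le> f (x, t) - f (x, t - \<tau>)" "- (C * \<tau>) \<le> - (f (x, t) - f (x, t - \<tau>))"
    if "\<tau> \<in> {a<..<b}" for \<tau>
    using C(2)[OF that] by linarith+
  then show ?thesis
    using l[where g = "\<lambda>_. 0", OF f] l[where f = "\<lambda>_. 0", OF _ f]
    by (simp add: set_integrable_def K_const abs_le_iff)
qed

lemma K_split:
  assumes "0 \<le> a" "a < r" "r < b" "set_integrable lborel {a<..<b} (K_integrand \<alpha> f x t)"
  shows "K \<alpha> a b f x t = K \<alpha> a r f x t + K \<alpha> r b f x t"
proof -
  have u: "{a<..<r} \<union> {r<..<b} = {a<..<b} - {r}" using assms by auto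
  have "(LINT \<tau>:{a<..<r} \<union> {r<..<b}|lborel. K_integrand \<alpha> f x t \<tau>)
     = (LINT \<tau>:{a<..<r}|lborel. K_integrand \<alpha> f x t \<tau>) + (LINT \<tau>:{r<..<b}|lborel. K_integrand \<alpha> f x t \<tau>)"
    by (rule set_integral_Un) (use assms in \<open>auto intro: set_integrable_subset[OF assms(4)]\<close>)
  moreover have "(LINT \<tau>:{a<..<b}|lborel. K_integrand \<alpha> f x t \<tau>) = (LINT \<tau>:{a<..<r} \<union> {r<..<b}|lborel. K_integrand \<alpha> f x t \<tau>)"
    unfolding set_lebesgue_integral_def
  proof (rule integral_cong_AE)
    show "(\<lambda>\<tau>. indicat_real {a<..<b} \<tau> *\<^sub>R K_integrand \<alpha> f x t \<tau>) \<in> borel_measurable lborel"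
      using assms(4) unfolding set_integrable_def by (rule borel_measurable_integrable)
    have "set_integrable lborel ({a<..<r} \<union> {r<..<b}) (K_integrand \<alpha> f x t)"
      by (rule set_integrable_subset[OF assms(4)]) (use assms in auto)
    then show "(\<lambda>\<tau>. indicat_real ({a<..<r} \<union> {r<..<b}) \<tau> *\<^sub>R K_integrand \<alpha> f x t \<tau>) \<in> borel_measurable lborel"
      unfolding set_integrable_def by (rule borel_measurable_integrable)
    have "AE \<tau> in lborel. \<tau> \<noteq> r" by (rule AE_lborel_singleton)
    then show "AE \<tau> in lborel. indicat_real {a<..<b} \<tau> *\<^sub>R K_integrand \<alpha> f x t \<tau>
        = indicat_real ({a<..<r} \<union> {r<..<b}) \<tau> *\<^sub>R K_integrand \<alpha> f x t \<tau>"
      unfolding u by eventually_elim (auto simp: indicator_def)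
  qed
  ultimately show ?thesis by (simp add: K_def distrib_left)
qed

text \<open>The constant \<open>e\<close> absorbs the error of an approximation made away from \<open>\<tau> = 0\<close>, where the
  kernel is bounded.\<close>

lemma K_mono:
  assumes \<alpha>: "\<alpha> \<in> {0<..<1}" 
    and fg: "set_integrable lborel {a<..<b} (K_integrand \<alpha> f x t)"
            "set_integrable lborel {a<..<b} (K_integrand \<alpha> g y s)"
    and le: "\<And>\<tau>. \<tau> \<in> {a<..<b} \<Longrightarrow> K_integrand \<alpha> f x t \<tau> \<le> K_integrand \<alpha> g y s \<tau> + e"
    and ab: "a < b"
  shows "K \<alpha> a b f x t \<le> K \<alpha> a b g y s + \<alpha> / Gamma (1 - \<alpha>) * (e * (b - a))"
proof -
  have G: "\<alpha> / Gamma (1 - \<alpha>) \<ge> 0" using \<alpha> by (simp add: Gamma_real_pos less_imp_le)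
  have e: "set_integrable lborel {a<..<b} (\<lambda>_. e)"
    using ab by (auto simp: set_integrable_def intro!: integrable_real_indicator)
  have "(LINT \<tau>:{a<..<b}|lborel. K_integrand \<alpha> f x t \<tau>) \<le> (LINT \<tau>:{a<..<b}|lborel. K_integrand \<alpha> g y s \<tau> + e)"
    by (intro set_integral_mono set_integral_add fg e le)
  also have "\<dots> = (LINT \<tau>:{a<..<b}|lborel. K_integrand \<alpha> g y s \<tau>) + (LINT \<tau>:{a<..<b}|lborel. e)"
    by (rule set_integral_add(2)[OF fg(2) e])
  also have "(LINT \<tau>:{a<..<b}|lborel. e) = e * (b - a)"
    using ab by (simp add: set_lebesgue_integral_def)
  finally show ?thesis
    unfolding K_def distrib_left[symmetric] by (rule mult_left_mono[OF _ G])
qed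

text \<open>This bound at \<open>\<tau> = 0\<close> is what makes the Caputo kernel integrable against the
  increments; away from \<open>t\<close> boundedness of \<open>f\<close> suffices.\<close>

lemma backward_difference_bound:
  fixes f :: "real \<Rightarrow> real"
  assumes "0 < t" "continuous_on {0..t} f" "(f has_real_derivative D) (at t within {0<..t})"
  obtains C where "C \<ge> 0" "\<And>\<tau>. \<tau> \<in> {0<..t} \<Longrightarrow> \<bar>f t - f (t - \<tau>)\<bar> \<le> C * \<tau>"
proof -
  have "((\<lambda>s. (f s - f t) / (s - t)) \<longlongrightarrow> D) (at t within {0<..t})"
    using assms(3) by (simp add: has_field_derivative_iff)
  then have "\<forall>\<^sub>F s in at t within {0<..t}. dist ((f s - f t) / (s - t)) D < 1"
    by (rule tendstoD) simp
  then obtain d where d: "d > 0"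
    "\<And>s. s \<in> {0<..t} \<Longrightarrow> s \<noteq> t \<Longrightarrow> dist s t < d \<Longrightarrow> dist ((f s - f t) / (s - t)) D < 1"
    unfolding eventually_at by metis
  obtain B where "\<forall>y\<in>f ` {0..t}. \<bar>y\<bar> \<le> B"
    using compact_imp_bounded[OF compact_continuous_image[OF assms(2) compact_Icc]]
    unfolding bounded_iff real_norm_def by blast
  then have B: "\<bar>f s\<bar> \<le> B" if "s \<in> {0..t}" for s using that by blast
  have B0: "B \<ge> 0" using B[of 0] assms(1) by auto
  define d' where "d' = min d t"
  have d': "d' > 0" using d assms by (simp add: d'_def)
  define C where "C = max (\<bar>D\<bar> + 1) (2 * B / d')"
  show thesis
  proof (rule that[of C])
    show "C \<ge> 0" by (simp add: C_def le_max_iff_disj)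
    fix \<tau> assume t: "\<tau> \<in> {0<..t}"
    show "\<bar>f t - f (t - \<tau>)\<bar> \<le> C * \<tau>"
    proof (cases "\<tau> < d'")
      case True
      then have "dist ((f (t - \<tau>) - f t) / (t - \<tau> - t)) D < 1"
        using t by (intro d(2)) (auto simp: dist_real_def d'_def)
      then have "\<bar>(f t - f (t - \<tau>)) / \<tau>\<bar> < \<bar>D\<bar> + 1"
        by (simp add: dist_real_def minus_divide_left[symmetric] minus_divide_right diff_divide_distrib)
      then have "\<bar>f t - f (t - \<tau>)\<bar> \<le> (\<bar>D\<bar> + 1) * \<tau>" using t by (simp add: divide_simps)
      also have "\<dots> \<le> C * \<tau>" using t by (intro mult_right_mono) (auto simp: C_def)
      finally show ?thesis .
    next
      case False
      have "\<bar>f t - f (t - \<tau>)\<bar> \<le> 2 * B" using B[of t] B[of "t - \<tau>"] t by auto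
      also have "\<dots> = 2 * B / d' * d'" using d' by simp
      also have "\<dots> \<le> C * \<tau>"
        using False d' B0 t by (intro mult_mono) (auto simp: C_def)
      finally show ?thesis .
    qed
  qed
qed

lemma K_integrand_integrable_test_function:
  assumes \<alpha>: "\<alpha> \<in> {0<..<1}" and "evol_test_function T \<phi> G" "t \<in> {0<..T}"
  obtains C where "C \<ge> 0" "\<And>\<tau>. \<tau> \<in> {0<..t} \<Longrightarrow> \<bar>\<phi> (x, t) - \<phi> (x, t - \<tau>)\<bar> \<le> C * \<tau>"
    "set_integrable lborel {0<..<t} (K_integrand \<alpha> \<phi> x t)"
proof -
  have cont: "continuous_on {0..t} (\<lambda>s. \<phi> (x, s))"
    using assms(2,3) unfolding evol_test_function_def by (intro continuous_on_time_slice) auto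
  have der: "((\<lambda>s. \<phi> (x, s)) has_real_derivative snd (G (x, t))) (at t within {0<..t})"
    using C1_on_time_slice assms(2,3) unfolding evol_test_function_def by blast
  obtain C where C: "C \<ge> 0" "\<And>\<tau>. \<tau> \<in> {0<..t} \<Longrightarrow> \<bar>\<phi> (x, t) - \<phi> (x, t - \<tau>)\<bar> \<le> C * \<tau>"
    using backward_difference_bound[OF _ cont der] assms(3) by auto
  moreover have "set_integrable lborel {0<..<t} (K_integrand \<alpha> \<phi> x t)"
    by (rule K_integrand_integrable[OF \<alpha> _ _ cont, where C = C]) (use C in auto)
  ultimately show thesis using that by blast
qed

text \<open>Away from \<open>\<tau> = 0\<close> the increments need no regularity.\<close>

lemma K_integrand_integrable_bounded:
  assumes \<alpha>: "\<alpha> \<in> {0<..<1}" and u: "BUC_on (UNIV \<times> {0..T}) u" and t: "t \<le> T" and r: "0 < r"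
  shows "set_integrable lborel {r<..<t} (K_integrand \<alpha> u x t)"
proof -
  obtain B where B: "0 \<le> B" "\<And>z. z \<in> UNIV \<times> {0..T} \<Longrightarrow> \<bar>u z\<bar> \<le> B"
    using BUC_on_boundE[OF u] by blast
  have cont: "continuous_on {0..t} (\<lambda>s. u (x, s))"
    using continuous_on_time_slice[OF BUC_on_imp_continuous_on[OF u] t] .
  show ?thesis
  proof (rule K_integrand_integrable[OF \<alpha> _ _ cont, where C = "2 * B / r"])
    fix \<tau> assume \<tau>: "\<tau> \<in> {r<..<t}"
    have "\<bar>u (x, t) - u (x, t - \<tau>)\<bar> \<le> 2 * B"
      using B(2)[of "(x, t)"] B(2)[of "(x, t - \<tau>)"] \<tau> r t by auto
    also have "\<dots> = 2 * B / r * r" using r by simp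
    also have "\<dots> \<le> 2 * B / r * \<tau>" using \<tau> B r by (intro mult_left_mono) auto
    finally show "\<bar>u (x, t) - u (x, t - \<tau>)\<bar> \<le> 2 * B / r * \<tau>" .
  qed (use r in auto)
qed

text \<open>Dominated convergence; the truncation at \<open>r\<close> keeps the kernel bounded.\<close>

lemma K_tendsto:
  fixes u :: "'a::euclidean_space \<times> real \<Rightarrow> real"
  assumes \<alpha>: "\<alpha> \<in> {0<..<1}" and u: "BUC_on (UNIV \<times> {0..T}) u" and r: "0 < r"
    and X: "X \<longlonglongrightarrow> x" and tn: "tn \<longlonglongrightarrow> t" "\<And>n. tn n \<in> {0..T}" and t: "t \<in> {0..T}"
  shows "(\<lambda>n. K \<alpha> r (tn n) u (X n) (tn n)) \<longlonglongrightarrow> K \<alpha> r t u x t"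
proof -
  obtain B where B: "0 \<le> B" "\<And>z. z \<in> UNIV \<times> {0..T} \<Longrightarrow> \<bar>u z\<bar> \<le> B"
    using BUC_on_boundE[OF u] by blast
  define b where "b = 2 * B / r powr (\<alpha> + 1)"
  have "(\<lambda>n. \<integral>\<tau>. indicator {r<..<tn n} \<tau> *\<^sub>R K_integrand \<alpha> u (X n) (tn n) \<tau> \<partial>lborel)
     \<longlonglongrightarrow> (\<integral>\<tau>. indicator {r<..<t} \<tau> *\<^sub>R K_integrand \<alpha> u x t \<tau> \<partial>lborel)"
  proof (rule integral_dominated_convergence[where w = "\<lambda>\<tau>. indicator {r<..<T} \<tau> * b"])
    show "(\<lambda>\<tau>. indicat_real {r<..<t} \<tau> *\<^sub>R K_integrand \<alpha> u x t \<tau>) \<in> borel_measurable lborel"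
      using K_integrand_integrable_bounded[OF \<alpha> u _ r, of t x] t
      unfolding set_integrable_def by (intro borel_measurable_integrable) auto
    show "(\<lambda>\<tau>. indicat_real {r<..<tn n} \<tau> *\<^sub>R K_integrand \<alpha> u (X n) (tn n) \<tau>) \<in> borel_measurable lborel" for n
      using K_integrand_integrable_bounded[OF \<alpha> u _ r, of "tn n" "X n"] tn(2)[of n]
      unfolding set_integrable_def by (intro borel_measurable_integrable) auto
    show "integrable lborel (\<lambda>\<tau>. indicat_real {r<..<T} \<tau> * b)"
      by (cases "r \<le> T") (auto intro!: integrable_mult_left integrable_real_indicator)
    show "AE \<tau> in lborel. norm (indicat_real {r<..<tn n} \<tau> *\<^sub>R K_integrand \<alpha> u (X n) (tn n) \<tau>)
        \<le> indicat_real {r<..<T} \<tau> * b" for n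
    proof (rule AE_I2)
      fix \<tau>
      show "norm (indicat_real {r<..<tn n} \<tau> *\<^sub>R K_integrand \<alpha> u (X n) (tn n) \<tau>) \<le> indicat_real {r<..<T} \<tau> * b"
      proof (cases "\<tau> \<in> {r<..<tn n}")
        case True
        then have T: "\<tau> \<in> {r<..<T}" using tn(2)[of n] by auto
        have 1: "\<bar>u (X n, tn n) - u (X n, tn n - \<tau>)\<bar> \<le> 2 * B"
          using B(2)[of "(X n, tn n)"] B(2)[of "(X n, tn n - \<tau>)"] True tn(2)[of n] r by auto
        have "\<bar>K_integrand \<alpha> u (X n) (tn n) \<tau>\<bar> = \<bar>u (X n, tn n) - u (X n, tn n - \<tau>)\<bar> / \<tau> powr (\<alpha> + 1)"
          by (simp add: abs_divide)
        also have "\<dots> \<le> 2 * B / r powr (\<alpha> + 1)"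
          using True r \<alpha> 1 B(1) by (intro frac_le powr_mono2) auto
        finally show ?thesis using True T by (simp add: b_def)
      next
        case False
        have "b \<ge> 0" using B(1) by (simp add: b_def)
        moreover have "indicat_real {r<..<tn n} \<tau> = 0" using False by simp
        ultimately show ?thesis by simp
      qed
    qed
    have "AE \<tau> in lborel. \<tau> \<noteq> t" by (rule AE_lborel_singleton)
    then show "AE \<tau> in lborel. (\<lambda>n. indicat_real {r<..<tn n} \<tau> *\<^sub>R K_integrand \<alpha> u (X n) (tn n) \<tau>)
        \<longlonglongrightarrow> indicat_real {r<..<t} \<tau> *\<^sub>R K_integrand \<alpha> u x t \<tau>"
    proof eventually_elim
      case (elim \<tau>)
      consider "\<tau> \<le> r" | "t < \<tau>" | "r < \<tau>" "\<tau> < t" using elim by linarith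
      then show ?case
      proof cases
        case 1 then show ?thesis by simp
      next
        case 2
        have "\<forall>\<^sub>F n in sequentially. tn n < \<tau>" by (rule order_tendstoD(2)[OF tn(1) 2])
        then have "\<forall>\<^sub>F n in sequentially. indicat_real {r<..<tn n} \<tau> *\<^sub>R K_integrand \<alpha> u (X n) (tn n) \<tau> = 0"
          by eventually_elim auto
        then show ?thesis using 2 by (simp add: tendsto_eventually)
      next
        case 3
        have ev: "\<forall>\<^sub>F n in sequentially. \<tau> < tn n" by (rule order_tendstoD(1)[OF tn(1) 3(2)])
        note cu = continuous_on_tendsto_compose[OF BUC_on_imp_continuous_on[OF u]]
        have l1: "(\<lambda>n. u (X n, tn n)) \<longlonglongrightarrow> u (x, t)"
          using t tn(2) by (intro cu tendsto_Pair X tn) auto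
        have l2: "(\<lambda>n. u (X n, tn n - \<tau>)) \<longlonglongrightarrow> u (x, t - \<tau>)"
        proof (intro cu tendsto_Pair X tendsto_diff tn tendsto_const)
          show "(x, t - \<tau>) \<in> UNIV \<times> {0..T}" using t 3 r by auto
          show "\<forall>\<^sub>F n in sequentially. (X n, tn n - \<tau>) \<in> UNIV \<times> {0..T}"
            using ev
          proof eventually_elim
            case (elim n) then show ?case using tn(2)[of n] 3 r by auto
          qed
        qed
        have "(\<lambda>n. K_integrand \<alpha> u (X n) (tn n) \<tau>) \<longlonglongrightarrow> K_integrand \<alpha> u x t \<tau>"
          using 3 r by (intro tendsto_divide tendsto_diff l1 l2 tendsto_const) auto
        moreover have "\<forall>\<^sub>F n in sequentially. K_integrand \<alpha> u (X n) (tn n) \<tau>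
            = indicat_real {r<..<tn n} \<tau> *\<^sub>R K_integrand \<alpha> u (X n) (tn n) \<tau>"
          using ev by eventually_elim (use 3 in auto)
        ultimately have "(\<lambda>n. indicat_real {r<..<tn n} \<tau> *\<^sub>R K_integrand \<alpha> u (X n) (tn n) \<tau>) \<longlonglongrightarrow> K_integrand \<alpha> u x t \<tau>"
          by (rule Lim_transform_eventually)
        then show ?thesis using 3 by simp
      qed
    qed
  qed
  then show ?thesis
    unfolding K_def set_lebesgue_integral_def by (intro tendsto_intros)
qed

lemma J_tendsto:
  fixes u :: "'a::euclidean_space \<times> real \<Rightarrow> real"
  assumes \<alpha>: "\<alpha> \<in> {0<..<1}" and u: "BUC_on (UNIV \<times> {0..T}) u"
    and X: "X \<longlonglongrightarrow> x" and tn: "tn \<longlonglongrightarrow> t" "\<And>n. tn n \<in> {0..T}" and t: "t \<in> {0<..T}"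
  shows "(\<lambda>n. J \<alpha> u (X n) (tn n)) \<longlonglongrightarrow> J \<alpha> u x t"
proof -
  note cu = continuous_on_tendsto_compose[OF BUC_on_imp_continuous_on[OF u]]
  have "(\<lambda>n. u (X n, tn n)) \<longlonglongrightarrow> u (x, t)" "(\<lambda>n. u (X n, 0)) \<longlonglongrightarrow> u (x, 0)"
    using t tn(2) by (auto intro!: cu tendsto_Pair X tn)
  moreover have "Gamma (1 - \<alpha>) > 0" using \<alpha> by (simp add: Gamma_real_pos)
  ultimately show ?thesis unfolding J_def
    using t by (intro tendsto_divide tendsto_diff tendsto_mult tendsto_powr tn tendsto_const) auto
qed

section \<open>Viscosity inequalities with the solution in the nonlocal term\<close>

text \<open>The viscosity inequality remains true when the test function is replaced by \<open>u\<close> itself in the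
  part of the nonlocal operator that is separated from the contact time. The reason is that the
  test function may be changed away from the contact time into a \<open>C\<^sup>1\<close> majorant of \<open>u\<close> that is as
  close to \<open>u\<close> as desired on the vertical line through the contact point.\<close>

lemma nonlocal_subsolution:
  fixes u :: "'a::euclidean_space \<times> real \<Rightarrow> real"
  assumes \<alpha>: "\<alpha> \<in> {0<..<1}" and u: "BUC_on (UNIV \<times> {0..T}) u"
    and sub: "evol_visc_subsolution \<alpha> T F u0 u"
    and test: "evol_test_function T \<phi> G" and t: "t \<in> {0<..T}"
    and max: "\<And>z. z \<in> UNIV \<times> {0..T} \<Longrightarrow> u z - \<phi> z \<le> u (x, t) - \<phi> (x, t)"
    and r: "0 < r" "r < t"
  shows "J \<alpha> u x t + K \<alpha> 0 r \<phi> x t + K \<alpha> r t u x t + F x (fst (G (x, t))) \<le> 0"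
proof -
  define \<psi> where "\<psi> = (\<lambda>z. \<phi> z + (u (x, t) - \<phi> (x, t)))"
  have \<psi>u: "u z \<le> \<psi> z" if "z \<in> UNIV \<times> {0..T}" for z
    using max[OF that] by (simp add: \<psi>_def)
  have C\<phi>: "C1_on (UNIV \<times> {0<..T}) \<phi> G" "continuous_on (UNIV \<times> {0..T}) \<phi>"
    using test by (auto simp: evol_test_function_def)
  have C\<psi>: "C1_on (UNIV \<times> {0<..T}) \<psi> G" "continuous_on (UNIV \<times> {0..T}) \<psi>"
    using C1_on_add[OF C\<phi>(1) C1_on_const] C\<phi>(2) by (auto simp: \<psi>_def intro!: continuous_intros)
  define k where "k = \<alpha> / Gamma (1 - \<alpha>)"
  have Gp: "Gamma (1 - \<alpha>) > 0" using \<alpha> by (simp add: Gamma_real_pos)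
  have k0: "k \<ge> 0" using \<alpha> Gp by (simp add: k_def)
  have cont_ux: "continuous_on {0..T} (\<lambda>s. u (x, s))"
    using continuous_on_time_slice[OF BUC_on_imp_continuous_on[OF u]] by blast
  obtain \<eta> \<eta>' where \<eta>: "C1_on UNIV \<eta> \<eta>'" "\<And>s. 0 \<le> \<eta> s" "\<And>s. \<eta> s \<le> 1"
    "\<And>s. s \<le> t - r \<Longrightarrow> \<eta> s = 1" "\<And>s. s \<ge> t - r / 2 \<Longrightarrow> \<eta> s = 0"
    using C1_cutoff[of "t - r" "t - r / 2"] r by auto
  have C\<eta>: "C1_on (UNIV \<times> {0<..T}) (\<lambda>z::'a \<times> real. \<eta> (snd z)) (\<lambda>z. (0, \<eta>' (snd z)))"
    by (rule C1_on_snd[OF C1_on_subset[OF \<eta>(1)]]) simp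
  define c where "c = 3 / (t powr \<alpha> * Gamma (1 - \<alpha>)) + k * (3 / (r / 2) powr (\<alpha> + 1) * t)"
  have "J \<alpha> u x t + K \<alpha> 0 r \<phi> x t + K \<alpha> r t u x t + F x (fst (G (x, t))) \<le> 0 + c * e"
    if e: "e > 0" for e
  proof -
    obtain D where D: "D \<ge> 0"
      "\<And>x y s. s \<in> {0..T} \<Longrightarrow> u (y, s) \<le> u (x, s) + e + D * (norm (y - x))\<^sup>2"
      using BUC_on_below_paraboloid[OF u e] by blast
    obtain q where q: "real_polynomial_function q" "\<And>s. s \<in> {0..T} \<Longrightarrow> \<bar>u (x, s) - q s\<bar> < e"
      using Stone_Weierstrass_real_polynomial_function[OF compact_Icc cont_ux e] by blast
    obtain q' where q': "real_polynomial_function q'" "\<And>s. (q has_real_derivative q' s) (at s)"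
      using has_real_derivative_polynomial_function[OF q(1)] by blast
    have Cq: "C1_on {0<..T} q q'"
      using q' by (intro C1_on_real)
        (auto intro: continuous_on_polymonial_function has_field_derivative_at_within
          simp: real_polynomial_function_eq)
    \<comment> \<open>A \<open>C\<^sup>1\<close> majorant of \<open>u\<close> that is within \<open>3 e\<close> of it on the line over \<open>x\<close>: the
       polynomial \<open>q\<close> handles the time dependence, the paraboloid the dependence on space.\<close>
    define W where "W = (\<lambda>z::'a \<times> real. q (snd z) + (2 * e + D * (norm (fst z - x))\<^sup>2))"
    define GW where "GW = (\<lambda>z::'a \<times> real. (0, q' (snd z)) + (0 + D *\<^sub>R (2 *\<^sub>R (fst z - x), 0)))"
    have CW: "C1_on (UNIV \<times> {0<..T}) W GW"
      unfolding W_def GW_def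
      by (intro C1_on_add C1_on_snd[OF Cq] C1_on_const C1_on_cmult C1_on_fst[OF C1_on_sqnorm])
    have contW: "continuous_on (UNIV \<times> {0..T}) W"
    proof -
      have "continuous_on UNIV q"
        using q(1) by (intro continuous_on_polymonial_function) (simp add: real_polynomial_function_eq)
      then have "continuous_on (UNIV \<times> {0..T}) (\<lambda>z::'a \<times> real. q (snd z))"
        by (rule continuous_on_compose2[OF _ continuous_on_snd[OF continuous_on_id] subset_UNIV])
      then show ?thesis unfolding W_def by (intro continuous_intros)
    qed
    have uW: "u z \<le> W z" if "z \<in> UNIV \<times> {0..T}" for z
      using D(2)[of "snd z" "fst z" x] q(2)[of "snd z"] that by (auto simp: W_def abs_less_iff)
    have Wu: "W (x, s) \<le> u (x, s) + 3 * e" if "s \<in> {0..T}" for s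
      using q(2)[OF that] by (auto simp: W_def abs_less_iff)
    \<comment> \<open>Equal to \<open>\<psi>\<close> for times after \<open>t - r / 2\<close>, hence with the same gradient at \<open>(x, t)\<close>, and
       to \<open>W\<close> for times before \<open>t - r\<close>.\<close>
    define \<Phi> where "\<Phi> = (\<lambda>z. \<psi> z + \<eta> (snd z) * (W z + - \<psi> z))"
    define G\<Phi> where "G\<Phi> = (\<lambda>z. G z + (\<eta> (snd z) *\<^sub>R (GW z + - G z) + (W z + - \<psi> z) *\<^sub>R (0, \<eta>' (snd z))))"
    have C\<Phi>: "C1_on (UNIV \<times> {0<..T}) \<Phi> G\<Phi>"
      unfolding \<Phi>_def G\<Phi>_def
      by (intro C1_on_add C\<psi> C1_on_mult C\<eta> CW C1_on_uminus)
    have "continuous_on UNIV \<eta>" using C1_on_imp_continuous_on[OF \<eta>(1)] .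
    then have "continuous_on (UNIV \<times> {0..T}) (\<lambda>z::'a \<times> real. \<eta> (snd z))"
      by (rule continuous_on_compose2[OF _ continuous_on_snd[OF continuous_on_id] subset_UNIV])
    then have "continuous_on (UNIV \<times> {0..T}) \<Phi>"
      unfolding \<Phi>_def by (intro continuous_on_add continuous_on_mult continuous_on_minus contW C\<psi>)
    with C\<Phi> have test\<Phi>: "evol_test_function T \<Phi> G\<Phi>" by (simp add: evol_test_function_def)
    have \<Phi>t: "\<Phi> (x, t) = u (x, t)" "fst (G\<Phi> (x, t)) = fst (G (x, t))"
      using \<eta>(5)[of t] r by (auto simp: \<Phi>_def \<psi>_def G\<Phi>_def)
    have \<Phi>u: "u z \<le> \<Phi> z" if "z \<in> UNIV \<times> {0..T}" for z
    proof -
      have "u z = (1 - \<eta> (snd z)) * u z + \<eta> (snd z) * u z" by (simp add: algebra_simps)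
      also have "\<dots> \<le> (1 - \<eta> (snd z)) * \<psi> z + \<eta> (snd z) * W z"
        using \<eta>(2,3)[of "snd z"] \<psi>u[OF that] uW[OF that] by (intro add_mono mult_left_mono) auto
      finally show ?thesis by (simp add: \<Phi>_def algebra_simps)
    qed
    have "\<forall>z\<in>UNIV \<times> {0..T}. u z - \<Phi> z \<le> u (x, t) - \<Phi> (x, t)"
      using \<Phi>u \<Phi>t by (simp add: le_diff_eq)
    then have visc: "J \<alpha> \<Phi> x t + K \<alpha> 0 t \<Phi> x t + F x (fst (G (x, t))) \<le> 0"
      using sub test\<Phi> t \<Phi>t unfolding evol_visc_subsolution_def by metis
    have JJ: "J \<alpha> u x t \<le> J \<alpha> \<Phi> x t + 3 * e / (t powr \<alpha> * Gamma (1 - \<alpha>))"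
    proof -
      have "\<Phi> (x, 0) \<le> u (x, 0) + 3 * e"
        using \<eta>(4)[of 0] r Wu[of 0] t by (simp add: \<Phi>_def)
      then have "u (x, t) - u (x, 0) \<le> (\<Phi> (x, t) - \<Phi> (x, 0)) + 3 * e" using \<Phi>t by simp
      then have "(u (x, t) - u (x, 0)) / (t powr \<alpha> * Gamma (1 - \<alpha>))
          \<le> ((\<Phi> (x, t) - \<Phi> (x, 0)) + 3 * e) / (t powr \<alpha> * Gamma (1 - \<alpha>))"
        using t Gp by (intro divide_right_mono) auto
      then show ?thesis by (simp add: J_def add_divide_distrib)
    qed
    \<comment> \<open>The functions are exchanged only for \<open>\<tau> \<ge> r / 2\<close>, where the kernel is bounded.\<close>
    define e' where "e' = 3 * e / (r / 2) powr (\<alpha> + 1)"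
    have e'le: "3 * e / \<tau> powr (\<alpha> + 1) \<le> e'" if "\<tau> \<ge> r / 2" for \<tau>
      unfolding e'_def using that e r \<alpha> by (intro divide_left_mono powr_mono2 mult_pos_pos) auto
    have e'0: "e' \<ge> 0" using e by (simp add: e'_def)
    obtain C where int\<Phi>: "set_integrable lborel {0<..<t} (K_integrand \<alpha> \<Phi> x t)"
      using K_integrand_integrable_test_function[OF \<alpha> test\<Phi> t] by blast
    obtain C where int\<phi>: "set_integrable lborel {0<..<t} (K_integrand \<alpha> \<phi> x t)"
      using K_integrand_integrable_test_function[OF \<alpha> test t] by blast
    have K1: "K \<alpha> 0 r \<phi> x t \<le> K \<alpha> 0 r \<Phi> x t + \<alpha> / Gamma (1 - \<alpha>) * (e' * (r - 0))"
    proof (rule K_mono[OF \<alpha>])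
      show "set_integrable lborel {0<..<r} (K_integrand \<alpha> \<phi> x t)" "set_integrable lborel {0<..<r} (K_integrand \<alpha> \<Phi> x t)"
        using r by (auto intro: set_integrable_subset[OF int\<phi>] set_integrable_subset[OF int\<Phi>])
      fix \<tau> assume \<tau>: "\<tau> \<in> {0<..<r}"
      show "K_integrand \<alpha> \<phi> x t \<tau> \<le> K_integrand \<alpha> \<Phi> x t \<tau> + e'"
      proof (cases "\<tau> \<le> r / 2")
        case True
        then have "\<Phi> (x, t - \<tau>) = \<psi> (x, t - \<tau>)" using \<eta>(5)[of "t - \<tau>"] by (simp add: \<Phi>_def)
        then show ?thesis using e'0 \<Phi>t by (simp add: \<psi>_def)
      next
        case False
        have s: "t - \<tau> \<in> {0..T}" using \<tau> r t by auto
        have "W (x, t - \<tau>) + - \<psi> (x, t - \<tau>) \<le> 3 * e"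
          using Wu[OF s] \<psi>u[of "(x, t - \<tau>)"] s by auto
        then have "\<eta> (t - \<tau>) * (W (x, t - \<tau>) + - \<psi> (x, t - \<tau>)) \<le> 1 * (3 * e)"
          using mult_left_mono[OF _ \<eta>(2)] mult_right_mono[OF \<eta>(3), of "3 * e"] e
          by (meson less_imp_le mult_nonneg_nonneg order_trans zero_le_numeral)
        moreover have "\<Phi> (x, t - \<tau>)
            = \<psi> (x, t - \<tau>) + \<eta> (t - \<tau>) * (W (x, t - \<tau>) + - \<psi> (x, t - \<tau>))"
          by (simp add: \<Phi>_def)
        ultimately have "\<phi> (x, t) - \<phi> (x, t - \<tau>) \<le> (\<Phi> (x, t) - \<Phi> (x, t - \<tau>)) + 3 * e"
          using \<Phi>t(1) unfolding \<psi>_def by linarith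
        then have "K_integrand \<alpha> \<phi> x t \<tau> \<le> ((\<Phi> (x, t) - \<Phi> (x, t - \<tau>)) + 3 * e) / \<tau> powr (\<alpha> + 1)"
          by (intro divide_right_mono) auto
        also have "\<dots> \<le> K_integrand \<alpha> \<Phi> x t \<tau> + e'"
          using e'le[of \<tau>] False by (simp add: add_divide_distrib)
        finally show ?thesis .
      qed
    qed (use r in auto)
    have K2: "K \<alpha> r t u x t \<le> K \<alpha> r t \<Phi> x t + \<alpha> / Gamma (1 - \<alpha>) * (e' * (t - r))"
    proof (rule K_mono[OF \<alpha>])
      show "set_integrable lborel {r<..<t} (K_integrand \<alpha> u x t)"
        using K_integrand_integrable_bounded[OF \<alpha> u] t r by simp
      show "set_integrable lborel {r<..<t} (K_integrand \<alpha> \<Phi> x t)"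
        using r by (auto intro: set_integrable_subset[OF int\<Phi>])
      fix \<tau> assume \<tau>: "\<tau> \<in> {r<..<t}"
      then have s: "t - \<tau> \<in> {0..T}" using r t by auto
      have "\<Phi> (x, t - \<tau>) = W (x, t - \<tau>)" using \<tau> \<eta>(4)[of "t - \<tau>"] by (simp add: \<Phi>_def)
      then have "u (x, t) - u (x, t - \<tau>) \<le> (\<Phi> (x, t) - \<Phi> (x, t - \<tau>)) + 3 * e"
        using Wu[OF s] \<Phi>t(1) by simp
      then have "K_integrand \<alpha> u x t \<tau> \<le> ((\<Phi> (x, t) - \<Phi> (x, t - \<tau>)) + 3 * e) / \<tau> powr (\<alpha> + 1)"
        by (intro divide_right_mono) auto
      also have "\<dots> \<le> K_integrand \<alpha> \<Phi> x t \<tau> + e'"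
        using e'le[of \<tau>] \<tau> r by (simp add: add_divide_distrib)
      finally show "K_integrand \<alpha> u x t \<tau> \<le> K_integrand \<alpha> \<Phi> x t \<tau> + e'" .
    qed (use r in auto)
    have sp: "K \<alpha> 0 t \<Phi> x t = K \<alpha> 0 r \<Phi> x t + K \<alpha> r t \<Phi> x t"
      by (rule K_split[OF _ _ _ int\<Phi>]) (use r in auto)
    have "k * (e' * (r - 0)) + k * (e' * (t - r)) = k * (e' * t)" by (simp add: algebra_simps)
    also have "\<dots> = k * (3 / (r / 2) powr (\<alpha> + 1) * t) * e" by (simp add: e'_def)
    finally have "k * (e' * (r - 0)) + k * (e' * (t - r)) + 3 * e / (t powr \<alpha> * Gamma (1 - \<alpha>)) = c * e"
      unfolding c_def by (simp add: distrib_right)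
    with visc JJ K1 K2 sp show ?thesis unfolding k_def by linarith
  qed
  then show ?thesis by (rule le_add_eps)
qed

text \<open>Reflection transfers all results on subsolutions to supersolutions.\<close>

lemma evol_visc_supersolution_uminus:
  assumes "evol_visc_supersolution \<alpha> T F u0 w"
  shows "evol_visc_subsolution \<alpha> T (\<lambda>x p. - F x (- p)) (\<lambda>x. - u0 x) (\<lambda>z. - w z)"
  unfolding evol_visc_subsolution_def
proof (intro conjI allI impI)
  have lsc: "lsc_on (UNIV \<times> {0..T}) w" and i: "\<And>x. w (x, 0) \<ge> u0 x"
    and super: "\<And>\<phi> G x t. evol_test_function T \<phi> G \<Longrightarrow> t \<in> {0<..T} \<Longrightarrow>
        (\<forall>z\<in>UNIV \<times> {0..T}. w z - \<phi> z \<ge> w (x, t) - \<phi> (x, t)) \<Longrightarrow>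
        J \<alpha> \<phi> x t + K \<alpha> 0 t \<phi> x t + F x (fst (G (x, t))) \<ge> 0"
    using assms unfolding evol_visc_supersolution_def by blast+
  show "usc_on (UNIV \<times> {0..T}) (\<lambda>z. - w z)"
    unfolding usc_on_def
  proof (intro ballI allI impI)
    fix z c assume "z \<in> UNIV \<times> {0..T}" "- w z < c"
    then have "\<forall>\<^sub>F v in at z within UNIV \<times> {0..T}. - c < w v"
      using lsc unfolding lsc_on_def by auto
    then show "\<forall>\<^sub>F v in at z within UNIV \<times> {0..T}. - w v < c"
      by eventually_elim auto
  qed
  show "- w (x, 0) \<le> - u0 x" for x using i by simp
  fix \<phi> G x t
  assume a: "evol_test_function T \<phi> G \<and> t \<in> {0<..T} \<and>
        (\<forall>z\<in>UNIV \<times> {0..T}. - w z - \<phi> z \<le> - w (x, t) - \<phi> (x, t))"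
  have "evol_test_function T (\<lambda>z. - \<phi> z) (\<lambda>z. - G z)"
    using a C1_on_uminus by (auto simp: evol_test_function_def intro: continuous_on_minus)
  moreover have "\<forall>z\<in>UNIV \<times> {0..T}. w z - - \<phi> z \<ge> w (x, t) - - \<phi> (x, t)"
  proof
    fix z :: "'a \<times> real" assume "z \<in> UNIV \<times> {0..T}"
    with a have "- w z - \<phi> z \<le> - w (x, t) - \<phi> (x, t)" by blast
    then show "w z - - \<phi> z \<ge> w (x, t) - - \<phi> (x, t)" by linarith
  qed
  ultimately have "J \<alpha> (\<lambda>z. - \<phi> z) x t + K \<alpha> 0 t (\<lambda>z. - \<phi> z) x t + F x (- fst (G (x, t))) \<ge> 0"
    using super[of "\<lambda>z. - \<phi> z" "\<lambda>z. - G z" t x] a by simp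
  then show "J \<alpha> \<phi> x t + K \<alpha> 0 t \<phi> x t + - F x (- fst (G (x, t))) \<le> 0"
    by (simp add: J_uminus K_uminus)
qed

section \<open>Doubling of variables\<close>

text \<open>The function whose maximum is taken after doubling the time variable and, in the argument of
  \<open>B\<close>, the space variable. The squared distances from \<open>(xh, yh, th)\<close> make that point the only
  limit of maximisers and supply coercivity; \<open>m\<close> is the strength of the penalisation.\<close>

definition doubled ::
  "real \<Rightarrow> real \<Rightarrow> ('a::euclidean_space \<times> real \<Rightarrow> real) \<Rightarrow> ('a \<times> real \<Rightarrow> real) \<Rightarrow> ('a \<Rightarrow> real) \<Rightarrow>
   ('a \<times> 'a \<Rightarrow> real) \<Rightarrow> 'a \<Rightarrow> 'a \<Rightarrow> real \<Rightarrow> real \<Rightarrow> 'a \<Rightarrow> 'a \<Rightarrow> 'a \<Rightarrow> real \<Rightarrow> real \<Rightarrow> real" where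
  "doubled \<alpha> c u w B A xh yh th m x y z t s =
     u (x, t) - w (y, s) - B z - A (x, y) - c * t powr \<alpha>
     - ((norm (x - xh))\<^sup>2 + (norm (y - yh))\<^sup>2 + (t - th)\<^sup>2)
     - m * ((norm (x - z))\<^sup>2 + (t - s)\<^sup>2)"

lemma doubled_attains_max:
  fixes u w :: "'a::euclidean_space \<times> real \<Rightarrow> real"
  assumes \<alpha>: "\<alpha> \<in> {0<..<1}" and u: "BUC_on (UNIV \<times> {0..T}) u" and w: "BUC_on (UNIV \<times> {0..T}) w"
    and B: "continuous_on UNIV B" "bounded (range B)"
    and A: "continuous_on UNIV A" "\<And>z. 0 \<le> A z" and c: "c \<ge> 0" and m: "m \<ge> 1" and T: "T \<ge> 0"
  obtains x y z t s where "t \<in> {0..T}" "s \<in> {0..T}"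
    "\<And>x' y' z' t' s'. t' \<in> {0..T} \<Longrightarrow> s' \<in> {0..T} \<Longrightarrow>
       doubled \<alpha> c u w B A xh yh th m x' y' z' t' s' \<le> doubled \<alpha> c u w B A xh yh th m x y z t s"
proof -
  define f where "f = (\<lambda>(x, y, z, t, s). doubled \<alpha> c u w B A xh yh th m x y z t s)"
  define S where "S = (UNIV :: 'a set) \<times> (UNIV :: 'a set) \<times> (UNIV :: 'a set) \<times> {0..T} \<times> {0..T}"
  define p0 where "p0 = (xh, xh, xh, 0::real, 0::real)"
  have cl: "closed S" unfolding S_def by (intro closed_Times) auto
  have cf: "continuous_on S f"
  proof -
    have "continuous_on S (\<lambda>p. u (fst p, fst (snd (snd (snd p)))))"
      by (rule continuous_on_compose2[OF BUC_on_imp_continuous_on[OF u]])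
         (auto simp: S_def intro!: continuous_intros)
    moreover have "continuous_on S (\<lambda>p. w (fst (snd p), snd (snd (snd (snd p)))))"
      by (rule continuous_on_compose2[OF BUC_on_imp_continuous_on[OF w]])
         (auto simp: S_def intro!: continuous_intros)
    moreover have "continuous_on S (\<lambda>p. B (fst (snd (snd p))))"
      by (rule continuous_on_compose2[OF B(1)]) (auto intro!: continuous_intros)
    moreover have "continuous_on S (\<lambda>p. A (fst p, fst (snd p)))"
      by (rule continuous_on_compose2[OF A(1)]) (auto intro!: continuous_intros)
    moreover have "continuous_on S (\<lambda>p. fst (snd (snd (snd p))) powr \<alpha>)"
      using \<alpha> by (intro continuous_on_powr' continuous_intros) (auto simp: S_def)
    ultimately show ?thesis
      unfolding f_def doubled_def case_prod_beta'
      by (intro continuous_on_arith)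
  qed
  obtain Bu where Bu: "0 \<le> Bu" "\<And>z. z \<in> UNIV \<times> {0..T} \<Longrightarrow> \<bar>u z\<bar> \<le> Bu"
    using BUC_on_boundE[OF u] by blast
  obtain Bw where Bw: "0 \<le> Bw" "\<And>z. z \<in> UNIV \<times> {0..T} \<Longrightarrow> \<bar>w z\<bar> \<le> Bw"
    using BUC_on_boundE[OF w] by blast
  obtain BB where BB: "\<And>z. \<bar>B z\<bar> \<le> BB"
    using B(2) unfolding bounded_iff real_norm_def by blast
  define M where "M = Bu + Bw + BB - f p0"
  have bd: "bounded {p \<in> S. f p \<ge> f p0}"
  proof -
    have "{p \<in> S. f p \<ge> f p0}
        \<subseteq> cball xh (1 + M) \<times> cball yh (1 + M) \<times> cball xh ((1 + M) + (1 + M)) \<times> {0..T} \<times> {0..T}"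
    proof
      fix p assume p: "p \<in> {p \<in> S. f p \<ge> f p0}"
      obtain x y z t s where xyz: "p = (x, y, z, t, s)" by (metis prod.exhaust)
      have ts: "t \<in> {0..T}" "s \<in> {0..T}" using p by (auto simp: xyz S_def)
      have "f p \<ge> f p0" using p by simp
      then have "f p0 \<le> doubled \<alpha> c u w B A xh yh th m x y z t s" by (simp add: f_def xyz)
      moreover have "u (x, t) \<le> Bu" "- w (y, s) \<le> Bw" "- B z \<le> BB" "0 \<le> A (x, y)" "0 \<le> c * t powr \<alpha>"
        using Bu(2)[of "(x, t)"] Bw(2)[of "(y, s)"] BB[of z] A(2) ts c by auto
      moreover have "(norm (x - z))\<^sup>2 \<le> m * ((norm (x - z))\<^sup>2 + (t - s)\<^sup>2)"
        using mult_mono[of 1 m "(norm (x - z))\<^sup>2" "(norm (x - z))\<^sup>2 + (t - s)\<^sup>2"] m by simp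
      ultimately have "(norm (x - xh))\<^sup>2 + (norm (y - yh))\<^sup>2 + (t - th)\<^sup>2 + (norm (x - z))\<^sup>2 \<le> M"
        unfolding doubled_def M_def by linarith
      moreover have "0 \<le> (norm (x - xh))\<^sup>2" "0 \<le> (norm (y - yh))\<^sup>2" "0 \<le> (t - th)\<^sup>2" "0 \<le> (norm (x - z))\<^sup>2"
        by simp_all
      ultimately have sq: "(norm (x - xh))\<^sup>2 \<le> M" "(norm (y - yh))\<^sup>2 \<le> M" "(norm (x - z))\<^sup>2 \<le> M"
        by linarith+
      have "dist xh z \<le> dist xh x + dist x z" by (rule dist_triangle)
      moreover have "dist xh x \<le> 1 + M" "dist yh y \<le> 1 + M" "dist x z \<le> 1 + M"
        using sq[THEN le_one_plus_of_square_le] by (simp_all add: dist_norm norm_minus_commute)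
      ultimately show "p \<in> cball xh (1 + M) \<times> cball yh (1 + M) \<times> cball xh ((1 + M) + (1 + M)) \<times> {0..T} \<times> {0..T}"
        using ts by (auto simp: xyz)
    qed
    then show ?thesis
      by (rule bounded_subset[rotated]) (intro bounded_Times bounded_cball bounded_closed_interval)
  qed
  have "p0 \<in> S" using T by (simp add: p0_def S_def)
  then obtain p where p: "p \<in> S" "\<And>q. q \<in> S \<Longrightarrow> f q \<le> f p"
    using continuous_attains_sup_coercive[OF cl cf _ bd] by blast
  obtain x y z t s where xyz: "p = (x, y, z, t, s)" by (metis prod.exhaust)
  show thesis
  proof (rule that[of t s x y z])
    show "t \<in> {0..T}" "s \<in> {0..T}" using p(1) by (auto simp: xyz S_def)
    fix x' y' z' t' s' assume "t' \<in> {0..T}" "s' \<in> {0..T}"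
    then show "doubled \<alpha> c u w B A xh yh th m x' y' z' t' s' \<le> doubled \<alpha> c u w B A xh yh th m x y z t s"
      using p(2)[of "(x', y', z', t', s')"] by (simp add: xyz f_def S_def)
  qed
qed

text \<open>The viscosity inequalities for \<open>u\<close> and \<open>w\<close> at a maximum of the doubled function, subtracted. The
  singular parts of the two nonlocal operators may be infinite; what is controlled is their
  difference, because shifting both times together changes the doubled function only through the
  localisation in \<open>t\<close>, which costs at most \<open>3 T \<tau>\<close>.\<close>

lemma doubled_viscosity_inequality:
  fixes u w :: "'a::euclidean_space \<times> real \<Rightarrow> real"
  assumes \<alpha>: "\<alpha> \<in> {0<..<1}" and u: "BUC_on (UNIV \<times> {0..T}) u" and w: "BUC_on (UNIV \<times> {0..T}) w"
    and sub: "evol_visc_subsolution \<alpha> T F1 u0 u" and super: "evol_visc_supersolution \<alpha> T F2 w0 w"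
    and A: "C1_on UNIV A G" and c: "c \<ge> 0" and th: "th \<in> {0..T}"
    and t: "t \<in> {0<..T}" and s: "s \<in> {0<..T}"
    and max: "\<And>x' y' z' t' s'. t' \<in> {0..T} \<Longrightarrow> s' \<in> {0..T} \<Longrightarrow>
       doubled \<alpha> c u w B A xh yh th m x' y' z' t' s' \<le> doubled \<alpha> c u w B A xh yh th m x y z t s"
    and r: "0 < r" "r < t" "r < s"
  shows "J \<alpha> u x t - J \<alpha> w y s + (K \<alpha> r t u x t - K \<alpha> r s w y s)
     - 3 * T * (\<alpha> / Gamma (1 - \<alpha>) * (r powr (1 - \<alpha>) / (1 - \<alpha>)))
     \<le> F2 y (- snd (G (x, y)) - 2 *\<^sub>R (y - yh))
       - F1 x ((2 * m) *\<^sub>R (x - z) + fst (G (x, y)) + 2 *\<^sub>R (x - xh))"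
proof -
  define k where "k = (\<lambda>r. \<alpha> / Gamma (1 - \<alpha>) * (r powr (1 - \<alpha>) / (1 - \<alpha>)))"
  note wsub = evol_visc_supersolution_uminus[OF super]
  have wB: "BUC_on (UNIV \<times> {0..T}) (\<lambda>z. - w z)"
    using w unfolding BUC_on_def
    by (auto simp: bounded_iff intro: uniformly_continuous_on_minus)
  define \<phi> where "\<phi> = (\<lambda>q::'a \<times> real.
     (A (fst q, y) + (1 * (norm (fst q - xh))\<^sup>2 + m * (norm (fst q - z))\<^sup>2))
      + (c * snd q powr \<alpha> + (1 * (norm (snd q - th))\<^sup>2 + m * (norm (snd q - s))\<^sup>2)))"
  define G\<phi> where "G\<phi> = (\<lambda>q::'a \<times> real.
     (fst (G (fst q, y)) + (1 *\<^sub>R (2 *\<^sub>R (fst q - xh)) + m *\<^sub>R (2 *\<^sub>R (fst q - z))), 0::real)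
      + (0, c *\<^sub>R (\<alpha> * snd q powr (\<alpha> - 1))
           + (1 *\<^sub>R (2 *\<^sub>R (snd q - th)) + m *\<^sub>R (2 *\<^sub>R (snd q - s)))))"
  define \<psi> where "\<psi> = (\<lambda>q::'a \<times> real.
     (A (x, fst q) + 1 * (norm (fst q - yh))\<^sup>2) + m * (norm (snd q - t))\<^sup>2)"
  define G\<psi> where "G\<psi> = (\<lambda>q::'a \<times> real.
     (snd (G (x, fst q)) + 1 *\<^sub>R (2 *\<^sub>R (fst q - yh)), 0::real)
      + (0, m *\<^sub>R (2 *\<^sub>R (snd q - t))))"
  have cA: "continuous_on UNIV A" by (rule C1_on_imp_continuous_on[OF A])
  have test\<phi>: "evol_test_function T \<phi> G\<phi>"
    unfolding evol_test_function_def
  proof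
    show "C1_on (UNIV \<times> {0<..T}) \<phi> G\<phi>"
      unfolding \<phi>_def G\<phi>_def
      by (rule C1_on_add[OF C1_on_fst C1_on_snd];
          intro C1_on_add C1_on_cmult C1_on_sqnorm C1_on_slice_fst[OF A] C1_on_powr)
    have "continuous_on (UNIV \<times> {0..T}) (\<lambda>q::'a \<times> real. A (fst q, y))"
      by (rule continuous_on_compose2[OF cA _ subset_UNIV]) (intro continuous_intros)
    moreover have "continuous_on (UNIV \<times> {0..T}) (\<lambda>q::'a \<times> real. snd q powr \<alpha>)"
      using \<alpha> by (intro continuous_on_powr' continuous_intros) auto
    ultimately show "continuous_on (UNIV \<times> {0..T}) \<phi>"
      unfolding \<phi>_def
      by (intro continuous_on_arith)
  qed
  have test\<psi>: "evol_test_function T \<psi> G\<psi>"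
    unfolding evol_test_function_def
  proof
    show "C1_on (UNIV \<times> {0<..T}) \<psi> G\<psi>"
      unfolding \<psi>_def G\<psi>_def
      by (rule C1_on_add[OF C1_on_fst C1_on_snd];
          intro C1_on_add C1_on_cmult C1_on_sqnorm C1_on_slice_snd[OF A])
    have "continuous_on (UNIV \<times> {0..T}) (\<lambda>q::'a \<times> real. A (x, fst q))"
      by (rule continuous_on_compose2[OF cA _ subset_UNIV]) (intro continuous_intros)
    then show "continuous_on (UNIV \<times> {0..T}) \<psi>"
      unfolding \<psi>_def
      by (intro continuous_on_arith)
  qed
  have max\<phi>: "u q - \<phi> q \<le> u (x, t) - \<phi> (x, t)" if "q \<in> UNIV \<times> {0..T}" for q
    using max[of "snd q" s "fst q" y z] that s
    by (simp add: doubled_def \<phi>_def algebra_simps mem_Times_iff)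
  have max\<psi>: "- w q - \<psi> q \<le> - w (y, s) - \<psi> (y, s)" if "q \<in> UNIV \<times> {0..T}" for q
    using max[of t "snd q" x "fst q" z] that t power2_commute[of "snd q" t] power2_commute[of s t]
    by (simp add: doubled_def \<psi>_def algebra_simps mem_Times_iff)
  obtain C\<phi> where C\<phi>: "C\<phi> \<ge> 0" "\<And>\<tau>. \<tau> \<in> {0<..t} \<Longrightarrow> \<bar>\<phi> (x, t) - \<phi> (x, t - \<tau>)\<bar> \<le> C\<phi> * \<tau>"
    "set_integrable lborel {0<..<t} (K_integrand \<alpha> \<phi> x t)"
    using K_integrand_integrable_test_function[OF \<alpha> test\<phi> t, of x] by blast
  obtain C\<psi> where C\<psi>: "C\<psi> \<ge> 0" "\<And>\<tau>. \<tau> \<in> {0<..s} \<Longrightarrow> \<bar>\<psi> (y, s) - \<psi> (y, s - \<tau>)\<bar> \<le> C\<psi> * \<tau>"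
    "set_integrable lborel {0<..<s} (K_integrand \<alpha> \<psi> y s)"
    using K_integrand_integrable_test_function[OF \<alpha> test\<psi> s, of y] by blast
  have g1: "fst (G\<phi> (x, t)) = (2 * m) *\<^sub>R (x - z) + fst (G (x, y)) + 2 *\<^sub>R (x - xh)"
    by (simp add: G\<phi>_def mult.commute[of m 2] add_ac)
  have g2: "- fst (G\<psi> (y, s)) = - snd (G (x, y)) - 2 *\<^sub>R (y - yh)"
    unfolding G\<psi>_def by simp
  \<comment> \<open>Simultaneous translation in the two time variables leaves the penalisation of their
     difference invariant.\<close>
  have drift: "(u (x, t) - u (x, t - \<tau>)) - (w (y, s) - w (y, s - \<tau>)) \<ge> - (3 * T * \<tau>)"
    if \<tau>: "\<tau> \<in> {r'<..<r}" "0 < r'" for \<tau> r'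
  proof -
    have "doubled \<alpha> c u w B A xh yh th m x y z (t - \<tau>) (s - \<tau>) \<le> doubled \<alpha> c u w B A xh yh th m x y z t s"
      using \<tau> r t s by (intro max) auto
    moreover have "c * (t - \<tau>) powr \<alpha> \<le> c * t powr \<alpha>"
      using \<tau> r t c \<alpha> by (intro mult_left_mono powr_mono2) auto
    ultimately have "(u (x, t) - u (x, t - \<tau>)) - (w (y, s) - w (y, s - \<tau>)) \<ge> (t - th)\<^sup>2 - (t - \<tau> - th)\<^sup>2"
      by (simp add: doubled_def)
    also have "(t - th)\<^sup>2 - (t - \<tau> - th)\<^sup>2 = (2 * (t - th) - \<tau>) * \<tau>"
      by (simp add: power2_eq_square algebra_simps)
    finally have 1: "(2 * (t - th) - \<tau>) * \<tau> \<le> (u (x, t) - u (x, t - \<tau>)) - (w (y, s) - w (y, s - \<tau>))" .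
    have "(- (3 * T)) * \<tau> \<le> (2 * (t - th) - \<tau>) * \<tau>"
      using \<tau> th t r by (intro mult_right_mono) auto
    with 1 show ?thesis by simp
  qed
  define LHS where "LHS = J \<alpha> u x t - J \<alpha> w y s + (K \<alpha> r t u x t - K \<alpha> r s w y s) - 3 * T * k r"
  define RHS where "RHS = F2 y (- snd (G (x, y)) - 2 *\<^sub>R (y - yh))
       - F1 x ((2 * m) *\<^sub>R (x - z) + fst (G (x, y)) + 2 *\<^sub>R (x - xh))"
  \<comment> \<open>Only the part of the kernel on \<open>(0, r')\<close> sees the test functions, and it vanishes with \<open>r'\<close>;
     the part on \<open>(r', r)\<close> is bounded below by the drift.\<close>
  have key: "LHS - RHS \<le> C\<phi> * k r' + C\<psi> * k r'" if r': "0 < r'" "r' < r" for r'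
  proof -
    have 1: "J \<alpha> u x t + K \<alpha> 0 r' \<phi> x t + K \<alpha> r' t u x t + F1 x (fst (G\<phi> (x, t))) \<le> 0"
      by (rule nonlocal_subsolution[OF \<alpha> u sub test\<phi> t max\<phi>]) (use r r' in auto)
    have 2: "J \<alpha> (\<lambda>z. - w z) y s + K \<alpha> 0 r' \<psi> y s + K \<alpha> r' s (\<lambda>z. - w z) y s
        + - F2 y (- fst (G\<psi> (y, s))) \<le> 0"
      by (rule nonlocal_subsolution[OF \<alpha> wB wsub test\<psi> s max\<psi>]) (use r r' in auto)
    have iu: "set_integrable lborel {r'<..<t} (K_integrand \<alpha> u x t)"
      using K_integrand_integrable_bounded[OF \<alpha> u] t r' by simp
    have iw: "set_integrable lborel {r'<..<s} (K_integrand \<alpha> w y s)"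
      using K_integrand_integrable_bounded[OF \<alpha> w] s r' by simp
    have s1: "K \<alpha> r' t u x t = K \<alpha> r' r u x t + K \<alpha> r t u x t"
      by (rule K_split[OF _ _ _ iu]) (use r r' in auto)
    have s2: "K \<alpha> r' s w y s = K \<alpha> r' r w y s + K \<alpha> r s w y s"
      by (rule K_split[OF _ _ _ iw]) (use r r' in auto)
    have 3: "K \<alpha> r' r u x t - K \<alpha> r' r w y s \<ge> - (3 * T * k r)"
      unfolding k_def
      by (rule K_diff_lower_bound[OF \<alpha>])
         (use r r' t drift in \<open>auto intro: set_integrable_subset[OF iu] set_integrable_subset[OF iw]\<close>)
    have 4: "\<bar>K \<alpha> 0 r' \<phi> x t\<bar> \<le> C\<phi> * k r'"
      unfolding k_def
      by (rule K_abs_bound[OF \<alpha>]) (use C\<phi> r r' in \<open>auto intro: set_integrable_subset[OF C\<phi>(3)]\<close>)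
    have 5: "\<bar>K \<alpha> 0 r' \<psi> y s\<bar> \<le> C\<psi> * k r'"
      unfolding k_def
      by (rule K_abs_bound[OF \<alpha>]) (use C\<psi> r r' in \<open>auto intro: set_integrable_subset[OF C\<psi>(3)]\<close>)
    show ?thesis
      using 1 2 3 4 5 s1 s2 unfolding LHS_def RHS_def g1 g2 J_uminus K_uminus by linarith
  qed
  have "((\<lambda>r'. C\<phi> * k r' + C\<psi> * k r') \<longlongrightarrow> C\<phi> * k 0 + C\<psi> * k 0) (at_right 0)"
    unfolding k_def using \<alpha>
    by (intro tendsto_add tendsto_mult tendsto_const tendsto_divide tendsto_powr2 tendsto_ident_at)
       (auto simp: eventually_at_filter)
  moreover have "\<forall>\<^sub>F r' in at_right 0. LHS - RHS \<le> C\<phi> * k r' + C\<psi> * k r'"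
    using eventually_at_right_real[OF r(1)] by eventually_elim (use key in auto)
  ultimately have "LHS - RHS \<le> C\<phi> * k 0 + C\<psi> * k 0"
    by (rule tendsto_lowerbound) simp
  then show ?thesis using \<alpha> by (simp add: k_def LHS_def RHS_def)
qed

text \<open>Since \<open>(xh, yh, th)\<close> maximises the undoubled function, the penalties at the maximisers are at
  most the oscillation of \<open>w\<close> and \<open>B\<close> between the doubled variables plus the error of \<open>A n\<close>. First
  boundedness forces the doubled variables together, and then uniform continuity forces the penalties
  to \<open>0\<close>.\<close>

lemma doubled_maximisers_converge:
  fixes u w :: "'a::euclidean_space \<times> real \<Rightarrow> real" and X Y Z :: "nat \<Rightarrow> 'a"
  assumes u: "BUC_on (UNIV \<times> {0..T}) u" and w: "BUC_on (UNIV \<times> {0..T}) w"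
    and B: "continuous_on UNIV B" "bounded (range B)"
    and A: "\<And>n z. \<bar>A n z - A0 z\<bar> \<le> err n" "err \<longlonglongrightarrow> 0"
    and th: "th \<in> {0..T}"
    and strict: "\<And>x y s. s \<in> {0..T} \<Longrightarrow> u (x, s) - w (y, s) - B x - A0 (x, y) - c * s powr \<alpha>
        \<le> u (xh, th) - w (yh, th) - B xh - A0 (xh, yh) - c * th powr \<alpha>"
    and ts: "\<And>n. t n \<in> {0..T}" "\<And>n. s n \<in> {0..T}"
    and max: "\<And>n. doubled \<alpha> c u w B (A n) xh yh th (real (Suc n)) xh yh xh th th
       \<le> doubled \<alpha> c u w B (A n) xh yh th (real (Suc n)) (X n) (Y n) (Z n) (t n) (s n)"
  shows "X \<longlonglongrightarrow> xh" "Y \<longlonglongrightarrow> yh" "Z \<longlonglongrightarrow> xh" "t \<longlonglongrightarrow> th" "s \<longlonglongrightarrow> th"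
proof -
  define q where "q = (\<lambda>n. 2 * err n + (w (Y n, t n) - w (Y n, s n)) + (B (X n) - B (Z n)))"
  define l where "l = (\<lambda>n. (norm (X n - xh))\<^sup>2 + (norm (Y n - yh))\<^sup>2 + (t n - th)\<^sup>2)"
  define p where "p = (\<lambda>n. (norm (X n - Z n))\<^sup>2 + (t n - s n)\<^sup>2)"
  have squeeze: "f \<longlonglongrightarrow> 0" if "\<And>n. 0 \<le> f n" "\<And>n. f n \<le> g n" "g \<longlonglongrightarrow> 0" for f g :: "nat \<Rightarrow> real"
    by (rule tendsto_sandwich[OF _ _ tendsto_const that(3)]) (simp_all add: that)
  have lp: "l n + real (Suc n) * p n \<le> q n" for n
    using max[of n] strict[OF ts(1), of "X n" n "Y n"] A(1)[of n "(xh, yh)"] A(1)[of n "(X n, Y n)"]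
    unfolding doubled_def q_def l_def p_def abs_le_iff by simp
  have l0: "0 \<le> l n" and p0: "0 \<le> p n" for n by (simp_all add: l_def p_def)
  obtain Bw where Bw: "0 \<le> Bw" "\<And>z. z \<in> UNIV \<times> {0..T} \<Longrightarrow> \<bar>w z\<bar> \<le> Bw"
    using BUC_on_boundE[OF w] by blast
  obtain BB where BB: "\<And>z. \<bar>B z\<bar> \<le> BB"
    using B(2) unfolding bounded_iff real_norm_def by blast
  obtain E where E: "\<And>n. \<bar>err n\<bar> \<le> E"
    using convergent_imp_Bseq[OF convergentI[OF A(2)]] unfolding Bseq_def real_norm_def by blast
  define M where "M = 2 * E + 2 * Bw + 2 * BB"
  have qM: "q n \<le> M" for n
    using E[of n] Bw(2)[of "(Y n, t n)"] Bw(2)[of "(Y n, s n)"] BB[of "X n"] BB[of "Z n"] ts[of n]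
    unfolding q_def M_def by (auto simp: abs_le_iff)
  have pM: "p n \<le> M / real (Suc n)" for n
    using lp[of n] l0[of n] qM[of n] by (simp add: field_simps del: of_nat_Suc)
  have "(\<lambda>n. M / real (Suc n)) \<longlonglongrightarrow> 0"
    by (intro LIMSEQ_Suc[of "\<lambda>n. M / real n"] lim_const_over_n)
  then have plim: "p \<longlonglongrightarrow> 0" by (rule squeeze[OF p0 pM])
  have "(\<lambda>n. (norm (X n - Z n))\<^sup>2) \<longlonglongrightarrow> 0" "(\<lambda>n. (t n - s n)\<^sup>2) \<longlonglongrightarrow> 0"
    by (rule squeeze[OF _ _ plim]; simp add: p_def)+
  then have XZ: "(\<lambda>n. norm (X n - Z n)) \<longlonglongrightarrow> 0" and tsl: "(\<lambda>n. t n - s n) \<longlonglongrightarrow> 0"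
    by (simp_all add: power_tendsto_0_iff)
  have dw: "(\<lambda>n. dist (w (Y n, t n)) (w (Y n, s n))) \<longlonglongrightarrow> 0"
  proof -
    have uc: "uniformly_continuous_on (UNIV \<times> {0..T}) w" using w by (simp add: BUC_on_def)
    have "(\<lambda>n. dist (Y n, t n) (Y n, s n)) \<longlonglongrightarrow> 0"
      using tendsto_rabs_zero[OF tsl] by (simp add: dist_Pair_Pair dist_real_def)
    then show ?thesis
      by (intro uc[unfolded uniformly_continuous_on_sequentially, THEN spec, THEN spec, THEN mp] conjI allI)
         (use ts in auto)
  qed
  have dB: "(\<lambda>n. dist (B (X n)) (B (Z n))) \<longlonglongrightarrow> 0"
  proof -
    define \<rho> where "\<rho> = 1 + M"
    have le: "a \<le> \<rho>" if "a\<^sup>2 \<le> M" for a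
      using le_one_plus_of_square_le[OF that] by (simp add: \<rho>_def)
    have X: "dist xh (X n) \<le> \<rho>" and Z: "dist xh (Z n) \<le> 2 * \<rho>" for n
    proof -
      have "l n + p n \<le> q n"
        using lp[of n] p0[of n] mult_right_mono[of 1 "real (Suc n)" "p n"] by simp
      then have "l n + p n \<le> M" using qM[of n] by linarith
      then have "(norm (X n - xh))\<^sup>2 \<le> M" "(norm (X n - Z n))\<^sup>2 \<le> M"
        using l0[of n] p0[of n] zero_le_power2[of "norm (X n - xh)"] zero_le_power2[of "norm (Y n - yh)"]
          zero_le_power2[of "t n - th"] zero_le_power2[of "norm (X n - Z n)"] zero_le_power2[of "t n - s n"]
        unfolding l_def p_def by linarith+
      then have "dist xh (X n) \<le> \<rho>" "dist (X n) (Z n) \<le> \<rho>"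
        using le by (simp_all add: dist_norm norm_minus_commute)
      then show "dist xh (X n) \<le> \<rho>" "dist xh (Z n) \<le> 2 * \<rho>"
        using dist_triangle[of xh "Z n" "X n"] by linarith+
    qed
    have "uniformly_continuous_on (cball xh (2 * \<rho>)) B"
      by (rule compact_uniformly_continuous) (use B(1) continuous_on_subset in auto)
    moreover have "X n \<in> cball xh (2 * \<rho>)" "Z n \<in> cball xh (2 * \<rho>)" for n
      using X[of n] Z[of n] zero_le_dist[of xh "X n"] by (auto simp del: zero_le_dist)
    moreover have "(\<lambda>n. dist (X n) (Z n)) \<longlonglongrightarrow> 0" using XZ by (simp add: dist_norm)
    ultimately show ?thesis
      unfolding uniformly_continuous_on_sequentially by simp
  qed
  have "(\<lambda>n. 2 * err n + dist (w (Y n, t n)) (w (Y n, s n)) + dist (B (X n)) (B (Z n))) \<longlonglongrightarrow> 2 * 0 + 0 + 0"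
    by (intro tendsto_add tendsto_mult tendsto_const A dw dB)
  then have ql: "(\<lambda>n. 2 * err n + dist (w (Y n, t n)) (w (Y n, s n)) + dist (B (X n)) (B (Z n))) \<longlonglongrightarrow> 0"
    by simp
  have "l n \<le> 2 * err n + dist (w (Y n, t n)) (w (Y n, s n)) + dist (B (X n)) (B (Z n))" for n
  proof -
    have "0 \<le> real (Suc n) * p n" using p0 by (intro mult_nonneg_nonneg) auto
    then have "l n \<le> q n" using lp[of n] by linarith
    then show ?thesis unfolding q_def dist_real_def by linarith
  qed
  then have llim: "l \<longlonglongrightarrow> 0" by (rule squeeze[OF l0 _ ql])
  have "(\<lambda>n. (norm (X n - xh))\<^sup>2) \<longlonglongrightarrow> 0" "(\<lambda>n. (norm (Y n - yh))\<^sup>2) \<longlonglongrightarrow> 0" "(\<lambda>n. (t n - th)\<^sup>2) \<longlonglongrightarrow> 0"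
    by (rule squeeze[OF _ _ llim]; simp add: l_def)+
  then have "(\<lambda>n. norm (X n - xh)) \<longlonglongrightarrow> 0" "(\<lambda>n. norm (Y n - yh)) \<longlonglongrightarrow> 0" and t: "(\<lambda>n. t n - th) \<longlonglongrightarrow> 0"
    by (simp_all add: power_tendsto_0_iff)
  then show X: "X \<longlonglongrightarrow> xh" and "Y \<longlonglongrightarrow> yh" and tt: "t \<longlonglongrightarrow> th"
    by (simp_all add: LIM_zero_iff tendsto_norm_zero_iff)
  show "Z \<longlonglongrightarrow> xh"
    using tendsto_diff[OF X tendsto_norm_zero_cancel[OF XZ]] by simp
  show "s \<longlonglongrightarrow> th" using tendsto_diff[OF tt tsl] by simp
qed

text \<open>The comparison inequality at a maximum of \<open>u(x,t) - w(y,t) - B(x) - A0(x,y) - c t\<^sup>\<alpha>\<close> in which the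
  time variable is not doubled. Here \<open>B\<close> is only continuous and enters through its own test functions,
  and \<open>A0\<close> is only a uniform limit of \<open>C\<^sup>1\<close> functions; the number \<open>S\<close> stands for any asymptotic
  bound of the difference of the Hamiltonians near the maximum. At fixed truncation \<open>r\<close> the doubled
  inequalities pass to the limit. The integrand of the difference of the nonlocal terms is
  nonnegative at the maximum, so the truncated differences increase as \<open>r\<close> decreases, and being
  bounded they converge.\<close>

lemma nonlocal_comparison_at_maximum:
  fixes u w :: "'a::euclidean_space \<times> real \<Rightarrow> real"
  assumes \<alpha>: "\<alpha> \<in> {0<..<1}" and u: "BUC_on (UNIV \<times> {0..T}) u" and w: "BUC_on (UNIV \<times> {0..T}) w"
    and sub: "evol_visc_subsolution \<alpha> T F1 u0 u" and super: "evol_visc_supersolution \<alpha> T F2 w0 w"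
    and B: "continuous_on UNIV B" "bounded (range B)"
    and A: "\<And>n. C1_on UNIV (A n) (G n)" "\<And>n z. 0 \<le> A n z"
      "\<And>n z. \<bar>A n z - A0 z\<bar> \<le> err n" "err \<longlonglongrightarrow> 0"
    and c: "c \<ge> 0" and th: "th \<in> {0<..T}"
    and max: "\<And>x y s. s \<in> {0..T} \<Longrightarrow> u (x, s) - w (y, s) - B x - A0 (x, y) - c * s powr \<alpha>
        \<le> u (xh, th) - w (yh, th) - B xh - A0 (xh, yh) - c * th powr \<alpha>"
    and bound: "\<And>e. e > 0 \<Longrightarrow> \<exists>\<kappa>>0. \<forall>n x y z g a b.
        dist x xh < \<kappa> \<and> dist y yh < \<kappa> \<and> dist z xh < \<kappa> \<and> norm a < \<kappa> \<and> norm b < \<kappa> \<and>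
        (\<exists>\<eta> G\<eta>. C1_on UNIV \<eta> G\<eta> \<and> G\<eta> z = g \<and> (\<forall>z'. B z' - \<eta> z' \<ge> B z - \<eta> z)) \<longrightarrow>
        F2 y (b - snd (G n (x, y))) - F1 x (g + fst (G n (x, y)) + a) \<le> S + e"
  shows "\<exists>L. ((\<lambda>r. K \<alpha> r th u xh th - K \<alpha> r th w yh th) \<longlongrightarrow> L) (at_right 0) \<and>
     c / Gamma (1 - \<alpha>) \<le> J \<alpha> u xh th - J \<alpha> w yh th + L \<and>
     J \<alpha> u xh th - J \<alpha> w yh th + L \<le> S"
proof -
  define D where "D = (\<lambda>r. K \<alpha> r th u xh th - K \<alpha> r th w yh th)"
  define Jd where "Jd = J \<alpha> u xh th - J \<alpha> w yh th"
  define k where "k = (\<lambda>r. \<alpha> / Gamma (1 - \<alpha>) * (r powr (1 - \<alpha>) / (1 - \<alpha>)))"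
  have Gp: "Gamma (1 - \<alpha>) > 0" using \<alpha> by (simp add: Gamma_real_pos)
  have th0: "th \<in> {0..T}" using th by auto
  define P where "P = (\<lambda>n (x, y, z, t, s). t \<in> {0..T} \<and> s \<in> {0..T} \<and>
      (\<forall>x' y' z'. \<forall>t'\<in>{0..T}. \<forall>s'\<in>{0..T}.
       doubled \<alpha> c u w B (A n) xh yh th (real (Suc n)) x' y' z' t' s'
         \<le> doubled \<alpha> c u w B (A n) xh yh th (real (Suc n)) x y z t s))"
  have "\<forall>n. \<exists>p. P n p"
  proof
    fix n
    have "T \<ge> 0" "real (Suc n) \<ge> 1" using th by auto
    from doubled_attains_max[where xh = xh and yh = yh and th = th,
        OF \<alpha> u w B C1_on_imp_continuous_on[OF A(1)[of n]] A(2)[of n] c this(2,1)]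
    obtain x y z t s where "t \<in> {0..T}" "s \<in> {0..T}"
      "\<And>x' y' z' t' s'. t' \<in> {0..T} \<Longrightarrow> s' \<in> {0..T} \<Longrightarrow>
       doubled \<alpha> c u w B (A n) xh yh th (real (Suc n)) x' y' z' t' s'
         \<le> doubled \<alpha> c u w B (A n) xh yh th (real (Suc n)) x y z t s" by metis
    then have "P n (x, y, z, t, s)" by (simp add: P_def)
    then show "\<exists>p. P n p" by blast
  qed
  then obtain p where p: "\<And>n. P n (p n)" by metis
  define X where "X = (\<lambda>n. fst (p n))"
  define Y where "Y = (\<lambda>n. fst (snd (p n)))"
  define Z where "Z = (\<lambda>n. fst (snd (snd (p n))))"
  define t where "t = (\<lambda>n. fst (snd (snd (snd (p n)))))"
  define s where "s = (\<lambda>n. snd (snd (snd (snd (p n)))))"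
  have ts: "t n \<in> {0..T}" "s n \<in> {0..T}" for n
    using p[of n] by (auto simp: P_def t_def s_def split: prod.splits)
  have mx: "doubled \<alpha> c u w B (A n) xh yh th (real (Suc n)) x' y' z' t' s'
       \<le> doubled \<alpha> c u w B (A n) xh yh th (real (Suc n)) (X n) (Y n) (Z n) (t n) (s n)"
    if "t' \<in> {0..T}" "s' \<in> {0..T}" for n x' y' z' t' s'
    using p[of n] that unfolding P_def X_def Y_def Z_def t_def s_def case_prod_beta' by blast
  note lims = doubled_maximisers_converge[OF u w B A(3,4) th0 max ts mx[OF th0 th0]]
  have flip: "(- m) *\<^sub>R (2 *\<^sub>R (y - x)) = (2 * m) *\<^sub>R (x - y)" for m :: real and x y :: 'a
    by (simp add: algebra_simps)
  \<comment> \<open>The cut-off \<open>r\<close> stays fixed while the penalisation tends to infinity.\<close>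
  have upper: "Jd + D r \<le> S + 3 * T * k r" if r: "0 < r" "r < th" for r
  proof -
    have "Jd + D r \<le> (S + 3 * T * k r) + 1 * e" if e: "e > 0" for e
    proof -
      obtain \<kappa> where \<kappa>: "\<kappa> > 0" "\<And>n x y z g a b.
        dist x xh < \<kappa> \<Longrightarrow> dist y yh < \<kappa> \<Longrightarrow> dist z xh < \<kappa> \<Longrightarrow> norm a < \<kappa> \<Longrightarrow> norm b < \<kappa> \<Longrightarrow>
        (\<exists>\<eta> G\<eta>. C1_on UNIV \<eta> G\<eta> \<and> G\<eta> z = g \<and> (\<forall>z'. B z' - \<eta> z' \<ge> B z - \<eta> z)) \<Longrightarrow>
        F2 y (b - snd (G n (x, y))) - F1 x (g + fst (G n (x, y)) + a) \<le> S + e"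
        using bound[OF e] by metis
      have lim: "(\<lambda>n. J \<alpha> u (X n) (t n) - J \<alpha> w (Y n) (s n)
            + (K \<alpha> r (t n) u (X n) (t n) - K \<alpha> r (s n) w (Y n) (s n)) - 3 * T * k r)
          \<longlonglongrightarrow> Jd + D r - 3 * T * k r"
        unfolding Jd_def D_def
        by (intro tendsto_add tendsto_diff tendsto_const
            J_tendsto[OF \<alpha> u lims(1,4) ts(1) th] J_tendsto[OF \<alpha> w lims(2,5) ts(2) th]
            K_tendsto[OF \<alpha> u r(1) lims(1,4) ts(1) th0] K_tendsto[OF \<alpha> w r(1) lims(2,5) ts(2) th0])
      have "\<forall>\<^sub>F n in sequentially. dist (X n) xh < \<kappa> / 2" "\<forall>\<^sub>F n in sequentially. dist (Y n) yh < \<kappa> / 2"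
        "\<forall>\<^sub>F n in sequentially. dist (Z n) xh < \<kappa>" "\<forall>\<^sub>F n in sequentially. r < t n"
        "\<forall>\<^sub>F n in sequentially. r < s n"
        using \<kappa>(1) tendstoD[OF lims(1), of "\<kappa> / 2"] tendstoD[OF lims(2), of "\<kappa> / 2"]
          tendstoD[OF lims(3) \<kappa>(1)] order_tendstoD(1)[OF lims(4) r(2)] order_tendstoD(1)[OF lims(5) r(2)]
        by simp_all
      then have "\<forall>\<^sub>F n in sequentially. J \<alpha> u (X n) (t n) - J \<alpha> w (Y n) (s n)
            + (K \<alpha> r (t n) u (X n) (t n) - K \<alpha> r (s n) w (Y n) (s n)) - 3 * T * k r \<le> S + e"
      proof eventually_elim
        case (elim n)
        have tn: "t n \<in> {0<..T}" "s n \<in> {0<..T}" using ts[of n] elim r by auto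
        define g where "g = (2 * real (Suc n)) *\<^sub>R (X n - Z n)"
        define \<eta> where "\<eta> = (\<lambda>z'. (- real (Suc n)) * (norm (z' - X n))\<^sup>2)"
        define G\<eta> where "G\<eta> = (\<lambda>z'. (- real (Suc n)) *\<^sub>R (2 *\<^sub>R (z' - X n)))"
        have "C1_on UNIV \<eta> G\<eta>" unfolding \<eta>_def G\<eta>_def by (intro C1_on_cmult C1_on_sqnorm)
        moreover have "G\<eta> (Z n) = g"
          unfolding G\<eta>_def g_def by (rule flip)
        moreover have "B z' - \<eta> z' \<ge> B (Z n) - \<eta> (Z n)" for z'
          using mx[OF ts(1)[of n] ts(2)[of n], of n "X n" "Y n" z']
          by (simp add: doubled_def \<eta>_def norm_minus_commute[of "X n"] algebra_simps)
        ultimately have test: "\<exists>\<eta> G\<eta>. C1_on UNIV \<eta> G\<eta> \<and> G\<eta> (Z n) = g \<and>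
            (\<forall>z'. B z' - \<eta> z' \<ge> B (Z n) - \<eta> (Z n))" by blast
        have "F2 (Y n) (- (2 *\<^sub>R (Y n - yh)) - snd (G n (X n, Y n)))
            - F1 (X n) (g + fst (G n (X n, Y n)) + 2 *\<^sub>R (X n - xh)) \<le> S + e"
          by (rule \<kappa>(2)[OF _ _ _ _ _ test])
             (use elim \<kappa>(1) in \<open>auto simp: dist_norm\<close>)
        moreover have "J \<alpha> u (X n) (t n) - J \<alpha> w (Y n) (s n)
            + (K \<alpha> r (t n) u (X n) (t n) - K \<alpha> r (s n) w (Y n) (s n)) - 3 * T * k r
            \<le> F2 (Y n) (- snd (G n (X n, Y n)) - 2 *\<^sub>R (Y n - yh))
             - F1 (X n) (g + fst (G n (X n, Y n)) + 2 *\<^sub>R (X n - xh))"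
          unfolding k_def g_def
          by (rule doubled_viscosity_inequality[OF \<alpha> u w sub super A(1) c th0 tn mx r(1)])
             (use elim in auto)
        moreover have "- snd (G n (X n, Y n)) - 2 *\<^sub>R (Y n - yh) = - (2 *\<^sub>R (Y n - yh)) - snd (G n (X n, Y n))"
          by simp
        ultimately show ?case by simp
      qed
      from tendsto_upperbound[OF lim this] show ?thesis by simp
    qed
    then show ?thesis by (rule le_add_eps)
  qed
  \<comment> \<open>At the limit point the drift is absent: the maximality there makes the integrand nonnegative.\<close>
  have incr: "(u (xh, th) - u (xh, th - \<tau>)) - (w (yh, th) - w (yh, th - \<tau>)) \<ge> - (0 * \<tau>)"
    if "0 < \<tau>" "\<tau> < th" for \<tau>
  proof -
    have "c * (th - \<tau>) powr \<alpha> \<le> c * th powr \<alpha>"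
      using that c \<alpha> by (intro mult_left_mono powr_mono2) auto
    then show ?thesis using max[of "th - \<tau>" xh yh] that th by simp
  qed
  have iu: "set_integrable lborel {r<..<th} (K_integrand \<alpha> u xh th)"
    and iw: "set_integrable lborel {r<..<th} (K_integrand \<alpha> w yh th)" if "r > 0" for r
    using K_integrand_integrable_bounded[OF \<alpha> u _ that] K_integrand_integrable_bounded[OF \<alpha> w _ that] th by auto
  have D0: "D r \<ge> 0" if r: "0 < r" "r < th" for r
    using K_diff_lower_bound[OF \<alpha> _ _ iu[OF r(1)] iw[OF r(1)], of 0] incr r
    by (simp add: D_def)
  have anti: "D r' \<le> D r" if r: "0 < r" "r < r'" "r' < th" for r r'
  proof -
    have "K \<alpha> r r' u xh th - K \<alpha> r r' w yh th \<ge> - (0 * (\<alpha> / Gamma (1 - \<alpha>) * (r' powr (1 - \<alpha>) / (1 - \<alpha>))))"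
      using r incr
      by (intro K_diff_lower_bound[OF \<alpha>] set_integrable_subset[OF iu[OF r(1)]]
          set_integrable_subset[OF iw[OF r(1)]]) auto
    moreover have "K \<alpha> r th u xh th = K \<alpha> r r' u xh th + K \<alpha> r' th u xh th"
      by (rule K_split[OF _ _ _ iu]) (use r in auto)
    moreover have "K \<alpha> r th w yh th = K \<alpha> r r' w yh th + K \<alpha> r' th w yh th"
      by (rule K_split[OF _ _ _ iw]) (use r in auto)
    ultimately show ?thesis by (simp add: D_def)
  qed
  have bdd: "D r \<le> S + 3 * T * k th - Jd" if r: "0 < r" "r < th" for r
  proof -
    have "k r \<le> k th" unfolding k_def
      using r \<alpha> Gp by (intro mult_left_mono divide_right_mono powr_mono2) auto
    then have "3 * T * k r \<le> 3 * T * k th" using th by (intro mult_left_mono) auto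
    then show ?thesis using upper[OF r] by linarith
  qed
  have "0 < th" using th by simp
  from antimono_tendsto_at_right_0[where D = D, OF this anti bdd]
  obtain L where L: "(D \<longlongrightarrow> L) (at_right 0)" by blast
  have ev: "\<forall>\<^sub>F r in at_right 0. r \<in> {0<..<th}"
    using th by (intro eventually_at_right_real) auto
  have "L \<ge> 0"
    by (rule tendsto_lowerbound[OF L]) (use D0 in \<open>auto intro: eventually_mono[OF ev]\<close>)
  moreover have "Jd \<ge> c / Gamma (1 - \<alpha>)"
  proof -
    have "c * th powr \<alpha> \<le> (u (xh, th) - u (xh, 0)) - (w (yh, th) - w (yh, 0))"
      using max[of 0 xh yh] th \<alpha> by simp
    then have "c * th powr \<alpha> / (th powr \<alpha> * Gamma (1 - \<alpha>))
      \<le> ((u (xh, th) - u (xh, 0)) - (w (yh, th) - w (yh, 0))) / (th powr \<alpha> * Gamma (1 - \<alpha>))"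
      using Gp th by (intro divide_right_mono) auto
    then show ?thesis using th by (simp add: Jd_def J_def diff_divide_distrib)
  qed
  moreover have "Jd + L \<le> S"
  proof -
    have "((\<lambda>r. S + 3 * T * k r) \<longlongrightarrow> S + 3 * T * k 0) (at_right 0)"
      unfolding k_def using \<alpha>
      by (intro tendsto_add tendsto_mult tendsto_const tendsto_divide tendsto_powr2 tendsto_ident_at)
         (auto simp: eventually_at_filter)
    moreover have "((\<lambda>r. Jd + D r) \<longlongrightarrow> Jd + L) (at_right 0)"
      by (intro tendsto_add tendsto_const L)
    moreover have "\<forall>\<^sub>F r in at_right 0. Jd + D r \<le> S + 3 * T * k r"
      using ev by eventually_elim (use upper in auto)
    ultimately have "Jd + L \<le> S + 3 * T * k 0"
      by (intro tendsto_le[OF trivial_limit_at_right_real])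
    then show ?thesis using \<alpha> by (simp add: k_def)
  qed
  ultimately show ?thesis using L unfolding D_def Jd_def by (intro exI[of _ L]) linarith
qed

section \<open>A priori estimates for the evolution problems\<close>

lemma evol_visc_solution_initial: "evol_visc_solution \<alpha> T F u0 u \<Longrightarrow> u (x, 0) = u0 x"
  unfolding evol_visc_solution_def evol_visc_subsolution_def evol_visc_supersolution_def
  by (simp add: antisym)

lemma evol_subsolution_upper_bound:
  fixes u :: "'a::euclidean_space \<times> real \<Rightarrow> real"
  assumes \<alpha>: "\<alpha> \<in> {0<..<1}" and u: "BUC_on (UNIV \<times> {0..T}) u"
    and sub: "evol_visc_subsolution \<alpha> T F u0 u"
    and F: "\<And>x p. - C \<le> F x p" and C: "0 \<le> C" and u0: "\<And>x. u0 x \<le> M0" and t: "t \<in> {0..T}"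
  shows "u (x, t) \<le> M0 + (C + 1) * Gamma (1 - \<alpha>) * t powr \<alpha>"
proof -
  \<comment> \<open>With this factor the boundary term \<open>J\<close> of \<open>m t\<^sup>\<alpha>\<close> is exactly \<open>C + 1\<close>.\<close>
  define m where "m = (C + 1) * Gamma (1 - \<alpha>)"
  have Gp: "Gamma (1 - \<alpha>) > 0" using \<alpha> by (simp add: Gamma_real_pos)
  have m0: "m \<ge> 0" using Gp C by (simp add: m_def)
  obtain B where B: "0 \<le> B" "\<And>z. z \<in> UNIV \<times> {0..T} \<Longrightarrow> \<bar>u z\<bar> \<le> B"
    using BUC_on_boundE[OF u] by blast
  have "u (x, t) \<le> (M0 + m * t powr \<alpha>) + (norm x)\<^sup>2 * \<delta>" if \<delta>: "\<delta> > 0" for \<delta>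
  proof -
    define \<phi> where "\<phi> = (\<lambda>q::'a \<times> real. \<delta> * (norm (fst q - 0))\<^sup>2 + m * snd q powr \<alpha>)"
    define G where "G = (\<lambda>q::'a \<times> real. (\<delta> *\<^sub>R (2 *\<^sub>R (fst q - 0)), 0::real) + (0, m *\<^sub>R (\<alpha> * snd q powr (\<alpha> - 1))))"
    have c\<phi>: "continuous_on (UNIV \<times> {0..T}) \<phi>"
    proof -
      have "continuous_on (UNIV \<times> {0..T}) (\<lambda>q::'a \<times> real. snd q powr \<alpha>)"
        using \<alpha> by (intro continuous_on_powr' continuous_intros) auto
      then show ?thesis unfolding \<phi>_def
        by (intro continuous_on_arith)
    qed
    have test: "evol_test_function T \<phi> G"
      unfolding evol_test_function_def
      using c\<phi> unfolding \<phi>_def G_def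
      by (intro conjI C1_on_add[OF C1_on_fst C1_on_snd] C1_on_cmult C1_on_sqnorm C1_on_powr)
    define p0 where "p0 = (0::'a, t)"
    have p0: "p0 \<in> UNIV \<times> {0..T}" using t by (simp add: p0_def)
    have bd: "bounded {q \<in> UNIV \<times> {0..T}. u q - \<phi> q \<ge> u p0 - \<phi> p0}"
    proof -
      define M where "M = (B - (u p0 - \<phi> p0)) / \<delta>"
      have "{q \<in> UNIV \<times> {0..T}. u q - \<phi> q \<ge> u p0 - \<phi> p0} \<subseteq> cball 0 (1 + M) \<times> {0..T}"
      proof
        fix q assume q: "q \<in> {q \<in> UNIV \<times> {0..T}. u q - \<phi> q \<ge> u p0 - \<phi> p0}"
        have "0 \<le> m * snd q powr \<alpha>" using m0 by simp
        then have "\<delta> * (norm (fst q))\<^sup>2 \<le> B - (u p0 - \<phi> p0)"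
          using q B(2)[of q] by (auto simp: \<phi>_def)
        then have "(norm (fst q))\<^sup>2 \<le> M" using \<delta> by (simp add: M_def field_simps)
        from le_one_plus_of_square_le[OF this] show "q \<in> cball 0 (1 + M) \<times> {0..T}"
          using q by (auto simp: mem_Times_iff)
      qed
      then show ?thesis
        by (rule bounded_subset[rotated]) (intro bounded_Times bounded_cball bounded_closed_interval)
    qed
    have "closed ((UNIV :: 'a set) \<times> {0..T})" by (intro closed_Times) auto
    from continuous_attains_sup_coercive[OF this continuous_on_diff[OF BUC_on_imp_continuous_on[OF u] c\<phi>] p0 bd]
    obtain q where q: "q \<in> UNIV \<times> {0..T}" "\<And>z. z \<in> UNIV \<times> {0..T} \<Longrightarrow> u z - \<phi> z \<le> u q - \<phi> q"
      by metis
    obtain xh th where xt: "q = (xh, th)" by fastforce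
    have th0: "th = 0"
    proof (rule ccontr)
      assume "th \<noteq> 0"
      then have th: "th \<in> {0<..T}" using q(1) by (auto simp: xt)
      have "J \<alpha> \<phi> xh th + K \<alpha> 0 th \<phi> xh th + F xh (fst (G (xh, th))) \<le> 0"
        using sub test th q(2) unfolding evol_visc_subsolution_def xt by blast
      moreover have "J \<alpha> \<phi> xh th = C + 1"
      proof -
        have "Gamma (1 - \<alpha>) \<noteq> 0" using Gp by linarith
        then show ?thesis using th \<alpha> unfolding J_def \<phi>_def m_def by simp
      qed
      moreover have "K \<alpha> 0 th \<phi> xh th \<ge> 0"
      proof -
        obtain C' where i: "set_integrable lborel {0<..<th} (K_integrand \<alpha> \<phi> xh th)"
          using K_integrand_integrable_test_function[OF \<alpha> test th] by blast
        have "K \<alpha> 0 th \<phi> xh th - K \<alpha> 0 th (\<lambda>_. 0) xh th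
            \<ge> - (0 * (\<alpha> / Gamma (1 - \<alpha>) * (th powr (1 - \<alpha>) / (1 - \<alpha>))))"
        proof (rule K_diff_lower_bound[OF \<alpha> _ _ i])
          fix \<tau> assume "\<tau> \<in> {0<..<th}"
          then have "m * (th - \<tau>) powr \<alpha> \<le> m * th powr \<alpha>"
            using m0 \<alpha> by (intro mult_left_mono powr_mono2) auto
          then show "- (0 * \<tau>) \<le> \<phi> (xh, th) - \<phi> (xh, th - \<tau>) - (0 - 0)" by (simp add: \<phi>_def)
        qed (use th in \<open>auto simp: set_integrable_def\<close>)
        then show ?thesis by (simp add: K_const)
      qed
      ultimately show False using F[of xh "fst (G (xh, th))"] by linarith
    qed
    have "u (xh, 0) \<le> M0"
      using sub u0[of xh] unfolding evol_visc_subsolution_def by (meson order_trans)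
    moreover have "u (x, t) - \<phi> (x, t) \<le> u (xh, 0) - \<phi> (xh, 0)"
      using q(2)[of "(x, t)"] t by (simp add: xt th0)
    moreover have "\<phi> (xh, 0) \<ge> 0" using \<delta> by (simp add: \<phi>_def)
    ultimately show ?thesis by (simp add: \<phi>_def mult.commute)
  qed
  then show ?thesis unfolding m_def by (rule le_add_eps)
qed

text \<open>For a Hamiltonian that does not depend on \<open>x\<close> the penalisation \<open>L |x - y|\<close> produces the same gradient
  in both equations, so a positive maximum of \<open>u(x,t) - u(y,t) - L |x - y|\<close> can only occur at the
  initial time.\<close>

lemma evol_solution_lipschitz:
  fixes u :: "'a::euclidean_space \<times> real \<Rightarrow> real"
  assumes \<alpha>: "\<alpha> \<in> {0<..<1}" and u: "BUC_on (UNIV \<times> {0..T}) u"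
    and sol: "evol_visc_solution \<alpha> T (\<lambda>x p. F p) u0 u"
    and F: "\<And>p q. \<bar>F p - F q\<bar> \<le> C * norm (p - q)"
    and u0: "L-lipschitz_on UNIV u0" and t: "t \<in> {0..T}"
  shows "u (x, t) - u (y, t) \<le> L * norm (x - y)"
proof -
  have L0: "L \<ge> 0" by (rule lipschitz_on_nonneg[OF u0])
  have C0: "C \<ge> 0"
  proof -
    obtain p :: 'a where "norm p = 1" using vector_choose_size zero_le_one by blast
    then show ?thesis using F[of p 0] by auto
  qed
  have sub: "evol_visc_subsolution \<alpha> T (\<lambda>x p. F p) u0 u" and super: "evol_visc_supersolution \<alpha> T (\<lambda>x p. F p) u0 u"
    using sol by (auto simp: evol_visc_solution_def)
  have init: "u (x, 0) = u0 x" for x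
    by (rule evol_visc_solution_initial[OF sol])
  have Gp: "Gamma (1 - \<alpha>) > 0" using \<alpha> by (simp add: Gamma_real_pos)
  obtain Bu where Bu: "0 \<le> Bu" "\<And>z. z \<in> UNIV \<times> {0..T} \<Longrightarrow> \<bar>u z\<bar> \<le> Bu"
    using BUC_on_boundE[OF u] by blast
  have "u (x, t) - u (y, t) \<le> L * norm (x - y) + (L + ((norm x)\<^sup>2 + (norm y)\<^sup>2) + t powr \<alpha>) * e"
    if e: "e > 0" for e
  proof -
    define M where "M = 2 * Bu + L * e"
    have M0: "M \<ge> 0" using Bu L0 e by (simp add: M_def)
    \<comment> \<open>Chosen so that the error \<open>4 C \<rho>\<close> due to the localisation stays below the strict gain
       \<open>e / \<Gamma>(1 - \<alpha>)\<close> from the term \<open>e t\<^sup>\<alpha>\<close>; the size of \<open>\<delta>\<close> then makes \<open>\<delta> |x|\<close> and \<open>\<delta> |y|\<close> at most \<open>\<rho>\<close>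
       at every maximum point.\<close>
    define \<rho> where "\<rho> = e / (Gamma (1 - \<alpha>) * (4 * C + 1))"
    have \<rho>: "\<rho> > 0" using e Gp C0 by (simp add: \<rho>_def)
    define \<delta> where "\<delta> = min e (\<rho>\<^sup>2 / (M + 1))"
    have \<delta>: "\<delta> > 0" using e \<rho> M0 by (simp add: \<delta>_def)
    have "\<delta> * (M + 1) \<le> \<rho>\<^sup>2"
      using M0 mult_right_mono[of \<delta> "\<rho>\<^sup>2 / (M + 1)" "M + 1"] by (simp add: \<delta>_def)
    then have \<delta>M: "\<delta> * M \<le> \<rho>\<^sup>2" using \<delta> by (simp add: distrib_left)
    define N where "N = (\<lambda>v::'a. sqrt ((norm (v - 0))\<^sup>2 + e\<^sup>2))"
    define GN where "GN = (\<lambda>v::'a. (v - 0) /\<^sub>R sqrt ((norm (v - 0))\<^sup>2 + e\<^sup>2))"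
    define A where "A = (\<lambda>z::'a \<times> 'a. L * N (fst z - snd z) + (\<delta> * (norm (fst z - 0))\<^sup>2 + \<delta> * (norm (snd z - 0))\<^sup>2))"
    define G where "G = (\<lambda>z::'a \<times> 'a. L *\<^sub>R (GN (fst z - snd z), - GN (fst z - snd z))
        + (\<delta> *\<^sub>R (2 *\<^sub>R (fst z - 0), 0) + \<delta> *\<^sub>R (0, 2 *\<^sub>R (snd z - 0))))"
    have "C1_on UNIV N GN" unfolding N_def GN_def by (rule C1_on_smooth_norm[OF e])
    then have CA: "C1_on UNIV A G"
      unfolding A_def G_def
      by (intro C1_on_add C1_on_cmult C1_on_diff_variables C1_on_UNIV_fst[OF C1_on_sqnorm]
          C1_on_UNIV_snd[OF C1_on_sqnorm])
    have N: "norm v \<le> N v" "N v \<le> norm v + e" for v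
      using smooth_norm_bounds[of e v] e by (simp_all add: N_def)
    have N0: "0 \<le> N v" for v using N(1)[of v] norm_ge_zero order_trans by blast
    have A0: "A z \<ge> 0" for z using L0 \<delta> N0 by (simp add: A_def)
    define f where "f = (\<lambda>(x, y, t). u (x, t) - u (y, t) - A (x, y) - e * t powr \<alpha>)"
    define S where "S = (UNIV :: 'a set) \<times> (UNIV :: 'a set) \<times> {0..T}"
    define p0 where "p0 = (0::'a, 0::'a, 0::real)"
    have cl: "closed S" unfolding S_def by (intro closed_Times) auto
    have cf: "continuous_on S f"
    proof -
      have "continuous_on S (\<lambda>p. u (fst p, snd (snd p)))"
        by (rule continuous_on_compose2[OF BUC_on_imp_continuous_on[OF u]])
           (auto simp: S_def intro!: continuous_intros)
      moreover have "continuous_on S (\<lambda>p. u (fst (snd p), snd (snd p)))"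
        by (rule continuous_on_compose2[OF BUC_on_imp_continuous_on[OF u]])
           (auto simp: S_def intro!: continuous_intros)
      moreover have "continuous_on S (\<lambda>p. A (fst p, fst (snd p)))"
        by (rule continuous_on_compose2[OF C1_on_imp_continuous_on[OF CA]]) (auto intro!: continuous_intros)
      moreover have "continuous_on S (\<lambda>p. snd (snd p) powr \<alpha>)"
        using \<alpha> by (intro continuous_on_powr' continuous_intros) (auto simp: S_def)
      ultimately show ?thesis
        unfolding f_def case_prod_beta'
        by (intro continuous_on_diff continuous_on_mult continuous_on_const)
    qed
    have sq: "\<delta> * (norm a)\<^sup>2 \<le> M" "\<delta> * (norm b)\<^sup>2 \<le> M"
      if "s \<in> {0..T}" "f (a, b, s) \<ge> f p0" for a b s
    proof -
      have "0 \<le> e * s powr \<alpha>" "0 \<le> \<delta> * (norm a)\<^sup>2" "0 \<le> \<delta> * (norm b)\<^sup>2" "0 \<le> L * N (a - b)"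
        using e \<delta> L0 N0 by auto
      moreover have "L * N 0 \<le> L * e" using L0 N(2)[of 0] by (intro mult_left_mono) auto
      ultimately show "\<delta> * (norm a)\<^sup>2 \<le> M" "\<delta> * (norm b)\<^sup>2 \<le> M"
        using that Bu(2)[of "(a, s)"] Bu(2)[of "(b, s)"] \<alpha>
        by (auto simp: f_def p0_def A_def M_def)
    qed
    have p0S: "p0 \<in> S" using t by (simp add: p0_def S_def)
    have bd: "bounded {p \<in> S. f p \<ge> f p0}"
    proof -
      have "{p \<in> S. f p \<ge> f p0} \<subseteq> cball 0 (1 + M / \<delta>) \<times> cball 0 (1 + M / \<delta>) \<times> {0..T}"
      proof
        fix p assume p: "p \<in> {p \<in> S. f p \<ge> f p0}"
        obtain a b s where abs: "p = (a, b, s)" by (metis prod.exhaust)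
        have s: "s \<in> {0..T}" using p by (simp add: abs S_def)
        from sq[OF s, of a b] p have "(norm a)\<^sup>2 \<le> M / \<delta>" "(norm b)\<^sup>2 \<le> M / \<delta>"
          using \<delta> by (auto simp: abs field_simps)
        from this[THEN le_one_plus_of_square_le]
        show "p \<in> cball 0 (1 + M / \<delta>) \<times> cball 0 (1 + M / \<delta>) \<times> {0..T}"
          using s by (simp add: abs)
      qed
      then show ?thesis
        by (rule bounded_subset[rotated]) (intro bounded_Times bounded_cball bounded_closed_interval)
    qed
    obtain p where p: "p \<in> S" "\<And>q. q \<in> S \<Longrightarrow> f q \<le> f p"
      using continuous_attains_sup_coercive[OF cl cf p0S bd] by metis
    obtain xh yh th where xyt: "p = (xh, yh, th)" by (metis prod.exhaust)
    have th: "th \<in> {0..T}" using p(1) by (simp add: xyt S_def)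
    have mx: "f (x', y', s) \<le> f (xh, yh, th)" if "s \<in> {0..T}" for x' y' s
      using p(2)[of "(x', y', s)"] that by (simp add: xyt S_def)
    have "th = 0"
    proof (rule ccontr)
      assume "th \<noteq> 0"
      then have th': "th \<in> {0<..T}" using th by auto
      have "f (xh, yh, th) \<ge> f p0" using p(2)[OF p0S] by (simp add: xyt)
      note sqh = sq[OF th this]
      have small: "\<delta> * norm xh \<le> \<rho>" "\<delta> * norm yh \<le> \<rho>"
        using scaled_norm_le_of_square[OF sqh(1) \<delta>M] scaled_norm_le_of_square[OF sqh(2) \<delta>M] \<delta> \<rho> by auto
      have bound: "\<exists>\<kappa>>0. \<forall>n x y z g a b.
        dist x xh < \<kappa> \<and> dist y yh < \<kappa> \<and> dist z xh < \<kappa> \<and> norm a < \<kappa> \<and> norm b < \<kappa> \<and>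
        (\<exists>\<eta> G\<eta>. C1_on UNIV \<eta> G\<eta> \<and> G\<eta> z = g \<and> (\<forall>z'. 0 - \<eta> z' \<ge> 0 - \<eta> z)) \<longrightarrow>
        F (b - snd (G (x, y))) - F (g + fst (G (x, y)) + a) \<le> C * (4 * \<rho>) + e'"
        if e': "e' > 0" for e' :: real
      proof -
        define \<kappa> where "\<kappa> = e' / ((C + 1) * (4 * \<delta> + 2))"
        have \<kappa>: "\<kappa> > 0" "(C + 1) * ((4 * \<delta> + 2) * \<kappa>) = e'" using e' C0 \<delta> by (simp_all add: \<kappa>_def)
        show ?thesis
        proof (intro exI[of _ \<kappa>] conjI allI impI)
          show "\<kappa> > 0" by (rule \<kappa>)
        fix n :: nat and x y z g a b :: 'a
        assume h: "dist x xh < \<kappa> \<and> dist y yh < \<kappa> \<and> dist z xh < \<kappa> \<and> norm a < \<kappa> \<and> norm b < \<kappa> \<and>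
          (\<exists>\<eta> G\<eta>. C1_on UNIV \<eta> G\<eta> \<and> G\<eta> z = g \<and> (\<forall>z'. 0 - \<eta> z' \<ge> 0 - \<eta> z))"
        then have g: "g = 0" using gradient_eq_0_at_maximum by force
        have nx: "norm x \<le> norm xh + \<kappa>" "norm y \<le> norm yh + \<kappa>"
          using h norm_triangle_sub[of x xh] norm_triangle_sub[of y yh] by (auto simp: dist_norm)
        have eq: "(b - snd (G (x, y))) - (g + fst (G (x, y)) + a) = b - a - \<delta> *\<^sub>R (2 *\<^sub>R x) - \<delta> *\<^sub>R (2 *\<^sub>R y)"
          by (simp add: G_def g)
        have "norm (b - a - \<delta> *\<^sub>R (2 *\<^sub>R x) - \<delta> *\<^sub>R (2 *\<^sub>R y))
            \<le> norm b + norm a + norm (\<delta> *\<^sub>R (2 *\<^sub>R x)) + norm (\<delta> *\<^sub>R (2 *\<^sub>R y))"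
          by (intro order_trans[OF norm_triangle_ineq4] add_right_mono norm_triangle_ineq4)
        moreover have "norm (\<delta> *\<^sub>R (2 *\<^sub>R x)) \<le> 2 * (\<rho> + \<delta> * \<kappa>)" "norm (\<delta> *\<^sub>R (2 *\<^sub>R y)) \<le> 2 * (\<rho> + \<delta> * \<kappa>)"
          using mult_left_mono[OF nx(1), of \<delta>] mult_left_mono[OF nx(2), of \<delta>] small \<delta>
          by (auto simp: distrib_left)
        moreover have "(4 * \<delta> + 2) * \<kappa> = 2 * (\<delta> * \<kappa>) + 2 * (\<delta> * \<kappa>) + \<kappa> + \<kappa>" by (simp add: algebra_simps)
        moreover have "norm a < \<kappa>" "norm b < \<kappa>" using h by auto
        ultimately have "norm ((b - snd (G (x, y))) - (g + fst (G (x, y)) + a)) \<le> 4 * \<rho> + (4 * \<delta> + 2) * \<kappa>"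
          unfolding eq distrib_left by linarith
        then have "C * norm ((b - snd (G (x, y))) - (g + fst (G (x, y)) + a)) \<le> C * (4 * \<rho> + (4 * \<delta> + 2) * \<kappa>)"
          using C0 by (rule mult_left_mono)
        also have "\<dots> = C * (4 * \<rho>) + C * ((4 * \<delta> + 2) * \<kappa>)" by (simp add: distrib_left)
        also have "C * ((4 * \<delta> + 2) * \<kappa>) \<le> (C + 1) * ((4 * \<delta> + 2) * \<kappa>)"
          using \<kappa> \<delta> by (intro mult_right_mono) auto
        also have "(C + 1) * ((4 * \<delta> + 2) * \<kappa>) = e'" by (rule \<kappa>)
        finally show "F (b - snd (G (x, y))) - F (g + fst (G (x, y)) + a) \<le> C * (4 * \<rho>) + e'"
          using F[of "b - snd (G (x, y))" "g + fst (G (x, y)) + a"] by linarith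
        qed
      qed
      have "e / Gamma (1 - \<alpha>) \<le> C * (4 * \<rho>)"
        using nonlocal_comparison_at_maximum[where B = "\<lambda>_. 0" and A = "\<lambda>_. A" and G = "\<lambda>_. G" and ?A0.0 = A
            and err = "\<lambda>_. 0" and c = e and xh = xh and yh = yh and S = "C * (4 * \<rho>)",
            OF \<alpha> u u sub super _ _ CA A0 _ _ _ th' _ bound] mx e
        by (auto simp: f_def)
      moreover have "e / Gamma (1 - \<alpha>) = (4 * C + 1) * \<rho>" using Gp C0 by (simp add: \<rho>_def)
      ultimately show False using \<rho> by (simp add: algebra_simps)
    qed
    then have "f (x, y, t) \<le> f (xh, yh, 0)" using mx[OF t] by simp
    also have "f (xh, yh, 0) \<le> 0"
    proof -
      have "u0 xh - u0 yh \<le> L * norm (xh - yh)"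
        using lipschitz_onD[OF u0, of xh yh] by (simp add: dist_norm dist_real_def)
      also have "\<dots> \<le> L * N (xh - yh)" using L0 N(1) by (rule mult_left_mono[rotated])
      also have "\<dots> \<le> A (xh, yh)" using \<delta> by (simp add: A_def)
      finally show ?thesis using \<alpha> by (simp add: f_def init)
    qed
    finally have "u (x, t) - u (y, t) \<le> L * N (x - y) + (\<delta> * (norm x)\<^sup>2 + \<delta> * (norm y)\<^sup>2) + e * t powr \<alpha>"
      by (simp add: f_def A_def)
    also have "\<dots> \<le> L * (norm (x - y) + e) + (e * (norm x)\<^sup>2 + e * (norm y)\<^sup>2) + e * t powr \<alpha>"
      using N(2)[of "x - y"] L0 by (intro add_mono mult_left_mono mult_right_mono) (auto simp: \<delta>_def)
    finally show ?thesis by (simp add: algebra_simps)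
  qed
  then show ?thesis by (rule le_add_eps)
qed

section \<open>The discounted and the cell problem\<close>

text \<open>Two different equations are compared; \<open>m\<close> measures their distance. For
  \<open>F1 = F2\<close> and \<open>m = 0\<close> this is the comparison principle, and in general it gives
  the dependence of solutions on a parameter in the Hamiltonian. Lipschitz continuity of the Hamiltonian in all variables replaces any regularity of \<open>v1\<close> and \<open>v2\<close>.\<close>

lemma stationary_comparison:
  fixes v1 v2 :: "'a::euclidean_space \<Rightarrow> real"
  assumes v1: "continuous_on UNIV v1" "bounded (range v1)" and v2: "continuous_on UNIV v2" "bounded (range v2)"
    and \<mu>: "\<mu> > 0"
    and sub: "\<And>\<eta> G y. C1_on UNIV \<eta> G \<Longrightarrow> (\<And>z. v1 z - \<eta> z \<le> v1 y - \<eta> y) \<Longrightarrow> \<mu> * v1 y + F1 y (G y) \<le> 0"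
    and super: "\<And>\<eta> G y. C1_on UNIV \<eta> G \<Longrightarrow> (\<And>z. v2 z - \<eta> z \<ge> v2 y - \<eta> y) \<Longrightarrow> \<mu> * v2 y + F2 y (G y) \<ge> 0"
    and F: "\<And>x y p q. F2 y q - F1 x p \<le> m + C * (norm (x - y) + norm (p - q))" and C: "C \<ge> 0"
  shows "\<mu> * (v1 x - v2 x) \<le> m"
proof -
  obtain B1 where B1: "\<And>z. \<bar>v1 z\<bar> \<le> B1"
    using v1(2) unfolding bounded_iff real_norm_def by blast
  obtain B2 where B2: "\<And>z. \<bar>v2 z\<bar> \<le> B2"
    using v2(2) unfolding bounded_iff real_norm_def by blast
  define M where "M = 2 * B1 + 2 * B2"
  have M0: "M \<ge> 0" using B1[of 0] B2[of 0] by (simp add: M_def)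
  have "\<mu> * (v1 x - v2 x) \<le> m + (3 * C + \<mu> * (norm x)\<^sup>2) * e" if e: "e > 0" for e
  proof -
    \<comment> \<open>These choices give \<open>|x - y| \<le> e\<close> and \<open>\<delta> |x| \<le> e\<close> at the maximum, because both penalty terms
       are at most \<open>M\<close> there.\<close>
    define n where "n = (M + 1) / e\<^sup>2"
    have n: "n > 0" using e M0 by (simp add: n_def)
    define \<delta> where "\<delta> = min e (e\<^sup>2 / (M + 1))"
    have \<delta>: "\<delta> > 0" using e M0 by (simp add: \<delta>_def)
    have "\<delta> * (M + 1) \<le> e\<^sup>2"
      using M0 mult_right_mono[of \<delta> "e\<^sup>2 / (M + 1)" "M + 1"] by (simp add: \<delta>_def)
    then have \<delta>M: "\<delta> * M \<le> e\<^sup>2" using \<delta> by (simp add: distrib_left)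
    define f where "f = (\<lambda>(x, y). v1 x - v2 y - (n * (norm (x - y))\<^sup>2 + \<delta> * (norm (x - 0))\<^sup>2))"
    have cf: "continuous_on UNIV f"
    proof -
      have "continuous_on UNIV (\<lambda>p::'a \<times> 'a. v1 (fst p))"
        by (rule continuous_on_compose2[OF v1(1)]) (auto intro!: continuous_intros)
      moreover have "continuous_on UNIV (\<lambda>p::'a \<times> 'a. v2 (snd p))"
        by (rule continuous_on_compose2[OF v2(1)]) (auto intro!: continuous_intros)
      ultimately show ?thesis unfolding f_def case_prod_beta'
        by (intro continuous_on_arith)
    qed
    have sq: "n * (norm (a - b))\<^sup>2 \<le> M" "\<delta> * (norm a)\<^sup>2 \<le> M" if "f (a, b) \<ge> f (0, 0)" for a b
    proof -
      have "0 \<le> n * (norm (a - b))\<^sup>2" "0 \<le> \<delta> * (norm a)\<^sup>2" using n \<delta> by auto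
      then show "n * (norm (a - b))\<^sup>2 \<le> M" "\<delta> * (norm a)\<^sup>2 \<le> M"
        using that B1[of a] B1[of 0] B2[of b] B2[of 0] by (auto simp: f_def M_def)
    qed
    have bd: "bounded {p \<in> UNIV. f p \<ge> f (0, 0)}"
    proof -
      define R1 where "R1 = 1 + M / \<delta>"
      define R2 where "R2 = 1 + M / n"
      have "{p \<in> UNIV. f p \<ge> f (0, 0)} \<subseteq> cball 0 R1 \<times> cball 0 (R1 + R2)"
      proof
        fix p assume p: "p \<in> {p \<in> UNIV. f p \<ge> f (0, 0)}"
        obtain a b where ab: "p = (a, b)" by fastforce
        have "(norm a)\<^sup>2 \<le> M / \<delta>" "(norm (a - b))\<^sup>2 \<le> M / n"
          using sq[of a b] p n \<delta> by (auto simp: ab field_simps)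
        from this[THEN le_one_plus_of_square_le] have "norm a \<le> R1" "norm (a - b) \<le> R2"
          by (simp_all add: R1_def R2_def)
        moreover have "norm b \<le> norm a + norm (a - b)"
          using norm_triangle_ineq4[of a "a - b"] by simp
        ultimately show "p \<in> cball 0 R1 \<times> cball 0 (R1 + R2)" by (simp add: ab)
      qed
      then show ?thesis by (rule bounded_subset[rotated]) (intro bounded_Times bounded_cball)
    qed
    obtain p where p: "\<And>q. f q \<le> f p"
      using continuous_attains_sup_coercive[OF closed_UNIV cf UNIV_I bd] by (metis UNIV_I)
    obtain xh yh where xy: "p = (xh, yh)" by fastforce
    note mx = p[unfolded xy]
    note sqh = sq[OF mx]
    define q where "q = n *\<^sub>R (2 *\<^sub>R (xh - yh))"
    have s1: "\<mu> * v1 xh + F1 xh (n *\<^sub>R (2 *\<^sub>R (xh - yh)) + \<delta> *\<^sub>R (2 *\<^sub>R (xh - 0))) \<le> 0"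
    proof (rule sub)
      show "C1_on UNIV (\<lambda>x. n * (norm (x - yh))\<^sup>2 + \<delta> * (norm (x - 0))\<^sup>2)
          (\<lambda>x. n *\<^sub>R (2 *\<^sub>R (x - yh)) + \<delta> *\<^sub>R (2 *\<^sub>R (x - 0)))"
        by (intro C1_on_add C1_on_cmult C1_on_sqnorm)
      show "v1 z - (n * (norm (z - yh))\<^sup>2 + \<delta> * (norm (z - 0))\<^sup>2)
          \<le> v1 xh - (n * (norm (xh - yh))\<^sup>2 + \<delta> * (norm (xh - 0))\<^sup>2)" for z
        using mx[of "(z, yh)"] by (simp add: f_def)
    qed
    have s2: "\<mu> * v2 yh + F2 yh ((- n) *\<^sub>R (2 *\<^sub>R (yh - xh))) \<ge> 0"
    proof (rule super)
      show "C1_on UNIV (\<lambda>y. (- n) * (norm (y - xh))\<^sup>2) (\<lambda>y. (- n) *\<^sub>R (2 *\<^sub>R (y - xh)))"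
        by (intro C1_on_cmult C1_on_sqnorm)
      show "v2 z - (- n) * (norm (z - xh))\<^sup>2 \<ge> v2 yh - (- n) * (norm (yh - xh))\<^sup>2" for z
        using mx[of "(xh, z)"] by (simp add: f_def norm_minus_commute[of xh])
    qed
    have fl: "(- n) *\<^sub>R (2 *\<^sub>R (yh - xh)) = q" by (simp add: q_def algebra_simps)
    have "\<mu> * (v1 xh - v2 yh) \<le> F2 yh q - F1 xh (q + \<delta> *\<^sub>R (2 *\<^sub>R xh))"
      using s1 s2 unfolding fl by (simp add: q_def right_diff_distrib)
    also have "\<dots> \<le> m + C * (norm (xh - yh) + norm ((q + \<delta> *\<^sub>R (2 *\<^sub>R xh)) - q))" by (rule F)
    also have "norm ((q + \<delta> *\<^sub>R (2 *\<^sub>R xh)) - q) = 2 * (\<delta> * norm xh)" using \<delta> by simp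
    also have "m + C * (norm (xh - yh) + 2 * (\<delta> * norm xh)) \<le> m + C * (e + 2 * e)"
    proof -
      have "\<delta> * norm xh \<le> e" using scaled_norm_le_of_square[OF sqh(2) \<delta>M] \<delta> e by simp
      moreover have "norm (xh - yh) \<le> e"
      proof (rule power2_le_imp_le)
        have "(norm (xh - yh))\<^sup>2 \<le> M / n" using sqh(1) n by (simp add: field_simps)
        also have "\<dots> \<le> e\<^sup>2"
          using e M0 by (simp add: n_def divide_simps)
        finally show "(norm (xh - yh))\<^sup>2 \<le> e\<^sup>2" .
      qed (use e in simp)
      ultimately show ?thesis using C by (intro add_left_mono mult_left_mono) auto
    qed
    finally have 1: "\<mu> * (v1 xh - v2 yh) \<le> m + C * (e + 2 * e)" .
    have "v1 x - v2 x - \<delta> * (norm x)\<^sup>2 \<le> v1 xh - v2 yh"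
    proof -
      have "0 \<le> n * (norm (xh - yh))\<^sup>2 + \<delta> * (norm xh)\<^sup>2" using n \<delta> by simp
      then show ?thesis using mx[of "(x, x)"] by (simp add: f_def)
    qed
    moreover have "\<delta> * (norm x)\<^sup>2 \<le> e * (norm x)\<^sup>2" by (intro mult_right_mono) (auto simp: \<delta>_def)
    ultimately have "v1 x - v2 x \<le> (v1 xh - v2 yh) + e * (norm x)\<^sup>2" by linarith
    then have "\<mu> * (v1 x - v2 x) \<le> \<mu> * ((v1 xh - v2 yh) + e * (norm x)\<^sup>2)"
      using \<mu> by (intro mult_left_mono) auto
    with 1 show ?thesis by (simp add: algebra_simps)
  qed
  then show ?thesis by (rule le_add_eps)
qed

text \<open>A cone with vertex \<open>x\<close> and slope larger than \<open>Kb\<close> can touch \<open>v\<close> from above only at its vertex. The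
  cone is smoothed at its vertex, which costs the factor \<open>2\<close>.\<close>

lemma lipschitz_of_gradient_bound:
  fixes v :: "'a::euclidean_space \<Rightarrow> real"
  assumes v: "continuous_on UNIV v" "bounded (range v)" and Kb: "Kb \<ge> 0"
    and grad: "\<And>\<eta> G y. C1_on UNIV \<eta> G \<Longrightarrow> (\<And>z. v z - \<eta> z \<le> v y - \<eta> y) \<Longrightarrow> norm (G y) \<le> Kb"
  shows "v y - v x \<le> 2 * (Kb + 1) * norm (y - x)"
proof -
  obtain B where B: "\<And>z. \<bar>v z\<bar> \<le> B"
    using v(2) unfolding bounded_iff real_norm_def by blast
  define K' where "K' = 2 * (Kb + 1)"
  have K': "K' > 0" using Kb by (simp add: K'_def)
  have "v y - v x \<le> K' * norm (y - x) + (1 + K') * e" if e: "e > 0" for e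
  proof -
    obtain d where d: "d > 0" "\<And>z. dist z x < d \<Longrightarrow> dist (v z) (v x) < e"
      using v(1) e unfolding continuous_on_iff by (metis UNIV_I)
    define k where "k = min d e"
    have k: "k > 0" using d e by (simp add: k_def)
    define N where "N = (\<lambda>z. sqrt ((norm (z - x))\<^sup>2 + k\<^sup>2))"
    define GN where "GN = (\<lambda>z. (z - x) /\<^sub>R sqrt ((norm (z - x))\<^sup>2 + k\<^sup>2))"
    have CN: "C1_on UNIV N GN" unfolding N_def GN_def by (rule C1_on_smooth_norm[OF k])
    have N: "norm (z - x) \<le> N z" "N z \<le> norm (z - x) + k" for z
      using smooth_norm_bounds[of k "z - x"] k by (simp_all add: N_def)
    have cf: "continuous_on UNIV (\<lambda>z. v z - K' * N z)"
      by (intro continuous_on_diff continuous_on_mult continuous_on_const v C1_on_imp_continuous_on[OF CN])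
    have bd: "bounded {z \<in> UNIV. v z - K' * N z \<ge> v x - K' * N x}"
    proof -
      have "{z \<in> UNIV. v z - K' * N z \<ge> v x - K' * N x} \<subseteq> cball x ((2 * B + K' * N x) / K')"
      proof
        fix z assume "z \<in> {z \<in> UNIV. v z - K' * N z \<ge> v x - K' * N x}"
        then have "K' * N z \<le> 2 * B + K' * N x" using B[of z] B[of x] by auto
        then have "K' * norm (z - x) \<le> 2 * B + K' * N x"
          using N(1)[of z] K' by (meson mult_le_cancel_left_pos order_trans)
        then show "z \<in> cball x ((2 * B + K' * N x) / K')"
          using K' by (simp add: dist_norm norm_minus_commute[of x] pos_le_divide_eq mult.commute)
      qed
      then show ?thesis by (rule bounded_subset[rotated]) (rule bounded_cball)
    qed
    obtain z where z: "\<And>w. v w - K' * N w \<le> v z - K' * N z"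
      using continuous_attains_sup_coercive[OF closed_UNIV cf UNIV_I bd] by (metis UNIV_I)
    \<comment> \<open>At distance at least \<open>k\<close> from \<open>x\<close> the smoothed cone has slope at least \<open>K' / 2 > Kb\<close>.\<close>
    have "norm (z - x) < k"
    proof (rule ccontr)
      assume "\<not> norm (z - x) < k"
      then have r: "k \<le> norm (z - x)" by simp
      have "N z \<le> 2 * norm (z - x)" using N(2)[of z] r by linarith
      moreover have Nz: "N z > 0" using N(1)[of z] r k by linarith
      ultimately have "1 / 2 \<le> norm (z - x) / N z" by (simp add: divide_simps)
      then have "K' * (1 / 2) \<le> K' * (norm (z - x) / N z)" using K' by (intro mult_left_mono) auto
      also have "\<dots> = norm (K' *\<^sub>R GN z)"
      proof -
        have "GN z = (z - x) /\<^sub>R N z" by (simp add: GN_def N_def)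
        then show ?thesis using K' Nz by (simp add: divide_inverse mult.commute)
      qed
      also have "\<dots> \<le> Kb" by (rule grad[OF C1_on_cmult[OF CN] z])
      finally show False by (simp add: K'_def)
    qed
    then have "v z \<le> v x + e" using d(2)[of z] by (auto simp: k_def dist_norm dist_real_def)
    moreover have "v y - K' * N y \<le> v z - K' * N z" by (rule z)
    moreover have "0 \<le> K' * N z" using N(1)[of z] K' by (intro mult_nonneg_nonneg) (auto intro: order_trans[OF norm_ge_zero])
    moreover have "K' * N y \<le> K' * (norm (y - x) + e)"
      using N(2)[of y] K' by (intro mult_left_mono) (auto simp: k_def)
    ultimately show ?thesis by (simp add: algebra_simps)
  qed
  then show ?thesis unfolding K'_def by (rule le_add_eps)
qed

text \<open>This ball contains a fundamental domain of the integer lattice.\<close>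

lemma integer_translate_into_ball:
  fixes y :: "real ^ 'n"
  obtains k where "integer_vec k" "norm (y + k) \<le> real CARD('n)"
proof (rule that[of "\<chi> i. - of_int \<lfloor>y $ i\<rfloor>"])
  let ?k = "\<chi> i. - of_int \<lfloor>y $ i\<rfloor>"
  show "integer_vec ?k" by (simp add: integer_vec_def)
  have "norm (y + ?k) \<le> (\<Sum>i\<in>UNIV. \<bar>(y + ?k) $ i\<bar>)" by (rule norm_le_l1_cart)
  also have "\<dots> \<le> (\<Sum>i\<in>(UNIV::'n set). 1)"
    by (intro sum_mono) (simp add: abs_le_iff, linarith)
  finally show "norm (y + ?k) \<le> real CARD('n)" by simp
qed

text \<open>\<open>C\<close> is the Lipschitz constant of \<open>H\<close> and \<open>C5\<close> its constant of linear coercivity.\<close>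

locale periodic_hamiltonian =
  fixes H :: "real ^ 'n \<Rightarrow> real ^ 'n \<Rightarrow> real" and C C5 :: real
  assumes periodic: "integer_vec k \<Longrightarrow> H (y + k) p = H y p"
    and lipschitz: "\<bar>H x p - H y q\<bar> \<le> C * (norm (x - y) + norm (p - q))"
    and coercive: "H x p \<ge> inverse C5 * norm p - C5"
    and C_pos: "C > 0" and C5_pos: "C5 > 0"
begin

text \<open>Bounds \<open>|H y 0|\<close>: by periodicity \<open>y\<close> may be taken in a ball of radius \<open>CARD('n)\<close>.\<close>

definition bound_at_0 :: real where "bound_at_0 = \<bar>H 0 0\<bar> + C * real CARD('n)"

lemma abs_H_at_0_le: "\<bar>H y 0\<bar> \<le> bound_at_0"
proof -
  obtain k where k: "integer_vec k" "norm (y + k) \<le> real CARD('n)"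
    by (rule integer_translate_into_ball)
  have "\<bar>H y 0 - H 0 0\<bar> \<le> C * norm (y + k)"
    using lipschitz[of "y + k" 0 0 0] periodic[OF k(1)] by simp
  also have "\<dots> \<le> C * real CARD('n)" using k(2) C_pos by (intro mult_left_mono) auto
  finally show ?thesis by (simp add: bound_at_0_def)
qed

lemma H_bound: "\<bar>H y p\<bar> \<le> bound_at_0 + C * norm p"
  using abs_H_at_0_le[of y] lipschitz[of y p y 0] by auto

lemma H_lower: "H y p \<ge> - C5"
proof -
  have "0 \<le> inverse C5 * norm p" using C5_pos by simp
  then show ?thesis using coercive[of p y] by linarith
qed

lemma bound_at_0_nonneg: "bound_at_0 \<ge> 0"
  using abs_H_at_0_le[of 0] by linarith

lemma cell_solution_bounded:
  assumes "cell_solution H p c v"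
  shows "bounded (range v)"
proof -
  have cont: "continuous_on UNIV v" and per: "\<And>y k. integer_vec k \<Longrightarrow> v (y + k) = v y"
    using assms by (auto simp: cell_solution_def stat_visc_solution_def)
  have "range v \<subseteq> v ` cball 0 (real CARD('n))"
  proof
    fix r assume "r \<in> range v"
    then obtain y where r: "r = v y" by blast
    obtain k where "integer_vec k" "norm (y + k) \<le> real CARD('n)"
      by (rule integer_translate_into_ball)
    then have "r = v (y + k)" "y + k \<in> cball 0 (real CARD('n))" using per r by auto
    then show "r \<in> v ` cball 0 (real CARD('n))" by blast
  qed
  moreover have "compact (v ` cball 0 (real CARD('n)))"
    by (intro compact_continuous_image compact_cball continuous_on_subset[OF cont]) simp
  ultimately show ?thesis using compact_imp_bounded bounded_subset by blast
qed

text \<open>Constants touch the cell solution at its extrema.\<close>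

lemma cell_constant_bound:
  assumes "cell_solution H p c v"
  shows "\<bar>c\<bar> \<le> bound_at_0 + C * norm p"
proof -
  have cont: "continuous_on UNIV v" and per: "\<And>y k. integer_vec k \<Longrightarrow> v (y + k) = v y"
    and sub: "\<And>\<eta> G y. C1_on UNIV \<eta> G \<Longrightarrow> eventually (\<lambda>z. v z - \<eta> z \<le> v y - \<eta> y) (nhds y) \<Longrightarrow> H y (p + G y) - c \<le> 0"
    and super: "\<And>\<eta> G y. C1_on UNIV \<eta> G \<Longrightarrow> eventually (\<lambda>z. v z - \<eta> z \<ge> v y - \<eta> y) (nhds y) \<Longrightarrow> H y (p + G y) - c \<ge> 0"
    using assms by (auto simp: cell_solution_def stat_visc_solution_def)
  have cb: "continuous_on (cball 0 (real CARD('n))) v" by (rule continuous_on_subset[OF cont]) simp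
  have ne: "cball (0::real ^ 'n) (real CARD('n)) \<noteq> {}" by simp
  obtain a where a: "\<And>y. y \<in> cball 0 (real CARD('n)) \<Longrightarrow> v y \<le> v a"
    using continuous_attains_sup[OF compact_cball ne cb] by blast
  obtain b where b: "\<And>y. y \<in> cball 0 (real CARD('n)) \<Longrightarrow> v b \<le> v y"
    using continuous_attains_inf[OF compact_cball ne cb] by blast
  have ab: "v y \<le> v a" "v b \<le> v y" for y
  proof -
    obtain k where "integer_vec k" "norm (y + k) \<le> real CARD('n)"
      by (rule integer_translate_into_ball)
    then show "v y \<le> v a" "v b \<le> v y" using per[of k y] a[of "y + k"] b[of "y + k"] by auto
  qed
  have "H a (p + 0) - c \<le> 0"
    by (rule sub[OF C1_on_const[of UNIV 0]]) (use ab in auto)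
  moreover have "H b (p + 0) - c \<ge> 0"
    by (rule super[OF C1_on_const[of UNIV 0]]) (use ab in auto)
  ultimately show ?thesis using H_bound[of a p] H_bound[of b p] by (auto simp: abs_le_iff)
qed

text \<open>The Lipschitz seminorm of a cell solution is governed by \<open>grad_const * (1 + norm p)\<close>, its
  oscillation is at most \<open>osc_const * (1 + norm p)\<close>.\<close>

definition grad_const :: real where "grad_const = 1 + C5 * (C5 + bound_at_0 + C)"

definition osc_const :: real where "osc_const = 2 * (grad_const + 1) * real CARD('n)"

lemma grad_const_pos: "grad_const > 0" and osc_const_nonneg: "osc_const \<ge> 0"
proof -
  show "grad_const > 0" using C5_pos C_pos bound_at_0_nonneg by (simp add: grad_const_def add_pos_nonneg)
  then show "osc_const \<ge> 0" by (simp add: osc_const_def)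
qed

text \<open>Coercivity turns the equation into a gradient bound, and periodicity turns the resulting Lipschitz
  estimate into a bound of the oscillation.\<close>

lemma cell_solution_oscillation:
  assumes cell: "cell_solution H p c v"
  shows "v y - v x \<le> osc_const * (1 + norm p)"
proof -
  have cont: "continuous_on UNIV v" and per: "\<And>y k. integer_vec k \<Longrightarrow> v (y + k) = v y"
    and sub: "\<And>\<eta> G y. C1_on UNIV \<eta> G \<Longrightarrow> eventually (\<lambda>z. v z - \<eta> z \<le> v y - \<eta> y) (nhds y) \<Longrightarrow> H y (p + G y) - c \<le> 0"
    using cell by (auto simp: cell_solution_def stat_visc_solution_def)
  define Kb where "Kb = grad_const * (1 + norm p)"
  have Kb: "Kb \<ge> 0" using grad_const_pos by (simp add: Kb_def)
  have lip: "v b - v a \<le> 2 * (Kb + 1) * norm (b - a)" for a b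
  proof (rule lipschitz_of_gradient_bound[OF cont cell_solution_bounded[OF cell] Kb])
    fix \<eta> G y assume "C1_on UNIV \<eta> G" "\<And>z. v z - \<eta> z \<le> v y - \<eta> y"
    then have "H y (p + G y) \<le> c" using sub[of \<eta> G y] by simp
    then have "inverse C5 * norm (p + G y) \<le> C5 + (bound_at_0 + C * norm p)"
      using coercive[of "p + G y" y] cell_constant_bound[OF cell] by linarith
    then have "norm (p + G y) \<le> C5 * (C5 + (bound_at_0 + C * norm p))"
      using C5_pos by (simp add: field_simps)
    then have "norm (G y) \<le> norm p + C5 * (C5 + (bound_at_0 + C * norm p))"
      using norm_triangle_ineq4[of "p + G y" p] by simp
    also have "\<dots> \<le> Kb"
      using C5_pos bound_at_0_nonneg C_pos by (simp add: Kb_def grad_const_def algebra_simps)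
    finally show "norm (G y) \<le> Kb" .
  qed
  obtain k where k: "integer_vec k" "norm ((y - x) + k) \<le> real CARD('n)"
    by (rule integer_translate_into_ball)
  have "v y - v x = v (y + k) - v x" using per[OF k(1)] by simp
  also have "\<dots> \<le> 2 * (Kb + 1) * norm ((y - x) + k)" using lip[of "y + k" x] by (simp add: algebra_simps)
  also have "\<dots> \<le> 2 * (Kb + 1) * real CARD('n)" using k(2) Kb by (intro mult_left_mono) auto
  also have "\<dots> \<le> 2 * ((grad_const + 1) * (1 + norm p)) * real CARD('n)"
    by (intro mult_right_mono mult_left_mono) (auto simp: Kb_def algebra_simps)
  also have "\<dots> = osc_const * (1 + norm p)" by (simp only: osc_const_def mult_ac)
  finally show ?thesis .
qed

lemma discounted_lipschitz_parameter:
  assumes \<mu>: "\<mu> > 0"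
    and v: "bounded (range v)" "stat_visc_solution (\<lambda>y r q. \<mu> * r + H y (p + q)) v"
    and v': "bounded (range v')" "stat_visc_solution (\<lambda>y r q. \<mu> * r + H y (p' + q)) v'"
  shows "\<mu> * (v x - v' x) \<le> C * norm (p - p')"
proof (rule stationary_comparison[OF _ v(1) _ v'(1) \<mu>])
  show "continuous_on UNIV v" "continuous_on UNIV v'" using v v' by (auto simp: stat_visc_solution_def)
  show "\<mu> * v y + H y (p + G y) \<le> 0" if "C1_on UNIV \<eta> G" "\<And>z. v z - \<eta> z \<le> v y - \<eta> y" for \<eta> G y
    using v(2) that unfolding stat_visc_solution_def by (meson always_eventually)
  show "\<mu> * v' y + H y (p' + G y) \<ge> 0" if "C1_on UNIV \<eta> G" "\<And>z. v' z - \<eta> z \<ge> v' y - \<eta> y" for \<eta> G y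
    using v'(2) that unfolding stat_visc_solution_def by (meson always_eventually)
  show "H y (p' + q) - H x (p + r) \<le> C * norm (p - p') + C * (norm (x - y) + norm (r - q))" for x y r q
  proof -
    have "H y (p' + q) - H x (p + r) \<le> C * (norm (y - x) + norm ((p' + q) - (p + r)))"
      using lipschitz[of y "p' + q" x "p + r"] by linarith
    also have "(p' + q) - (p + r) = (p' - p) + (q - r)" by simp
    also have "C * (norm (y - x) + norm ((p' - p) + (q - r)))
        \<le> C * (norm (x - y) + (norm (p - p') + norm (r - q)))"
      using norm_triangle_ineq[of "p' - p" "q - r"] C_pos
      by (intro mult_left_mono add_mono) (auto simp: norm_minus_commute)
    finally show ?thesis by (simp add: algebra_simps)
  qed
  show "C \<ge> 0" using C_pos by simp
qed

text \<open>A cell solution, shifted vertically, is a sub- or supersolution of the discounted equation. The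
  shifts differ by twice a bound of its oscillation, which is the source of the linear growth in \<open>p\<close>.\<close>

lemma discounted_near_effective:
  assumes \<mu>: "\<mu> > 0"
    and v: "bounded (range v)" "stat_visc_solution (\<lambda>y r q. \<mu> * r + H y (p + q)) v"
    and cell: "cell_solution H p c v0"
  shows "\<bar>\<mu> * v x + c\<bar> \<le> \<mu> * (2 * osc_const * (1 + norm p))"
proof -
  define q where "q = osc_const * (1 + norm p)"
  have osc: "v0 y - v0 0 \<le> q" "v0 0 - v0 y \<le> q" for y
    using cell_solution_oscillation[OF cell] by (auto simp: q_def)
  have c0: "continuous_on UNIV v0"
    and sub0: "\<And>\<eta> G y. C1_on UNIV \<eta> G \<Longrightarrow> eventually (\<lambda>z. v0 z - \<eta> z \<le> v0 y - \<eta> y) (nhds y) \<Longrightarrow> H y (p + G y) - c \<le> 0"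
    and super0: "\<And>\<eta> G y. C1_on UNIV \<eta> G \<Longrightarrow> eventually (\<lambda>z. v0 z - \<eta> z \<ge> v0 y - \<eta> y) (nhds y) \<Longrightarrow> H y (p + G y) - c \<ge> 0"
    using cell by (auto simp: cell_solution_def stat_visc_solution_def)
  have cv: "continuous_on UNIV v" using v by (simp add: stat_visc_solution_def)
  have Hl: "H y (p + r) - H x (p + s) \<le> 0 + C * (norm (x - y) + norm (s - r))" for x y r s
    using lipschitz[of y "p + r" x "p + s"] by (simp add: norm_minus_commute algebra_simps)
  have bdd: "bounded (range (\<lambda>y. v0 y + d))" for d
    using bounded_plus[OF cell_solution_bounded[OF cell], of "{d}"]
    by (rule bounded_subset) auto
  \<comment> \<open>Vertical shifts of the cell solution that lie above, respectively below, \<open>- c / \<mu>\<close>.\<close>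
  define up where "up = (\<lambda>y. v0 y + (q - v0 0 - c / \<mu>))"
  define lo where "lo = (\<lambda>y. v0 y + (- q - v0 0 - c / \<mu>))"
  have "\<mu> * (v x - up x) \<le> 0"
  proof (rule stationary_comparison[OF cv v(1) _ _ \<mu> _ _ Hl])
    show "continuous_on UNIV up" "bounded (range up)"
      unfolding up_def using c0 bdd by (auto intro: continuous_intros)
    show "\<mu> * v y + H y (p + G y) \<le> 0" if "C1_on UNIV \<eta> G" "\<And>z. v z - \<eta> z \<le> v y - \<eta> y" for \<eta> G y
      using v(2) that unfolding stat_visc_solution_def by (meson always_eventually)
    show "\<mu> * up y + H y (p + G y) \<ge> 0" if "C1_on UNIV \<eta> G" "\<And>z. up z - \<eta> z \<ge> up y - \<eta> y" for \<eta> G y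
    proof -
      have "\<And>z. v0 z - \<eta> z \<ge> v0 y - \<eta> y" using that(2) by (simp add: up_def)
      then have "H y (p + G y) \<ge> c" using super0[OF that(1), of y] by simp
      moreover have "\<mu> * up y \<ge> \<mu> * (- c / \<mu>)"
        using osc(2)[of y] \<mu> by (intro mult_left_mono) (auto simp: up_def)
      ultimately show ?thesis using \<mu> by simp
    qed
  qed (use C_pos in simp)
  moreover have "\<mu> * (lo x - v x) \<le> 0"
  proof (rule stationary_comparison[OF _ _ cv v(1) \<mu> _ _ Hl])
    show "continuous_on UNIV lo" "bounded (range lo)"
      unfolding lo_def using c0 bdd by (auto intro: continuous_intros)
    show "\<mu> * v y + H y (p + G y) \<ge> 0" if "C1_on UNIV \<eta> G" "\<And>z. v z - \<eta> z \<ge> v y - \<eta> y" for \<eta> G y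
      using v(2) that unfolding stat_visc_solution_def by (meson always_eventually)
    show "\<mu> * lo y + H y (p + G y) \<le> 0" if "C1_on UNIV \<eta> G" "\<And>z. lo z - \<eta> z \<le> lo y - \<eta> y" for \<eta> G y
    proof -
      have "\<And>z. v0 z - \<eta> z \<le> v0 y - \<eta> y" using that(2) by (simp add: lo_def)
      then have "H y (p + G y) \<le> c" using sub0[OF that(1), of y] by simp
      moreover have "\<mu> * lo y \<le> \<mu> * (- c / \<mu>)"
        using osc(1)[of y] \<mu> by (intro mult_left_mono) (auto simp: lo_def)
      ultimately show ?thesis using \<mu> by simp
    qed
  qed (use C_pos in simp)
  ultimately have "\<mu> * v x \<le> \<mu> * up x" "\<mu> * lo x \<le> \<mu> * v x" by (simp_all add: right_diff_distrib)
  moreover have "\<mu> * up x \<le> \<mu> * (2 * q - c / \<mu>)" "\<mu> * (- (2 * q) - c / \<mu>) \<le> \<mu> * lo x"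
    using osc[of x] \<mu> by (auto intro!: mult_left_mono simp: up_def lo_def)
  moreover have "\<mu> * (2 * q - c / \<mu>) = \<mu> * (2 * q) - c" "\<mu> * (- (2 * q) - c / \<mu>) = - (\<mu> * (2 * q)) - c"
    using \<mu> by (simp_all add: field_simps)
  ultimately have "\<bar>\<mu> * v x + c\<bar> \<le> \<mu> * (2 * q)" by linarith
  then show ?thesis by (simp add: q_def mult.assoc)
qed

text \<open>\<open>Hbar p\<close> is the limit of \<open>- \<mu> v \<mu> 0 p\<close> as \<open>\<mu>\<close> tends to \<open>0\<close>, and these functions are Lipschitz in
  \<open>p\<close> with a common constant.\<close>

lemma effective_hamiltonian_lipschitz:
  assumes eff: "effective_hamiltonian H Hbar"
    and v: "\<forall>\<mu>>0. \<forall>p. bounded (range (\<lambda>y. v \<mu> y p)) \<and>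
              stat_visc_solution (\<lambda>y r q. \<mu> * r + H y (p + q)) (\<lambda>y. v \<mu> y p)"
  shows "\<bar>Hbar p - Hbar q\<bar> \<le> C * norm (p - q)"
proof -
  have cells: "\<exists>v0. cell_solution H p (Hbar p) v0" for p
    using eff unfolding effective_hamiltonian_def by blast
  have le: "Hbar p - Hbar q \<le> C * norm (p - q)" for p q
  proof -
    have "Hbar p - Hbar q \<le> C * norm (p - q) + (2 * osc_const * (1 + norm p) + 2 * osc_const * (1 + norm q)) * \<mu>"
      if \<mu>: "\<mu> > 0" for \<mu>
    proof -
      obtain v0 w0 where "cell_solution H p (Hbar p) v0" "cell_solution H q (Hbar q) w0" using cells by metis
      then have "\<bar>\<mu> * v \<mu> 0 p + Hbar p\<bar> \<le> \<mu> * (2 * osc_const * (1 + norm p))"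
        "\<bar>\<mu> * v \<mu> 0 q + Hbar q\<bar> \<le> \<mu> * (2 * osc_const * (1 + norm q))"
        using discounted_near_effective[OF \<mu>, of "\<lambda>y. v \<mu> y p"]
          discounted_near_effective[OF \<mu>, of "\<lambda>y. v \<mu> y q"] v \<mu> by blast+
      moreover have "\<mu> * (v \<mu> 0 q - v \<mu> 0 p) \<le> C * norm (q - p)"
        using discounted_lipschitz_parameter[OF \<mu>, of "\<lambda>y. v \<mu> y q" q "\<lambda>y. v \<mu> y p" p 0] v \<mu> by blast
      ultimately have "Hbar p - Hbar q \<le> C * norm (q - p) + \<mu> * (2 * osc_const * (1 + norm p)) + \<mu> * (2 * osc_const * (1 + norm q))"
        unfolding right_diff_distrib by linarith
      then show ?thesis by (simp add: norm_minus_commute algebra_simps)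
    qed
    then show ?thesis by (rule le_add_eps)
  qed
  from le[of p q] le[of q p] show ?thesis by (simp add: norm_minus_commute)
qed

section \<open>The estimate at the maximum point\<close>

text \<open>With \<open>v\<close> frozen at \<open>p\<close>, the function \<open>B\<close> solves the discounted equation at scale \<open>\<epsilon>\<close> and plays
  the role of the corrector. The term \<open>E (|x - xh| + |y - yh|)\<close> that pays for freezing perturbs both
  gradients by at most \<open>E\<close>. Of the two upper bounds the first uses the equation of \<open>v\<close> to replace
  \<open>H\<close> by \<open>Hbar p\<close>, the second only that \<open>H\<close> is bounded below.\<close>

lemma corrected_maximum_estimate:
  fixes u ubar :: "(real ^ 'n) \<times> real \<Rightarrow> real" and v :: "real ^ 'n \<Rightarrow> real ^ 'n \<Rightarrow> real"
  assumes \<alpha>: "\<alpha> \<in> {0<..<1}"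
    and u: "BUC_on (UNIV \<times> {0..T}) u" "evol_visc_subsolution \<alpha> T (\<lambda>x p. H (x /\<^sub>R \<epsilon>) p) u0 u"
    and ubar: "BUC_on (UNIV \<times> {0..T}) ubar" "evol_visc_supersolution \<alpha> T (\<lambda>x p. Hbar p) u0 ubar"
    and eff: "effective_hamiltonian H Hbar"
    and Hbar: "\<And>p q. \<bar>Hbar p - Hbar q\<bar> \<le> C * norm (p - q)"
    and lip: "\<And>x y t. t \<in> {0..T} \<Longrightarrow> ubar (x, t) - ubar (y, t) \<le> L * norm (x - y)"
    and v: "\<And>p. bounded (range (\<lambda>y. v y p)) \<and> stat_visc_solution (\<lambda>y r q. lam * r + H y (p + q)) (\<lambda>y. v y p)"
    and pos: "lam > 0" "\<epsilon> > 0" "e > 0" "\<delta> > 0" "c \<ge> 0"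
    and th: "th \<in> {0<..T}"
    and max: "\<And>x y t. t \<in> {0..T} \<Longrightarrow>
       u (x, t) - ubar (y, t) - \<epsilon> * v (x /\<^sub>R \<epsilon>) ((x - y) /\<^sub>R e) - (norm (x - y))\<^sup>2 / (2 * e)
         - \<delta> * (norm y)\<^sup>2 / 2 - c * t powr \<alpha>
       \<le> u (xh, th) - ubar (yh, th) - \<epsilon> * v (xh /\<^sub>R \<epsilon>) ((xh - yh) /\<^sub>R e) - (norm (xh - yh))\<^sup>2 / (2 * e)
         - \<delta> * (norm yh)\<^sup>2 / 2 - c * th powr \<alpha>"
    and p: "p = (xh - yh) /\<^sub>R e" and E: "E = C * \<epsilon> / (lam * e)"
  shows "norm (p - \<delta> *\<^sub>R yh) \<le> L + E"
    and "\<exists>l. ((\<lambda>r. K \<alpha> r th u xh th - K \<alpha> r th ubar yh th) \<longlongrightarrow> l) (at_right 0) \<and>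
      J \<alpha> u xh th - J \<alpha> ubar yh th + l \<le> lam * (2 * osc_const * (1 + norm p)) + C * (\<delta> * norm yh) + 2 * (C * E) \<and>
      J \<alpha> u xh th - J \<alpha> ubar yh th + l \<le> C5 + bound_at_0 + C * norm (p - \<delta> *\<^sub>R yh) + C * E"
proof -
  have E0: "E \<ge> 0" using pos C_pos by (simp add: E)
  define B where "B = (\<lambda>x. \<epsilon> * v (x /\<^sub>R \<epsilon>) p)"
  define A0 where "A0 = (\<lambda>z::(real ^ 'n) \<times> (real ^ 'n). 1 / (2 * e) * (norm (fst z - snd z))\<^sup>2 + \<delta> / 2 * (norm (snd z))\<^sup>2
      + E * (norm (fst z - xh) + norm (snd z - yh)))"
  \<comment> \<open>Freezing the second argument of \<open>v\<close> costs its Lipschitz constant \<open>C / lam\<close> times the distance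
     moved in that argument, and keeps the point \<open>(xh, yh, th)\<close> maximal.\<close>
  have frozen: "u (x, t) - ubar (y, t) - B x - A0 (x, y) - c * t powr \<alpha>
      \<le> u (xh, th) - ubar (yh, th) - B xh - A0 (xh, yh) - c * th powr \<alpha>" if t: "t \<in> {0..T}" for x y t
  proof -
    define p' where "p' = (x - y) /\<^sub>R e"
    have "p' - p = ((x - xh) - (y - yh)) /\<^sub>R e" by (simp add: p'_def p algebra_simps)
    then have "norm (p' - p) = norm ((x - xh) - (y - yh)) / e" using pos by (simp add: divide_inverse mult.commute)
    also have "\<dots> \<le> (norm (x - xh) + norm (y - yh)) / e"
      using pos by (intro divide_right_mono norm_triangle_ineq4) auto
    finally have pp: "norm (p' - p) \<le> (norm (x - xh) + norm (y - yh)) / e" .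
    have "lam * (v (x /\<^sub>R \<epsilon>) p' - v (x /\<^sub>R \<epsilon>) p) \<le> C * norm (p' - p)"
      using discounted_lipschitz_parameter[OF pos(1), of "\<lambda>y. v y p'" p' "\<lambda>y. v y p" p] v by blast
    also have "\<dots> \<le> C * ((norm (x - xh) + norm (y - yh)) / e)" using pp C_pos by (intro mult_left_mono) auto
    finally have "v (x /\<^sub>R \<epsilon>) p' - v (x /\<^sub>R \<epsilon>) p \<le> C * ((norm (x - xh) + norm (y - yh)) / e) / lam"
      using pos by (simp add: pos_le_divide_eq mult.commute)
    then have "\<epsilon> * (v (x /\<^sub>R \<epsilon>) p' - v (x /\<^sub>R \<epsilon>) p) \<le> \<epsilon> * (C * ((norm (x - xh) + norm (y - yh)) / e) / lam)"
      using pos by (intro mult_left_mono) auto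
    also have "\<dots> = E * (norm (x - xh) + norm (y - yh))" by (simp add: E mult_ac)
    finally have "\<epsilon> * v (x /\<^sub>R \<epsilon>) p' \<le> \<epsilon> * v (x /\<^sub>R \<epsilon>) p + E * (norm (x - xh) + norm (y - yh))"
      by (simp add: right_diff_distrib)
    then show ?thesis
      using max[OF t, of x y] unfolding B_def A0_def p'_def[symmetric] p[symmetric] by simp
  qed
  define q where "q = p - \<delta> *\<^sub>R yh"
  show grad: "norm (p - \<delta> *\<^sub>R yh) \<le> L + E"
  proof -
    \<comment> \<open>Moving \<open>y\<close> from \<open>yh\<close> by \<open>s q\<close> decreases the quadratic terms at the rate \<open>|q|\<^sup>2\<close>.\<close>
    have "norm q * norm q \<le> (L + E) * norm q + (norm q * norm q * (1 / (2 * e) + \<delta> / 2)) * s" if s: "s > 0" for s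
    proof -
      have "ubar (yh, th) - ubar (yh + s *\<^sub>R q, th) + A0 (xh, yh) - A0 (xh, yh + s *\<^sub>R q) \<le> 0"
        using frozen[of th xh "yh + s *\<^sub>R q"] th by simp
      moreover have "ubar (yh + s *\<^sub>R q, th) - ubar (yh, th) \<le> L * (s * norm q)"
        using lip[of th "yh + s *\<^sub>R q" yh] th s by simp
      moreover have "A0 (xh, yh) - A0 (xh, yh + s *\<^sub>R q)
          = s * (norm q * norm q) - s * s * (norm q * norm q) * (1 / (2 * e) + \<delta> / 2) - E * (s * norm q)"
      proof -
        have n1: "(norm (xh - (yh + s *\<^sub>R q)))\<^sup>2 = (norm (xh - yh))\<^sup>2 - 2 * s * ((xh - yh) \<bullet> q) + s * s * (q \<bullet> q)"
          by (simp add: power2_norm_eq_inner inner_diff_left inner_diff_right inner_add_left inner_add_right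
              inner_commute algebra_simps)
        have n2: "(norm (yh + s *\<^sub>R q))\<^sup>2 = (norm yh)\<^sup>2 + 2 * s * (yh \<bullet> q) + s * s * (q \<bullet> q)"
          by (simp add: power2_norm_eq_inner inner_add_left inner_add_right inner_commute algebra_simps)
        have "A0 (xh, yh) - A0 (xh, yh + s *\<^sub>R q)
          = s * (((xh - yh) \<bullet> q) / e - \<delta> * (yh \<bullet> q)) - s * s * (q \<bullet> q) * (1 / (2 * e) + \<delta> / 2) - E * (s * norm q)"
          unfolding A0_def fst_conv snd_conv n1 n2 using s pos by (simp add: field_simps)
        moreover have "((xh - yh) \<bullet> q) / e - \<delta> * (yh \<bullet> q) = q \<bullet> q"
          by (simp add: q_def p inner_diff_left inner_diff_right divide_inverse_commute algebra_simps)
        ultimately show ?thesis by (simp add: power2_norm_eq_inner[symmetric] power2_eq_square)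
      qed
      ultimately have "s * (norm q * norm q)
        \<le> s * ((L + E) * norm q + (norm q * norm q * (1 / (2 * e) + \<delta> / 2)) * s)"
        by (simp add: algebra_simps)
      then show ?thesis using s by simp
    qed
    then have "norm q * norm q \<le> (L + E) * norm q" by (rule le_add_eps)
    moreover have "0 \<le> L + E"
    proof -
      obtain d :: "real ^ 'n" where d: "norm d = 1" using vector_choose_size zero_le_one by blast
      have "ubar (d, th) - ubar (0, th) \<le> L" "ubar (0, th) - ubar (d, th) \<le> L"
        using lip[of th d 0] lip[of th 0 d] th d by auto
      then show ?thesis using E0 by linarith
    qed
    ultimately show ?thesis unfolding q_def[symmetric] by (cases "q = 0") auto
  qed
  \<comment> \<open>The Euclidean norms are smoothed at scale \<open>1 / (n + 1)\<close> to obtain admissible test functions.\<close>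
  define k where "k = (\<lambda>n::nat. 1 / real (Suc n))"
  have k0: "k n > 0" for n by (simp add: k_def)
  define N where "N = (\<lambda>n a (x::real ^ 'n). sqrt ((norm (x - a))\<^sup>2 + (k n)\<^sup>2))"
  define GN where "GN = (\<lambda>n a (x::real ^ 'n). (x - a) /\<^sub>R sqrt ((norm (x - a))\<^sup>2 + (k n)\<^sup>2))"
  have CN: "C1_on UNIV (N n a) (GN n a)" for n a
    unfolding N_def GN_def by (rule C1_on_smooth_norm[OF k0])
  have N: "norm (x - a) \<le> N n a x" "N n a x \<le> norm (x - a) + k n" "norm (GN n a x) \<le> 1" for n a x
    using smooth_norm_bounds[of "k n" "x - a"] k0[of n] by (simp_all add: N_def GN_def less_imp_le)
  define A where "A = (\<lambda>n (z::(real ^ 'n) \<times> (real ^ 'n)). (1 / (2 * e) * (norm ((fst z - snd z) - 0))\<^sup>2 + \<delta> / 2 * (norm (snd z - 0))\<^sup>2)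
      + E * (N n xh (fst z) + N n yh (snd z)))"
  define G where "G = (\<lambda>n (z::(real ^ 'n) \<times> (real ^ 'n)).
      ((1 / (2 * e)) *\<^sub>R (2 *\<^sub>R ((fst z - snd z) - 0), - (2 *\<^sub>R ((fst z - snd z) - 0)))
        + (\<delta> / 2) *\<^sub>R (0, 2 *\<^sub>R (snd z - 0)))
      + E *\<^sub>R ((GN n xh (fst z), 0) + (0, GN n yh (snd z))))"
  have CA: "C1_on UNIV (A n) (G n)" for n
    unfolding A_def G_def
    by (intro C1_on_add C1_on_cmult C1_on_diff_variables[OF C1_on_sqnorm] C1_on_UNIV_snd[OF C1_on_sqnorm]
        C1_on_UNIV_fst[OF CN] C1_on_UNIV_snd[OF CN])
  have A_nonneg: "0 \<le> A n z" for n z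
  proof -
    have "0 \<le> N n xh (fst z)" "0 \<le> N n yh (snd z)" using N(1) norm_ge_zero order_trans by blast+
    then show ?thesis unfolding A_def using pos E0 by (intro add_nonneg_nonneg mult_nonneg_nonneg) auto
  qed
  have A_close: "\<bar>A n z - A0 z\<bar> \<le> 2 * E * k n" for n z
  proof -
    define d where "d = (N n xh (fst z) - norm (fst z - xh)) + (N n yh (snd z) - norm (snd z - yh))"
    have "A n z - A0 z = E * d"
      by (simp add: A_def A0_def d_def algebra_simps)
    moreover have "0 \<le> d" "d \<le> 2 * k n"
      using N(1)[of "fst z" xh n] N(2)[of n xh "fst z"] N(1)[of "snd z" yh n] N(2)[of n yh "snd z"]
      unfolding d_def by linarith+
    moreover from this have "E * d \<le> E * (2 * k n)" using E0 by (intro mult_left_mono)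
    ultimately show ?thesis using E0 by (simp add: mult_ac)
  qed
  have k_lim: "(\<lambda>n. 2 * E * k n) \<longlonglongrightarrow> 0"
    unfolding k_def using tendsto_mult_right_zero[OF LIMSEQ_inverse_real_of_nat, of "2 * E"]
    by (simp add: divide_inverse)
  define S1 where "S1 = lam * (2 * osc_const * (1 + norm p)) + C * (\<delta> * norm yh) + 2 * (C * E)"
  define S2 where "S2 = C5 + bound_at_0 + C * norm (p - \<delta> *\<^sub>R yh) + C * E"
  obtain v0 where v0: "cell_solution H p (Hbar p) v0" using eff unfolding effective_hamiltonian_def by blast
  have bound: "\<exists>\<kappa>>0. \<forall>n x y z g a b.
        dist x xh < \<kappa> \<and> dist y yh < \<kappa> \<and> dist z xh < \<kappa> \<and> norm a < \<kappa> \<and> norm b < \<kappa> \<and>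
        (\<exists>\<eta> G\<eta>. C1_on UNIV \<eta> G\<eta> \<and> G\<eta> z = g \<and> (\<forall>z'. B z' - \<eta> z' \<ge> B z - \<eta> z)) \<longrightarrow>
        Hbar (b - snd (G n (x, y))) - H (x /\<^sub>R \<epsilon>) (g + fst (G n (x, y)) + a) \<le> min S1 S2 + e'"
    if e': "e' > 0" for e' :: real
  proof -
    \<comment> \<open>The total factor of \<open>\<kappa>\<close> in the perturbations of the arguments of \<open>H\<close> and \<open>Hbar\<close> below.\<close>
    define w where "w = 2 / \<epsilon> + 4 / e + 2 + \<delta>"
    have w: "w > 0" using pos by (simp add: w_def add_pos_pos)
    define \<kappa> where "\<kappa> = e' / (C * w)"
    have \<kappa>: "\<kappa> > 0" "C * (w * \<kappa>) = e'" using e' C_pos w by (simp_all add: \<kappa>_def)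
    show ?thesis
    proof (intro exI[of _ \<kappa>] conjI allI impI)
      show "\<kappa> > 0" by (rule \<kappa>)
      fix n and x y z g a b :: "real ^ 'n"
      assume h: "dist x xh < \<kappa> \<and> dist y yh < \<kappa> \<and> dist z xh < \<kappa> \<and> norm a < \<kappa> \<and> norm b < \<kappa> \<and>
        (\<exists>\<eta> G\<eta>. C1_on UNIV \<eta> G\<eta> \<and> G\<eta> z = g \<and> (\<forall>z'. B z' - \<eta> z' \<ge> B z - \<eta> z))"
      then obtain \<eta> G\<eta> where \<eta>: "C1_on UNIV \<eta> G\<eta>" "G\<eta> z = g" "\<And>z'. B z' - \<eta> z' \<ge> B z - \<eta> z" by blast
      have close: "norm (x - xh) < \<kappa>" "norm (y - yh) < \<kappa>" "norm (z - xh) < \<kappa>" "norm a < \<kappa>" "norm b < \<kappa>"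
        using h by (auto simp: dist_norm)
      define d where "d = ((x - xh) - (y - yh)) /\<^sub>R e"
      have d: "norm d \<le> 2 * \<kappa> / e"
      proof -
        have "norm d = norm ((x - xh) - (y - yh)) / e" using pos by (simp add: d_def divide_inverse mult.commute)
        also have "\<dots> \<le> 2 * \<kappa> / e"
          using pos close norm_triangle_ineq4[of "x - xh" "y - yh"] by (intro divide_right_mono) auto
        finally show ?thesis .
      qed
      have pd: "(1 / (2 * e)) *\<^sub>R (2 *\<^sub>R (x - y)) = p + d"
      proof -
        have "1 / (2 * e) * 2 = inverse e" using pos by (simp add: field_simps)
        moreover have "(xh - yh) + ((x - xh) - (y - yh)) = x - y" by simp
        ultimately show ?thesis
          unfolding p d_def scaleR_add_right[symmetric] scaleR_scaleR by (simp only:)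
      qed
      have G1: "fst (G n (x, y)) = p + d + E *\<^sub>R GN n xh x"
        unfolding pd[symmetric] by (simp add: G_def)
      have G2: "- snd (G n (x, y)) = (p - \<delta> *\<^sub>R yh) + (d - \<delta> *\<^sub>R (y - yh) - E *\<^sub>R GN n yh y)"
      proof -
        have "- snd (G n (x, y)) = (1 / (2 * e)) *\<^sub>R (2 *\<^sub>R (x - y)) - \<delta> *\<^sub>R y - E *\<^sub>R GN n yh y"
          by (simp add: G_def)
        then show ?thesis unfolding pd by (simp add: algebra_simps)
      qed
      have nE: "norm (E *\<^sub>R GN n c x) \<le> E" for n c x
        using E0 N(3)[of n c x] mult_left_mono[of "norm (GN n c x)" 1 E] by simp
      define b' where "b' = b + (d - \<delta> *\<^sub>R (y - yh) - E *\<^sub>R GN n yh y)"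
      have b'_bound: "norm b' \<le> E + (\<kappa> + 2 * \<kappa> / e + \<delta> * \<kappa>)"
      proof -
        have "norm b' \<le> norm b + (norm d + norm (\<delta> *\<^sub>R (y - yh)) + norm (E *\<^sub>R GN n yh y))"
          unfolding b'_def
          by (meson norm_triangle_ineq norm_triangle_ineq4 add_left_mono add_right_mono order_trans)
        moreover have "norm (\<delta> *\<^sub>R (y - yh)) \<le> \<delta> * \<kappa>" using pos close by simp
        ultimately show ?thesis using close d nE[of n yh y] by linarith
      qed
      have b_eq: "b - snd (G n (x, y)) = (p - \<delta> *\<^sub>R yh) + b'"
        unfolding b'_def using G2 by (simp add: algebra_simps)
      have Cw: "C * norm b' \<le> C * E + C * (\<kappa> + 2 * \<kappa> / e + \<delta> * \<kappa>)"
        unfolding distrib_left[symmetric] using b'_bound C_pos by (intro mult_left_mono) auto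
      have Hb: "Hbar (b - snd (G n (x, y))) \<le> Hbar (p - \<delta> *\<^sub>R yh) + (C * E + C * (\<kappa> + 2 * \<kappa> / e + \<delta> * \<kappa>))"
        using Hbar[of "(p - \<delta> *\<^sub>R yh) + b'" "p - \<delta> *\<^sub>R yh"] Cw unfolding b_eq by simp
      have part: "C * (\<kappa> + 2 * \<kappa> / e + \<delta> * \<kappa>) + C * (2 * \<kappa> / \<epsilon> + \<kappa> + 2 * \<kappa> / e) = e'"
        unfolding \<kappa>(2)[symmetric] w_def distrib_left[symmetric]
        by (simp add: algebra_simps)
      have part0: "0 \<le> C * (2 * \<kappa> / \<epsilon> + \<kappa> + 2 * \<kappa> / e)" using C_pos pos \<kappa> by simp
      have le2: "Hbar (b - snd (G n (x, y))) - H (x /\<^sub>R \<epsilon>) (g + fst (G n (x, y)) + a) \<le> S2 + e'"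
      proof -
        obtain v1 where "cell_solution H (p - \<delta> *\<^sub>R yh) (Hbar (p - \<delta> *\<^sub>R yh)) v1"
          using eff unfolding effective_hamiltonian_def by blast
        from cell_constant_bound[OF this]
        have "Hbar (p - \<delta> *\<^sub>R yh) \<le> bound_at_0 + C * norm (p - \<delta> *\<^sub>R yh)" by linarith
        then show ?thesis
          using Hb part part0 H_lower[of "x /\<^sub>R \<epsilon>" "g + fst (G n (x, y)) + a"] unfolding S2_def by linarith
      qed
      have le1: "Hbar (b - snd (G n (x, y))) - H (x /\<^sub>R \<epsilon>) (g + fst (G n (x, y)) + a) \<le> S1 + e'"
      proof -
        \<comment> \<open>The test function for \<open>B\<close> at \<open>z\<close> becomes one for \<open>v\<close> at \<open>z / \<epsilon>\<close>.\<close>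
        have super: "lam * v (z /\<^sub>R \<epsilon>) p + H (z /\<^sub>R \<epsilon>) (p + g) \<ge> 0"
        proof -
          have "C1_on UNIV (\<lambda>y. \<eta> (\<epsilon> *\<^sub>R y) / \<epsilon>) (\<lambda>y. G\<eta> (\<epsilon> *\<^sub>R y))"
            using C1_on_rescale[OF \<eta>(1)] pos by simp
          moreover have "v z' p - \<eta> (\<epsilon> *\<^sub>R z') / \<epsilon> \<ge> v (z /\<^sub>R \<epsilon>) p - \<eta> (\<epsilon> *\<^sub>R (z /\<^sub>R \<epsilon>)) / \<epsilon>" for z'
          proof -
            have "B (\<epsilon> *\<^sub>R z') - \<eta> (\<epsilon> *\<^sub>R z') \<ge> B z - \<eta> z" by (rule \<eta>(3))
            then have "\<epsilon> * (v (z /\<^sub>R \<epsilon>) p - \<eta> z / \<epsilon>) \<le> \<epsilon> * (v z' p - \<eta> (\<epsilon> *\<^sub>R z') / \<epsilon>)"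
              using pos by (simp add: B_def right_diff_distrib)
            then show ?thesis using pos by simp
          qed
          ultimately have "lam * v (z /\<^sub>R \<epsilon>) p + H (z /\<^sub>R \<epsilon>) (p + G\<eta> (\<epsilon> *\<^sub>R (z /\<^sub>R \<epsilon>))) \<ge> 0"
            using v[of p] unfolding stat_visc_solution_def by (meson always_eventually)
          then show ?thesis using \<eta>(2) pos by simp
        qed
        have near: "lam * v (z /\<^sub>R \<epsilon>) p + Hbar p \<le> lam * (2 * osc_const * (1 + norm p))"
          using discounted_near_effective[OF pos(1) _ _ v0, of "\<lambda>y. v y p" "z /\<^sub>R \<epsilon>"] v[of p] by auto
        have "H (z /\<^sub>R \<epsilon>) (p + g) - H (x /\<^sub>R \<epsilon>) (g + fst (G n (x, y)) + a)
          \<le> C * (norm (z /\<^sub>R \<epsilon> - x /\<^sub>R \<epsilon>) + norm ((p + g) - (g + fst (G n (x, y)) + a)))"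
          using lipschitz[of "z /\<^sub>R \<epsilon>" "p + g" "x /\<^sub>R \<epsilon>" "g + fst (G n (x, y)) + a"] by linarith
        also have "\<dots> \<le> C * (E + (2 * \<kappa> / \<epsilon> + \<kappa> + 2 * \<kappa> / e))"
        proof -
          have "norm (z /\<^sub>R \<epsilon> - x /\<^sub>R \<epsilon>) = norm ((z - xh) - (x - xh)) / \<epsilon>"
            unfolding scaleR_diff_right[symmetric] using pos by (simp add: divide_inverse mult.commute)
          also have "\<dots> \<le> 2 * \<kappa> / \<epsilon>"
            using pos close norm_triangle_ineq4[of "z - xh" "x - xh"] by (intro divide_right_mono) auto
          finally have 1: "norm (z /\<^sub>R \<epsilon> - x /\<^sub>R \<epsilon>) \<le> 2 * \<kappa> / \<epsilon>" .
          have "(p + g) - (g + fst (G n (x, y)) + a) = - (d + E *\<^sub>R GN n xh x + a)"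
            unfolding G1 by simp
          then have "norm ((p + g) - (g + fst (G n (x, y)) + a)) = norm (d + E *\<^sub>R GN n xh x + a)"
            by (simp only: norm_minus_cancel)
          also have "\<dots> \<le> norm d + norm (E *\<^sub>R GN n xh x) + norm a"
            by (meson norm_triangle_ineq add_right_mono order_trans)
          finally have "norm ((p + g) - (g + fst (G n (x, y)) + a)) \<le> 2 * \<kappa> / e + E + \<kappa>"
            using d nE[of n xh x] close by linarith
          with 1 show ?thesis using C_pos by (intro mult_left_mono) linarith+
        qed
        also have "\<dots> = C * E + C * (2 * \<kappa> / \<epsilon> + \<kappa> + 2 * \<kappa> / e)" by (rule distrib_left)
        finally have hx: "H (z /\<^sub>R \<epsilon>) (p + g) - H (x /\<^sub>R \<epsilon>) (g + fst (G n (x, y)) + a)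
          \<le> C * E + C * (2 * \<kappa> / \<epsilon> + \<kappa> + 2 * \<kappa> / e)" .
        have "Hbar (p - \<delta> *\<^sub>R yh) \<le> Hbar p + C * (\<delta> * norm yh)"
          using Hbar[of "p - \<delta> *\<^sub>R yh" p] pos by simp
        then show ?thesis using Hb hx super near part unfolding S1_def by linarith
      qed
      show "Hbar (b - snd (G n (x, y))) - H (x /\<^sub>R \<epsilon>) (g + fst (G n (x, y)) + a) \<le> min S1 S2 + e'"
        using le1 le2 by linarith
    qed
  qed
  have cB: "continuous_on UNIV B"
  proof -
    have "continuous_on UNIV (\<lambda>y. v y p)" using v[of p] by (simp add: stat_visc_solution_def)
    then have "continuous_on UNIV (\<lambda>x. v (x /\<^sub>R \<epsilon>) p)"
      by (rule continuous_on_compose2) (auto intro!: continuous_intros)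
    then show ?thesis unfolding B_def by (intro continuous_on_mult continuous_on_const)
  qed
  have bB: "bounded (range B)"
  proof -
    obtain b where "\<And>y. \<bar>v y p\<bar> \<le> b" using v[of p] unfolding bounded_iff real_norm_def by blast
    then have "norm (B x) \<le> \<epsilon> * b" for x using pos by (simp add: B_def abs_mult)
    then show ?thesis unfolding bounded_iff by blast
  qed
  show "\<exists>l. ((\<lambda>r. K \<alpha> r th u xh th - K \<alpha> r th ubar yh th) \<longlongrightarrow> l) (at_right 0) \<and>
      J \<alpha> u xh th - J \<alpha> ubar yh th + l \<le> lam * (2 * osc_const * (1 + norm p)) + C * (\<delta> * norm yh) + 2 * (C * E) \<and>
      J \<alpha> u xh th - J \<alpha> ubar yh th + l \<le> C5 + bound_at_0 + C * norm (p - \<delta> *\<^sub>R yh) + C * E"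
    using nonlocal_comparison_at_maximum[where xh = xh and yh = yh,
        OF \<alpha> u(1) ubar(1) u(2) ubar(2) cB bB CA A_nonneg A_close k_lim pos(5) th frozen bound]
    unfolding S1_def[symmetric] S2_def[symmetric] by auto
qed

end

theorem lemma5p2:
  fixes T \<alpha> \<theta> \<beta> :: real
    and H :: "real ^ 'n \<Rightarrow> real ^ 'n \<Rightarrow> real"
    and Hbar u0 :: "real ^ 'n \<Rightarrow> real"
    and u :: "real \<Rightarrow> (real ^ 'n) \<times> real \<Rightarrow> real"
    and ubar :: "(real ^ 'n) \<times> real \<Rightarrow> real"
    and v :: "real \<Rightarrow> real ^ 'n \<Rightarrow> real ^ 'n \<Rightarrow> real"
  assumes T: "T > 0" and \<alpha>: "\<alpha> \<in> {0<..<1}"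
    and \<theta>: "\<theta> \<in> {0<..<1}" and \<beta>: "\<beta> \<in> {0<..<1}"
    and H_cont: "continuous_on UNIV (\<lambda>(y, p). H y p)"
    and A1: "((\<lambda>r. INF (y, p)\<in>{(y, p). norm p \<ge> r}. ereal (H y p)) \<longlongrightarrow> \<infinity>) at_top"
    and A2: "\<forall>y p k. integer_vec k \<longrightarrow> H (y + k) p = H y p"
    and A3: "\<exists>L. L-lipschitz_on UNIV u0" "BUC_on UNIV u0"
    and A4: "\<exists>C>0. \<forall>x y p q. \<bar>H x p - H y q\<bar> \<le> C * (norm (x - y) + norm (p - q))"
    and A5: "\<exists>C>0. \<forall>x p. H x p \<ge> inverse C * norm p - C"
    and Hbar: "effective_hamiltonian H Hbar"
    and u: "\<forall>\<epsilon>>0. BUC_on (UNIV \<times> {0..T}) (u \<epsilon>) \<and>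
              evol_visc_solution \<alpha> T (\<lambda>x p. H (x /\<^sub>R \<epsilon>) p) u0 (u \<epsilon>)"
    and ubar: "BUC_on (UNIV \<times> {0..T}) ubar"
              "evol_visc_solution \<alpha> T (\<lambda>x p. Hbar p) u0 ubar"
    and v: "\<forall>\<mu>>0. \<forall>p. bounded (range (\<lambda>y. v \<mu> y p)) \<and>
              stat_visc_solution (\<lambda>y r q. \<mu> * r + H y (p + q)) (\<lambda>y. v \<mu> y p)"
  shows "\<exists>\<epsilon>0\<in>{0<..<1}. \<forall>\<nu>\<in>{0<..<1}. \<exists>C>0.
           \<forall>\<epsilon>\<in>{0<..<\<epsilon>0}. \<forall>\<delta>\<in>{0<..<1}. \<forall>R>0. \<forall>xh yh. \<forall>th\<in>{0<..T}.
             sqrt \<delta> < \<epsilon> powr \<theta> \<and>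
             (\<forall>x y. \<forall>t\<in>{0..T}. Phi \<alpha> \<beta> \<epsilon> \<delta> R (u \<epsilon>) ubar (v (\<epsilon> powr \<theta>)) x y t
                \<le> Phi \<alpha> \<beta> \<epsilon> \<delta> R (u \<epsilon>) ubar (v (\<epsilon> powr \<theta>)) xh yh th) \<longrightarrow>
             (\<exists>L. ((\<lambda>r. K \<alpha> r th (u \<epsilon>) xh th - K \<alpha> r th ubar yh th) \<longlongrightarrow> L) (at_right 0) \<and>
                J \<alpha> (u \<epsilon>) xh th - J \<alpha> ubar yh th + L
                  \<le> C * (\<epsilon> powr (\<theta> - \<beta> * (1 - \<nu>) / (2 - \<nu>)) + \<epsilon> powr (1 - \<theta> - \<beta>)))"
proof -
  obtain C where C: "C > 0" "\<And>x y p q. \<bar>H x p - H y q\<bar> \<le> C * (norm (x - y) + norm (p - q))"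
    using A4 by blast
  obtain C5 where C5: "C5 > 0" "\<And>x p. H x p \<ge> inverse C5 * norm p - C5"
    using A5 by blast
  obtain L where L: "L-lipschitz_on UNIV u0" using A3(1) by blast
  interpret H: periodic_hamiltonian H C C5
    by unfold_locales (use A2 C C5 in auto)
  have L0: "L \<ge> 0" by (rule lipschitz_on_nonneg[OF L])
  have Hbar_lip: "\<bar>Hbar p - Hbar q\<bar> \<le> C * norm (p - q)" for p q
    by (rule H.effective_hamiltonian_lipschitz[OF Hbar v])
  have ubar_lip: "ubar (x, t) - ubar (y, t) \<le> L * norm (x - y)" if "t \<in> {0..T}" for x y t
    by (rule evol_solution_lipschitz[OF \<alpha> ubar Hbar_lip L that])
  have usub: "evol_visc_subsolution \<alpha> T (\<lambda>x p. H (x /\<^sub>R \<epsilon>) p) u0 (u \<epsilon>)" and uB: "BUC_on (UNIV \<times> {0..T}) (u \<epsilon>)" if "\<epsilon> > 0" for \<epsilon>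
    using u that unfolding evol_visc_solution_def by blast+
  have bsuper: "evol_visc_supersolution \<alpha> T (\<lambda>x p. Hbar p) u0 ubar"
    using ubar(2) unfolding evol_visc_solution_def by blast+
  have init: "u \<epsilon> (x, 0) = u0 x" if "\<epsilon> > 0" for \<epsilon> x
    using evol_visc_solution_initial u that by blast
  have initb: "ubar (x, 0) = u0 x" for x
    by (rule evol_visc_solution_initial[OF ubar(2)])
  obtain Bb where Bb: "0 \<le> Bb" "\<And>z. z \<in> UNIV \<times> {0..T} \<Longrightarrow> \<bar>ubar z\<bar> \<le> Bb"
    using BUC_on_boundE[OF ubar(1)] by blast
  have u0B: "\<bar>u0 x\<bar> \<le> Bb" for x using Bb(2)[of "(x, 0)"] T initb by simp
  have G1: "Gamma (1 - \<alpha>) > 0" and G2: "Gamma (1 + \<alpha>) > 0" using \<alpha> by (simp_all add: Gamma_real_pos)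
  define Mu where "Mu = Bb + (C5 + 1) * Gamma (1 - \<alpha>) * T powr \<alpha>"
  have upper: "u \<epsilon> (x, t) \<le> Mu" if "\<epsilon> > 0" "t \<in> {0..T}" for \<epsilon> x t
  proof -
    have "u \<epsilon> (x, t) \<le> Bb + (C5 + 1) * Gamma (1 - \<alpha>) * t powr \<alpha>"
      by (rule evol_subsolution_upper_bound[OF \<alpha> uB[OF that(1)] usub[OF that(1)] H.H_lower _ _ that(2)])
         (use C5 u0B in \<open>auto simp: abs_le_iff\<close>)
    also have "\<dots> \<le> Mu"
      unfolding Mu_def using that \<alpha> C5 G1 by (intro add_left_mono mult_left_mono powr_mono2) auto
    finally show ?thesis .
  qed
  define Cv where "Cv = H.bound_at_0 + C + 2 * H.osc_const"
  have Cv0: "Cv \<ge> 0" using H.bound_at_0_nonneg H.osc_const_nonneg C by (simp add: Cv_def)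
  have v_bound: "\<bar>\<mu> * v \<mu> y p\<bar> \<le> Cv * (1 + norm p)" if "0 < \<mu>" "\<mu> \<le> 1" for \<mu> y p
  proof -
    obtain v0 where v0: "cell_solution H p (Hbar p) v0" using Hbar unfolding effective_hamiltonian_def by blast
    have "\<bar>\<mu> * v \<mu> y p + Hbar p\<bar> \<le> \<mu> * (2 * H.osc_const * (1 + norm p))"
      using H.discounted_near_effective[OF that(1) _ _ v0, of "\<lambda>y. v \<mu> y p"] v that by blast
    also have "\<dots> \<le> 1 * (2 * H.osc_const * (1 + norm p))"
      using that H.osc_const_nonneg by (intro mult_right_mono) auto
    finally have "\<bar>\<mu> * v \<mu> y p\<bar> \<le> 2 * H.osc_const * (1 + norm p) + (H.bound_at_0 + C * norm p)"
      using H.cell_constant_bound[OF v0] by linarith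
    also have "\<dots> \<le> Cv * (1 + norm p)"
      using H.bound_at_0_nonneg C by (simp add: Cv_def algebra_simps)
    finally show ?thesis .
  qed
  define M1 where "M1 = \<bar>Mu\<bar> + Bb + 2 * Cv + Cv\<^sup>2 / 2"
  have M1: "M1 \<ge> 0" using Bb Cv0 by (simp add: M1_def)
  define P where "P = L + C + (1 + 2 * M1)"
  have P0: "P \<ge> 0" using L0 C M1 by (simp add: P_def)
  define Ca where "Ca = C5 + H.bound_at_0 + C * L + 2 * C\<^sup>2"
  define Cb where "Cb = 2 * H.osc_const * (1 + P) + C * (1 + 2 * M1)"
  define Cf where "Cf = Ca + Cb + 2 * C\<^sup>2 + 1"
  have Ca0: "Ca \<ge> 0" using C5 H.bound_at_0_nonneg C L0 by (simp add: Ca_def)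
  have Cb0: "Cb \<ge> 0" using H.osc_const_nonneg P0 C M1 by (simp add: Cb_def)
  have Cf0: "Cf > 0" using Ca0 Cb0 by (simp add: Cf_def add_nonneg_pos)
  have main: "\<exists>l. ((\<lambda>r. K \<alpha> r th (u \<epsilon>) xh th - K \<alpha> r th ubar yh th) \<longlongrightarrow> l) (at_right 0) \<and>
      J \<alpha> (u \<epsilon>) xh th - J \<alpha> ubar yh th + l \<le> Cf * (\<epsilon> powr (\<theta> - \<beta> * (1 - \<nu>) / (2 - \<nu>)) + \<epsilon> powr (1 - \<theta> - \<beta>))"
    if \<nu>: "\<nu> \<in> {0<..<1}" and eps: "\<epsilon> \<in> {0<..<1/2}" and \<delta>: "\<delta> \<in> {0<..<1}" and R: "R > 0"
      and th: "th \<in> {0<..T}" and small: "sqrt \<delta> < \<epsilon> powr \<theta>"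
      and max: "\<And>x y t. t \<in> {0..T} \<Longrightarrow> Phi \<alpha> \<beta> \<epsilon> \<delta> R (u \<epsilon>) ubar (v (\<epsilon> powr \<theta>)) x y t
                \<le> Phi \<alpha> \<beta> \<epsilon> \<delta> R (u \<epsilon>) ubar (v (\<epsilon> powr \<theta>)) xh yh th"
    for \<nu> \<epsilon> \<delta> R xh yh th
  proof -
    have e0: "\<epsilon> > 0" "\<epsilon> < 1" using eps by auto
    define lam where "lam = \<epsilon> powr \<theta>"
    define e where "e = \<epsilon> powr \<beta>"
    define s where "s = \<epsilon> powr (1 - \<theta> - \<beta>)"
    define p where "p = (xh - yh) /\<^sub>R e"
    define E where "E = C * \<epsilon> / (lam * e)"
    define c where "c = R / Gamma (1 + \<alpha>)"
    have pos: "lam > 0" "e > 0" "s > 0" "c \<ge> 0" using e0 R G2 by (auto simp: lam_def e_def s_def c_def)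
    have le1: "lam \<le> 1" "e \<le> 1"
      using e0 \<theta> \<beta> powr_le1[of \<theta> \<epsilon>] powr_le1[of \<beta> \<epsilon>] by (auto simp: lam_def e_def)
    have Es: "E = C * s" using e0 by (simp add: E_def s_def lam_def e_def powr_diff)
    have Phi_eq: "Phi \<alpha> \<beta> \<epsilon> \<delta> R (u \<epsilon>) ubar (v (\<epsilon> powr \<theta>)) x y t =
       u \<epsilon> (x, t) - ubar (y, t) - \<epsilon> * v lam (x /\<^sub>R \<epsilon>) ((x - y) /\<^sub>R e) - (norm (x - y))\<^sup>2 / (2 * e)
         - \<delta> * (norm y)\<^sup>2 / 2 - c * t powr \<alpha>" for x y t
      by (simp add: Phi_def lam_def e_def c_def)
    note mx = max[unfolded Phi_eq]
    have v': "\<And>p. bounded (range (\<lambda>y. v lam y p)) \<and>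
        stat_visc_solution (\<lambda>y r q. lam * r + H y (p + q)) (\<lambda>y. v lam y p)"
      using v pos by blast
    have d0: "\<delta> > 0" using \<delta> by simp
    note est = H.corrected_maximum_estimate[OF \<alpha> uB[OF e0(1)] usub[OF e0(1)] ubar(1) bsuper Hbar Hbar_lip
        ubar_lip v' pos(1) e0(1) pos(2) d0 pos(4) th mx p_def E_def]
    obtain l where l: "((\<lambda>r. K \<alpha> r th (u \<epsilon>) xh th - K \<alpha> r th ubar yh th) \<longlongrightarrow> l) (at_right 0)"
      and l1: "J \<alpha> (u \<epsilon>) xh th - J \<alpha> ubar yh th + l
          \<le> lam * (2 * H.osc_const * (1 + norm p)) + C * (\<delta> * norm yh) + 2 * (C * E)"
      and l2: "J \<alpha> (u \<epsilon>) xh th - J \<alpha> ubar yh th + l \<le> C5 + H.bound_at_0 + C * norm (p - \<delta> *\<^sub>R yh) + C * E"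
      using est(2) by blast
    define \<phi> where "\<phi> = \<epsilon> powr (\<theta> - \<beta> * (1 - \<nu>) / (2 - \<nu>))"
    \<comment> \<open>The exponent \<open>\<theta>\<close> is at least the one in the claim, and \<open>\<epsilon> < 1\<close>.\<close>
    have \<phi>: "lam \<le> \<phi>"
    proof -
      have "0 \<le> \<beta> * (1 - \<nu>) / (2 - \<nu>)" using \<beta> \<nu> by simp
      then show ?thesis unfolding lam_def \<phi>_def using e0 by (intro powr_mono') auto
    qed
    have \<phi>0: "\<phi> \<ge> 0" by (simp add: \<phi>_def)
    have "J \<alpha> (u \<epsilon>) xh th - J \<alpha> ubar yh th + l \<le> Cf * (\<phi> + s)"
    proof (cases "1 - \<theta> - \<beta> \<ge> 0")
      case False
      \<comment> \<open>The bound to be shown is then bounded away from \<open>0\<close>, so that lower boundedness of \<open>H\<close> is enough.\<close>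
      have s1: "s \<ge> 1"
        unfolding s_def using False e0 powr_mono'[of "1 - \<theta> - \<beta>" 0 \<epsilon>] by simp
      have "C * norm (p - \<delta> *\<^sub>R yh) \<le> C * (L + C * s)"
        using est(1) C unfolding Es by (intro mult_left_mono) auto
      then have "J \<alpha> (u \<epsilon>) xh th - J \<alpha> ubar yh th + l \<le> (C5 + H.bound_at_0 + C * L) * 1 + 2 * C\<^sup>2 * s"
        using l2 unfolding Es by (simp add: power2_eq_square algebra_simps)
      also have "\<dots> \<le> (C5 + H.bound_at_0 + C * L) * s + 2 * C\<^sup>2 * s"
        using s1 C5 H.bound_at_0_nonneg C L0 by (intro add_right_mono mult_left_mono) auto
      also have "\<dots> = Ca * s" by (simp add: Ca_def algebra_simps)
      also have "\<dots> \<le> Cf * (\<phi> + s)"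
        using Cb0 \<phi>0 Ca0 pos by (intro mult_mono) (auto simp: Cf_def)
      finally show ?thesis .
    next
      case True
      have s1: "s \<le> 1" unfolding s_def using True e0 by (intro powr_le1) auto
      have ratio: "\<epsilon> / lam \<le> e"
      proof -
        have "\<epsilon> / lam = s * e" using e0 by (simp add: s_def lam_def e_def powr_diff)
        also have "\<dots> \<le> 1 * e" using s1 pos by (intro mult_right_mono) auto
        finally show ?thesis by simp
      qed
      have vb: "\<bar>\<epsilon> * v lam y q\<bar> \<le> e * (Cv * (1 + norm q))" for y q
      proof -
        have "\<bar>\<epsilon> * v lam y q\<bar> = (\<epsilon> / lam) * \<bar>lam * v lam y q\<bar>"
          using pos e0 by (simp add: abs_mult)
        also have "\<dots> \<le> e * (Cv * (1 + norm q))"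
          using ratio v_bound[OF pos(1) le1(1), of y q] pos by (intro mult_mono) auto
        finally show ?thesis .
      qed
      \<comment> \<open>Comparison with the value at the origin, where \<open>u \<epsilon>\<close> and \<open>ubar\<close> agree initially. The corrector
         grows linearly in \<open>p\<close> and is absorbed by the quadratic term since \<open>\<epsilon> / lam \<le> \<epsilon>\<^sup>\<beta>\<close>.\<close>
      have yh: "\<delta> * (norm yh)\<^sup>2 \<le> 2 * M1"
      proof -
        have th0: "th \<in> {0..T}" using th by auto
        have n2: "(norm (xh - yh))\<^sup>2 / (2 * e) = e * ((norm p)\<^sup>2 / 2)"
        proof -
          have "norm (xh - yh) = e * norm p" using pos by (simp add: p_def)
          then show ?thesis using pos by (simp add: power2_eq_square field_simps)
        qed
        have "- (\<epsilon> * v lam 0 0) \<le> u \<epsilon> (xh, th) - ubar (yh, th) - \<epsilon> * v lam (xh /\<^sub>R \<epsilon>) p - e * ((norm p)\<^sup>2 / 2)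
            - \<delta> * (norm yh)\<^sup>2 / 2 - c * th powr \<alpha>"
          using mx[of 0 0 0] T \<alpha> init[OF e0(1)] initb unfolding n2 p_def[symmetric] by simp
        moreover have "0 \<le> c * th powr \<alpha>" using pos by simp
        moreover have "u \<epsilon> (xh, th) \<le> \<bar>Mu\<bar>" using upper[OF e0(1) th0, of xh] by linarith
        moreover have "- ubar (yh, th) \<le> Bb" using Bb(2)[of "(yh, th)"] th0 by (auto simp: abs_le_iff)
        moreover have "\<epsilon> * v lam 0 0 \<le> Cv"
        proof -
          have "\<epsilon> * v lam 0 0 \<le> e * Cv" using vb[of 0 0] by simp
          also have "\<dots> \<le> 1 * Cv" using le1 Cv0 by (intro mult_right_mono) auto
          finally show ?thesis by simp
        qed
        moreover have "- (\<epsilon> * v lam (xh /\<^sub>R \<epsilon>) p) - e * ((norm p)\<^sup>2 / 2) \<le> Cv + Cv\<^sup>2 / 2"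
        proof -
          have "- (\<epsilon> * v lam (xh /\<^sub>R \<epsilon>) p) - e * ((norm p)\<^sup>2 / 2) \<le> e * (Cv * (1 + norm p)) - e * ((norm p)\<^sup>2 / 2)"
            using vb[of "xh /\<^sub>R \<epsilon>" p] by linarith
          also have "\<dots> = e * (Cv + (Cv * norm p - (norm p)\<^sup>2 / 2))" by (simp add: algebra_simps)
          also have "\<dots> \<le> e * (Cv + Cv\<^sup>2 / 2)"
          proof -
            have "0 \<le> (Cv - norm p)\<^sup>2" by simp
            then have "Cv * norm p - (norm p)\<^sup>2 / 2 \<le> Cv\<^sup>2 / 2" by (simp add: power2_diff)
            then show ?thesis using pos by (intro mult_left_mono) auto
          qed
          also have "\<dots> \<le> 1 * (Cv + Cv\<^sup>2 / 2)" using le1 Cv0 by (intro mult_right_mono) auto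
          finally show ?thesis by simp
        qed
        moreover have "Y \<le> 2 * (m + b + 2 * k + w)"
          if "- a \<le> U - W - V - q - Y / 2 - r" "0 \<le> r" "U \<le> m" "- W \<le> b" "a \<le> k" "- V - q \<le> k + w"
          for a U W V q Y r m b k w :: real
          using that by argo
        ultimately show ?thesis unfolding M1_def by blast
      qed
      have yh': "\<delta> * norm yh \<le> lam * (1 + 2 * M1)"
      proof (rule scaled_norm_le_of_square[OF yh])
        have "\<delta> \<le> lam\<^sup>2"
        proof -
          have "\<delta> = (sqrt \<delta>)\<^sup>2" using d0 by simp
          also have "\<dots> \<le> lam\<^sup>2" using small d0 unfolding lam_def by (intro power_mono) auto
          finally show ?thesis .
        qed
        moreover have "2 * M1 \<le> (1 + 2 * M1)\<^sup>2" using M1 by (simp add: power2_sum)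
        ultimately have "\<delta> * (2 * M1) \<le> lam\<^sup>2 * (1 + 2 * M1)\<^sup>2" using M1 d0 by (intro mult_mono) auto
        then show "\<delta> * (2 * M1) \<le> (lam * (1 + 2 * M1))\<^sup>2" by (simp add: power_mult_distrib)
      qed (use d0 pos M1 in auto)
      have "norm p \<le> norm (p - \<delta> *\<^sub>R yh) + norm (\<delta> *\<^sub>R yh)" by (metis norm_triangle_sub add.commute)
      also have "\<dots> \<le> (L + C * 1) + 1 * (1 + 2 * M1)"
      proof (intro add_mono)
        show "norm (p - \<delta> *\<^sub>R yh) \<le> L + C * 1"
          using est(1) mult_left_mono[OF s1, of C] C unfolding Es by linarith
        have "lam * (1 + 2 * M1) \<le> 1 * (1 + 2 * M1)" using le1 M1 by (intro mult_right_mono) auto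
        then show "norm (\<delta> *\<^sub>R yh) \<le> 1 * (1 + 2 * M1)" using yh' d0 by simp
      qed
      finally have pP: "norm p \<le> P" by (simp add: P_def)
      have "lam * (2 * H.osc_const * (1 + norm p)) + C * (\<delta> * norm yh) + 2 * (C * E)
         \<le> lam * (2 * H.osc_const * (1 + P)) + C * (lam * (1 + 2 * M1)) + 2 * (C * E)"
        using pP yh' pos H.osc_const_nonneg C by (intro add_right_mono add_mono mult_left_mono) auto
      also have "\<dots> = Cb * lam + 2 * C\<^sup>2 * s" by (simp add: Cb_def Es power2_eq_square algebra_simps)
      also have "\<dots> \<le> Cf * \<phi> + Cf * s"
        using \<phi> pos Cf0 Ca0 Cb0 by (intro add_mono mult_mono) (auto simp: Cf_def)
      finally show ?thesis using l1 by (simp add: distrib_left)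
    qed
    with l show ?thesis unfolding \<phi>_def s_def by blast
  qed
  show ?thesis
  proof (rule bexI[of _ "1 / 2"], rule ballI, rule exI[of _ Cf], rule conjI[OF Cf0], intro ballI allI impI)
    fix \<nu> \<epsilon> \<delta> R xh yh th
    assume a: "\<nu> \<in> {0<..<1::real}" "\<epsilon> \<in> {0<..<1/2::real}" "\<delta> \<in> {0<..<1::real}" "(0::real) < R" "th \<in> {0<..T}"
      and b: "sqrt \<delta> < \<epsilon> powr \<theta> \<and>
       (\<forall>x y. \<forall>t\<in>{0..T}. Phi \<alpha> \<beta> \<epsilon> \<delta> R (u \<epsilon>) ubar (v (\<epsilon> powr \<theta>)) x y t
          \<le> Phi \<alpha> \<beta> \<epsilon> \<delta> R (u \<epsilon>) ubar (v (\<epsilon> powr \<theta>)) xh yh th)"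
    show "\<exists>L. ((\<lambda>r. K \<alpha> r th (u \<epsilon>) xh th - K \<alpha> r th ubar yh th) \<longlongrightarrow> L) (at_right 0) \<and>
                J \<alpha> (u \<epsilon>) xh th - J \<alpha> ubar yh th + L
                  \<le> Cf * (\<epsilon> powr (\<theta> - \<beta> * (1 - \<nu>) / (2 - \<nu>)) + \<epsilon> powr (1 - \<theta> - \<beta>))"
      using b by (intro main[OF a(1-5)]) auto
  qed auto
qed

end
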